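(* Let $\Omega_P\subset\mathbb{R}^d$ be a bounded Lipschitz domain, $T>0$, $\nu>0$, and let $f:\mathbb{R}\to\mathbb{R}^d$ be continuously differentiable. Let $u^{\nu}$ be an exact (scalar) solution of $$u^{\nu}_t+\nabla\cdot f(u^{\nu})=\nu\Delta u^{\nu}\quad\text{on }\Omega_P\times(0,T),$$ subject to either homogeneous Dirichlet boundary conditions ($u^\nu=0$ on $\partial\Omega_P$) or periodic boundary conditions. Let $u$ be a scalar function on $\Omega_P\times(0,T)$ that exactly satisfies the same boundary conditions; in the periodic case assume in addition that $u$ and $u^\nu$ have the same spatial mean for every $t\in[0,T]$. Define the residual $$\mathcal{R}(u):=u_t+\nabla\cdot f(u)-\nu\Delta u .$$ Suppose that $u\in L^2(0,T;H^1(\Omega_P))$, $u_t\in L^2(0,T;H^{-1}(\Omega_P))$ and $\mathcal{R}(u)\in L^2(0,T;L^2(\Omega_P))$, and that $u$ and $u^\nu$ take values in a common bounded interval $I\subset\mathbb{R}$. Then for all $t\in[0,T]$ the error $e:=u^\nu-u$ satisfies $$\|e(t)\|_{L^2(\Omega_P)}\le\exp\!\left(\frac{L_f^2}{2\nu}\,t\right)\left[\|e(0)\|_{L^2(\Omega_P)}+\frac{C_P}{\sqrt{\nu}}\,\|\mathcal{R}(u)\|_{L^2(0,t;\,L^2(\Omega_P))}\right],$$ where $C_P>0$ is the Poincaré constant, depending only on $\Omega_P$ and the boundary condition, and $L_f:=\sup_{s\in I}\|f'(s)\|_{\mathbb{R}^d}$ with $\|\cdot\|_{\mathbb{R}^d}$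 the Euclidean norm.
   Context: Let $V=H^1_0(\Omega_P)$ in the Dirichlet case; in the periodic case $\Omega_P$ is a periodicity box and $V=H^1_{\mathrm{per}}(\Omega_P)$ is the space of periodic $H^1$ functions. $H^{-1}(\Omega_P)$ denotes the dual of $V$. Satisfying the boundary conditions means $u(t),u^\nu(t)\in V$ for a.e. $t$. The exact solution $u^\nu$ is understood as a weak solution with $u^\nu\in L^2(0,T;V)$, $u^\nu_t\in L^2(0,T;H^{-1}(\Omega_P))$, the equation holding when tested against every element of $V$ for a.e. $t$; likewise the defining identity of $\mathcal{R}(u)$ is understood as an identity in $H^{-1}(\Omega_P)$ for a.e. $t$, with the divergence and Laplacian terms interpreted weakly, i.e. $\langle \nabla\cdot f(u),v\rangle=-\int_{\Omega_P} f(u)\cdot\nabla v\,\mathrm{d}\mathbf{x}$ and $\langle\Delta u,v\rangle=-\int_{\Omega_P}\nabla u\cdot\nabla v\,\mathrm{d}\mathbf{x}$ for $v\in V$. Functions in this class are identified with their representatives in $C([0,T];L^2(\Omega_P))$, so that $e(t)$ is defined for every $t\in[0,T]$. The Poincaré constant $C_P$ is a constant with $\|v\|_{L^2(\Omega_P)}\le C_P\|\nabla v\|_{L^2(\Omega_P)}$ for all $v\in H^1_0(\Omega_P)$ (Dirichlet case), respectively for all $v\in H^1_{\mathrm{per}}(\Omega_P)$ with zero mean (periodic case). *)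

theory Defs
  imports "HOL-Analysis.Analysis"
begin

section \<open>Domains and test functions\<close>

text \<open>
  The ambient space \<open>\<real>\<^sup>d\<close> is a type of class \<open>euclidean_space\<close>, with \<open>d = DIM('a)\<close>.
  Near each boundary point, a Lipschitz domain is the strict epigraph, in some direction \<open>n\<close>,
  of a Lipschitz function \<open>\<gamma>\<close> on the hyperplane orthogonal to \<open>n\<close>.
\<close>

definition lipschitz_domain :: "'a::euclidean_space set \<Rightarrow> bool" where
  "lipschitz_domain \<Omega> \<longleftrightarrow> open \<Omega> \<and> connected \<Omega> \<and> \<Omega> \<noteq> {} \<and>
     (\<forall>p\<in>frontier \<Omega>. \<exists>r>0. \<exists>n L \<gamma>. norm n = 1 \<and> L-lipschitz_on {y. y \<bullet> n = 0} \<gamma> \<and>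
        \<Omega> \<inter> ball p r = {x \<in> ball p r. x \<bullet> n > (\<gamma> (x - (x \<bullet> n) *\<^sub>R n) :: real)})"

primrec Ck_fun :: "nat \<Rightarrow> ('a::euclidean_space \<Rightarrow> real) \<Rightarrow> bool" where
  "Ck_fun 0 \<phi> \<longleftrightarrow> continuous_on UNIV \<phi>"
| "Ck_fun (Suc k) \<phi> \<longleftrightarrow> (\<forall>x. \<phi> differentiable at x) \<and>
     (\<forall>i\<in>Basis. Ck_fun k (\<lambda>x. frechet_derivative \<phi> (at x) i))"

definition test_function :: "'a::euclidean_space set \<Rightarrow> ('a \<Rightarrow> real) \<Rightarrow> bool" where
  "test_function \<Omega> \<phi> \<longleftrightarrow> (\<forall>k. Ck_fun k \<phi>) \<and>
     compact (closure {x. \<phi> x \<noteq> 0}) \<and> closure {x. \<phi> x \<noteq> 0} \<subseteq> \<Omega>"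


section \<open>Lebesgue and Sobolev spaces\<close>

text \<open>
  Elements of function spaces are represented by functions on the whole space, of which only the
  restriction to \<open>\<Omega>\<close>, up to null sets, matters; all norms below are therefore seminorms on
  representatives.
\<close>

definition L2_space :: "'a::euclidean_space set \<Rightarrow> ('a \<Rightarrow> 'b::euclidean_space) set" where
  "L2_space \<Omega> = {v \<in> borel_measurable (lebesgue_on \<Omega>). integrable (lebesgue_on \<Omega>) (\<lambda>x. (norm (v x))\<^sup>2)}"

definition L2_norm :: "'a::euclidean_space set \<Rightarrow> ('a \<Rightarrow> 'b::euclidean_space) \<Rightarrow> real" where
  "L2_norm \<Omega> v = sqrt (LINT x|lebesgue_on \<Omega>. (norm (v x))\<^sup>2)"

definition has_weak_gradient ::
  "'a::euclidean_space set \<Rightarrow> ('a \<Rightarrow> real) \<Rightarrow> ('a \<Rightarrow> 'a) \<Rightarrow> bool" where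
  "has_weak_gradient \<Omega> v g \<longleftrightarrow> g \<in> L2_space \<Omega> \<and>
     (\<forall>\<phi> i. test_function \<Omega> \<phi> \<longrightarrow> i \<in> Basis \<longrightarrow>
        (LINT x|lebesgue_on \<Omega>. v x * frechet_derivative \<phi> (at x) i)
        = - (LINT x|lebesgue_on \<Omega>. (g x \<bullet> i) * \<phi> x))"

definition H1 :: "'a::euclidean_space set \<Rightarrow> ('a \<Rightarrow> real) set" where
  "H1 \<Omega> = {v \<in> L2_space \<Omega>. \<exists>g. has_weak_gradient \<Omega> v g}"

text \<open>The weak gradient is unique almost everywhere on \<open>\<Omega>\<close>; an arbitrary version is chosen.\<close>

definition wgrad :: "'a::euclidean_space set \<Rightarrow> ('a \<Rightarrow> real) \<Rightarrow> 'a \<Rightarrow> 'a" where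
  "wgrad \<Omega> v = (SOME g. has_weak_gradient \<Omega> v g)"

definition H1_norm :: "'a::euclidean_space set \<Rightarrow> ('a \<Rightarrow> real) \<Rightarrow> real" where
  "H1_norm \<Omega> v = sqrt ((L2_norm \<Omega> v)\<^sup>2 + (L2_norm \<Omega> (wgrad \<Omega> v))\<^sup>2)"

definition H1_0 :: "'a::euclidean_space set \<Rightarrow> ('a \<Rightarrow> real) set" where
  "H1_0 \<Omega> = {v \<in> H1 \<Omega>. \<exists>\<phi>::nat \<Rightarrow> 'a \<Rightarrow> real. (\<forall>n. test_function \<Omega> (\<phi> n)) \<and>
     (\<lambda>n. H1_norm \<Omega> (\<lambda>x. v x - \<phi> n x)) \<longlonglongrightarrow> 0}"

text \<open>
  Periodic \<open>H\<^sup>1\<close> functions on the box with corners \<open>a\<close>, \<open>b\<close>: restrictions to the box of functions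
  in \<open>H\<^sup>1\<^sub>l\<^sub>o\<^sub>c(\<real>\<^sup>d)\<close> that are periodic with the side length of the box in each coordinate direction.
\<close>

definition box_periodic :: "'a::euclidean_space \<Rightarrow> 'a \<Rightarrow> ('a \<Rightarrow> real) \<Rightarrow> bool" where
  "box_periodic a b w \<longleftrightarrow> (\<forall>i\<in>Basis. \<forall>x. w (x + ((b - a) \<bullet> i) *\<^sub>R i) = w x)"

definition H1_per :: "'a::euclidean_space \<Rightarrow> 'a \<Rightarrow> ('a \<Rightarrow> real) set" where
  "H1_per a b = {v \<in> H1 (box a b). \<exists>w. box_periodic a b w \<and> (\<forall>r>0. w \<in> H1 (ball 0 r)) \<and>
     (AE x in lebesgue_on (box a b). v x = w x)}"

definition spatial_mean :: "'a::euclidean_space set \<Rightarrow> ('a \<Rightarrow> real) \<Rightarrow> real" where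
  "spatial_mean \<Omega> v = (LINT x|lebesgue_on \<Omega>. v x) / measure lebesgue \<Omega>"


section \<open>Boundary conditions\<close>

text \<open>\<open>Periodic a b\<close> carries the corners of the periodicity box.\<close>

datatype 'a boundary_condition = Dirichlet | Periodic 'a 'a

fun admissible_domain :: "'a::euclidean_space boundary_condition \<Rightarrow> 'a set \<Rightarrow> bool" where
  "admissible_domain Dirichlet \<Omega> \<longleftrightarrow> True"
| "admissible_domain (Periodic a b) \<Omega> \<longleftrightarrow> \<Omega> = box a b"

fun bc_space :: "'a::euclidean_space boundary_condition \<Rightarrow> 'a set \<Rightarrow> ('a \<Rightarrow> real) set" where
  "bc_space Dirichlet \<Omega> = H1_0 \<Omega>"
| "bc_space (Periodic a b) \<Omega> = H1_per a b"

fun poincare_constant :: "'a::euclidean_space boundary_condition \<Rightarrow> 'a set \<Rightarrow> real \<Rightarrow> bool" where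
  "poincare_constant Dirichlet \<Omega> C \<longleftrightarrow> C > 0 \<and>
     (\<forall>v\<in>H1_0 \<Omega>. L2_norm \<Omega> v \<le> C * L2_norm \<Omega> (wgrad \<Omega> v))"
| "poincare_constant (Periodic a b) \<Omega> C \<longleftrightarrow> C > 0 \<and>
     (\<forall>v\<in>H1_per a b. spatial_mean \<Omega> v = 0 \<longrightarrow> L2_norm \<Omega> v \<le> C * L2_norm \<Omega> (wgrad \<Omega> v))"


section \<open>Dual spaces and Bochner spaces\<close>

text \<open>
  Functionals are total functions on representatives; only their values on \<open>V\<close> matter.  The
  boundedness condition makes them respect equality almost everywhere.
\<close>

definition dual_space ::
  "'a::euclidean_space set \<Rightarrow> ('a \<Rightarrow> real) set \<Rightarrow> (('a \<Rightarrow> real) \<Rightarrow> real) set" where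
  "dual_space \<Omega> V = {F. (\<forall>v\<in>V. \<forall>w\<in>V. F (\<lambda>x. v x + w x) = F v + F w) \<and>
     (\<forall>c. \<forall>v\<in>V. F (\<lambda>x. c * v x) = c * F v) \<and>
     (\<exists>C. \<forall>v\<in>V. \<bar>F v\<bar> \<le> C * H1_norm \<Omega> v)}"

definition dual_norm ::
  "'a::euclidean_space set \<Rightarrow> ('a \<Rightarrow> real) set \<Rightarrow> (('a \<Rightarrow> real) \<Rightarrow> real) \<Rightarrow> real" where
  "dual_norm \<Omega> V F = (SUP v\<in>{v\<in>V. H1_norm \<Omega> v \<le> 1}. \<bar>F v\<bar>)"

text \<open>
  \<open>L\<^sup>2(0,T;X)\<close> for a space \<open>X\<close> of real functions (or of functionals) with norm \<open>N\<close>: Bochner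
  measurability means being an almost everywhere limit of \<open>X\<close>-valued simple functions.
\<close>

definition bochner_measurable ::
  "('b \<Rightarrow> real) set \<Rightarrow> (('b \<Rightarrow> real) \<Rightarrow> real) \<Rightarrow> real measure \<Rightarrow> (real \<Rightarrow> 'b \<Rightarrow> real) \<Rightarrow> bool" where
  "bochner_measurable X N M w \<longleftrightarrow>
     (\<exists>s. (\<forall>n::nat. simple_function M (s n) \<and> (\<forall>t\<in>space M. s n t \<in> X)) \<and>
          (AE t in M. (\<lambda>n. N (\<lambda>x. w t x - s n t x)) \<longlonglongrightarrow> 0))"

definition bochner_L2 ::
  "('b \<Rightarrow> real) set \<Rightarrow> (('b \<Rightarrow> real) \<Rightarrow> real) \<Rightarrow> real \<Rightarrow> (real \<Rightarrow> 'b \<Rightarrow> real) set" where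
  "bochner_L2 X N T = {w. (AE t in lebesgue_on {0<..<T}. w t \<in> X) \<and>
     bochner_measurable X N (lebesgue_on {0<..<T}) w \<and>
     integrable (lebesgue_on {0<..<T}) (\<lambda>t. (N (w t))\<^sup>2)}"

definition bochner_L2_norm ::
  "(('b \<Rightarrow> real) \<Rightarrow> real) \<Rightarrow> real \<Rightarrow> (real \<Rightarrow> 'b \<Rightarrow> real) \<Rightarrow> real" where
  "bochner_L2_norm N T w = sqrt (LINT t|lebesgue_on {0<..<T}. (N (w t))\<^sup>2)"

definition continuous_L2 ::
  "'a::euclidean_space set \<Rightarrow> real \<Rightarrow> (real \<Rightarrow> 'a \<Rightarrow> real) \<Rightarrow> bool" where
  "continuous_L2 \<Omega> T w \<longleftrightarrow> (\<forall>t\<in>{0..T}. w t \<in> L2_space \<Omega>) \<and>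
     (\<forall>s\<in>{0..T}. ((\<lambda>t. L2_norm \<Omega> (\<lambda>x. w t x - w s x)) \<longlongrightarrow> 0) (at s within {0..T}))"

text \<open>
  Distributional time derivative with values in the dual of \<open>V\<close>, where \<open>w(t)\<close> acts on \<open>V\<close>
  through the \<open>L\<^sup>2\<close> inner product.
\<close>

definition has_weak_time_derivative ::
  "'a::euclidean_space set \<Rightarrow> ('a \<Rightarrow> real) set \<Rightarrow> real \<Rightarrow> (real \<Rightarrow> 'a \<Rightarrow> real) \<Rightarrow>
    (real \<Rightarrow> ('a \<Rightarrow> real) \<Rightarrow> real) \<Rightarrow> bool" where
  "has_weak_time_derivative \<Omega> V T w w' \<longleftrightarrow>
     (\<forall>v\<in>V. \<forall>\<psi>. test_function {0<..<T} \<psi> \<longrightarrow>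
        (LINT t|lebesgue_on {0<..<T}. (LINT x|lebesgue_on \<Omega>. w t x * v x) * deriv \<psi> t)
        = - (LINT t|lebesgue_on {0<..<T}. w' t v * \<psi> t))"

text \<open>
  \<open>w \<in> L\<^sup>2(0,T;X)\<close> with time derivative \<open>w'\<close> in \<open>L\<^sup>2(0,T;V\<^sup>*)\<close>, where \<open>X\<close> is \<open>V\<close> or all of \<open>H\<^sup>1(\<Omega>)\<close>,
  and \<open>w\<close> is the representative in \<open>C([0,T];L\<^sup>2(\<Omega>))\<close>.
\<close>

definition evolution_class ::
  "'a::euclidean_space set \<Rightarrow> ('a \<Rightarrow> real) set \<Rightarrow> ('a \<Rightarrow> real) set \<Rightarrow> real \<Rightarrow>
    (real \<Rightarrow> 'a \<Rightarrow> real) \<Rightarrow> (real \<Rightarrow> ('a \<Rightarrow> real) \<Rightarrow> real) \<Rightarrow> bool" where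
  "evolution_class \<Omega> V X T w w' \<longleftrightarrow>
     w \<in> bochner_L2 X (H1_norm \<Omega>) T \<and>
     w' \<in> bochner_L2 (dual_space \<Omega> V) (dual_norm \<Omega> V) T \<and>
     has_weak_time_derivative \<Omega> V T w w' \<and>
     continuous_L2 \<Omega> T w"


section \<open>The viscous conservation law\<close>

definition weak_div ::
  "'a::euclidean_space set \<Rightarrow> ('a \<Rightarrow> 'a) \<Rightarrow> ('a \<Rightarrow> real) \<Rightarrow> real" where
  "weak_div \<Omega> F v = - (LINT x|lebesgue_on \<Omega>. F x \<bullet> wgrad \<Omega> v x)"

definition weak_laplacian ::
  "'a::euclidean_space set \<Rightarrow> ('a \<Rightarrow> real) \<Rightarrow> ('a \<Rightarrow> real) \<Rightarrow> real" where
  "weak_laplacian \<Omega> w v = - (LINT x|lebesgue_on \<Omega>. wgrad \<Omega> w x \<bullet> wgrad \<Omega> v x)"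

text \<open>The functional \<open>w\<^sub>t + \<nabla>\<cdot>f(w) - \<nu>\<Delta>w\<close> at time \<open>t\<close>, applied to \<open>v\<close>.\<close>

definition residual_functional ::
  "'a::euclidean_space set \<Rightarrow> real \<Rightarrow> (real \<Rightarrow> 'a) \<Rightarrow> (real \<Rightarrow> 'a \<Rightarrow> real) \<Rightarrow>
    (real \<Rightarrow> ('a \<Rightarrow> real) \<Rightarrow> real) \<Rightarrow> real \<Rightarrow> ('a \<Rightarrow> real) \<Rightarrow> real" where
  "residual_functional \<Omega> \<nu> f w w' t v =
     w' t v + weak_div \<Omega> (\<lambda>x. f (w t x)) v - \<nu> * weak_laplacian \<Omega> (w t) v"

definition weak_solution ::
  "'a::euclidean_space set \<Rightarrow> ('a \<Rightarrow> real) set \<Rightarrow> real \<Rightarrow> real \<Rightarrow> (real \<Rightarrow> 'a) \<Rightarrow>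
    (real \<Rightarrow> 'a \<Rightarrow> real) \<Rightarrow> (real \<Rightarrow> ('a \<Rightarrow> real) \<Rightarrow> real) \<Rightarrow> bool" where
  "weak_solution \<Omega> V T \<nu> f w w' \<longleftrightarrow> evolution_class \<Omega> V V T w w' \<and>
     (AE t in lebesgue_on {0<..<T}. \<forall>v\<in>V. residual_functional \<Omega> \<nu> f w w' t v = 0)"

text \<open>The residual of \<open>w\<close> is (represented by) the function \<open>R \<in> L\<^sup>2(0,T;L\<^sup>2(\<Omega>))\<close>.\<close>

definition has_L2_residual ::
  "'a::euclidean_space set \<Rightarrow> ('a \<Rightarrow> real) set \<Rightarrow> real \<Rightarrow> real \<Rightarrow> (real \<Rightarrow> 'a) \<Rightarrow>
    (real \<Rightarrow> 'a \<Rightarrow> real) \<Rightarrow> (real \<Rightarrow> ('a \<Rightarrow> real) \<Rightarrow> real) \<Rightarrow> (real \<Rightarrow> 'a \<Rightarrow> real) \<Rightarrow> bool" where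
  "has_L2_residual \<Omega> V T \<nu> f w w' R \<longleftrightarrow> R \<in> bochner_L2 (L2_space \<Omega>) (L2_norm \<Omega>) T \<and>
     (AE t in lebesgue_on {0<..<T}. \<forall>v\<in>V.
        residual_functional \<Omega> \<nu> f w w' t v = (LINT x|lebesgue_on \<Omega>. R t x * v x))"

end

theory Submission
  imports Defs
begin

text \<open>
  The error \<open>e = u\<nu> - u\<close> satisfies \<open>e\<^sub>t + \<nabla>\<cdot>(f(u\<nu>) - f(u)) - \<nu>\<Delta>e = -R\<close> in the dual of \<open>V\<close>.
  Tested with \<open>e\<close> itself, the flux term is bounded by \<open>L \<parallel>e\<parallel> \<parallel>\<nabla>e\<parallel>\<close> because \<open>f\<close> is Lipschitz on \<open>I\<close>, and
  the residual term by \<open>C \<parallel>R\<parallel> \<parallel>\<nabla>e\<parallel>\<close> because of the Poincare inequality.  Young's inequality absorbs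
  \<open>\<parallel>\<nabla>e\<parallel>\<close> into \<open>\<nu>\<parallel>\<nabla>e\<parallel>\<^sup>2\<close> and leaves \<open>2 \<langle>e\<^sub>t, e\<rangle> \<le> L\<^sup>2/\<nu> \<parallel>e\<parallel>\<^sup>2 + C\<^sup>2/\<nu> \<parallel>R\<parallel>\<^sup>2\<close> at almost every
  time (\<open>residual_error_estimate\<close>).  Once the left-hand side is known to control the increments of
  \<open>\<parallel>e\<parallel>\<^sup>2\<close>, Gronwall's inequality and \<open>\<surd>(x\<^sup>2 + y\<^sup>2) \<le> x + y\<close> give the claim.

  The analytic core is therefore the chain rule for \<open>\<parallel>e(t)\<parallel>\<^sup>2\<close> when \<open>e\<^sub>t\<close> exists only in the dual of \<open>V\<close>,
  in the one-sided form \<open>\<parallel>e(b)\<parallel>\<^sup>2 - \<parallel>e(a)\<parallel>\<^sup>2 \<le> 2 \<integral>\<langle>e\<^sub>t, e\<rangle>\<close> (\<open>energy_inequality\<close>).  It starts from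
  \<open>\<parallel>e(t)\<parallel>\<^sup>2 - \<parallel>e(t-h)\<parallel>\<^sup>2 \<le> 2 (e(t) - e(t-h), e(t))\<close>, integrated over \<open>(a,b]\<close> and divided by \<open>h\<close>.
  For a fixed \<open>v \<in> V\<close> the quotient \<open>(e(t) - e(t-h), v)/h\<close> is the mean of \<open>\<langle>e\<^sub>t, v\<rangle>\<close> over \<open>(t-h,t]\<close>, hence
  bounded by \<open>\<delta>\<close> times the mean of \<open>\<mu>\<close> plus \<open>\<parallel>v\<parallel>\<^sup>2/\<delta>\<close>, where \<open>\<mu>\<close> is the squared dual norm of the time
  derivative.  Integrated over \<open>t\<close>, this bound is uniform in \<open>h\<close>.  So the second slot \<open>e(t)\<close> may be
  replaced by a simple function with values in \<open>V\<close> that is close to \<open>e\<close> in \<open>L\<^sup>2(0,T;V)\<close>, at a cost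
  independent of \<open>h\<close>, and for a simple function the limit \<open>h \<rightarrow> 0\<close> is a question about scalar functions
  on measurable sets (\<open>difference_quotient_tendsto\<close>).

  Three ingredients prepare this.  The weak gradient is unique almost everywhere, hence linear, by the
  fundamental lemma of the calculus of variations, for which explicit bump functions are built from
  \<open>exp(-1/x)\<close>.  The distributional time derivative of \<open>t \<mapsto> (w(t), v)\<close> is turned into an integral identity
  valid for all pairs of times in \<open>(0,T)\<close> (\<open>weak_derivative_imp_FTC\<close>).  The function \<open>u\<close> comes with simple
  approximants in \<open>H\<^sup>1\<close> only, although it takes values in \<open>V\<close>; replacing each value of an approximant by a
  nearly closest element of \<open>V\<close> repairs this (\<open>simple_approximation_in_subspace\<close>).
\<close>

section \<open>Smooth bump functions\<close>

text \<open>
  Multiples of \<open>exp(-1/x)\<close> by polynomials in \<open>1/x\<close>, continued by zero.  Admitting all polynomials makes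
  the family closed under differentiation, so its members are smooth.
\<close>
definition flat :: "real poly \<Rightarrow> real \<Rightarrow> real" where
  "flat p x = (if x \<le> 0 then 0 else poly p (1 / x) * exp (- (1 / x)))"

lemma poly_times_exp_minus_tendsto_0: "((\<lambda>y. poly p y * exp (- y)) \<longlongrightarrow> (0::real)) at_top"
proof -
  have "((\<lambda>y. \<Sum>i\<le>degree p. coeff p i * (y ^ i / exp y)) \<longlongrightarrow> (\<Sum>i\<le>degree p. coeff p i * 0)) at_top"
    by (intro tendsto_sum tendsto_mult_left tendsto_power_div_exp_0)
  then show ?thesis
    by (simp only: poly_altdef exp_minus sum_distrib_right divide_inverse mult.assoc mult_zero_right sum.neutral_const)
qed

lemma flat_has_real_derivative:
  "(flat p has_real_derivative flat ([:0, 0, 1:] * (p - pderiv p)) x) (at x)"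
proof -
  consider "x < 0" | "x = 0" | "x > 0" by linarith
  then show ?thesis
  proof cases
    case 1
    have "((\<lambda>_. 0) has_real_derivative flat ([:0, 0, 1:] * (p - pderiv p)) x) (at x)"
      using 1 by (simp add: flat_def)
    then show ?thesis
      by (rule has_field_derivative_transform_within_open[where S="{..<0}"]) (use 1 in \<open>auto simp: flat_def\<close>)
  next
    case 2
    have "((\<lambda>h. flat p h / h) \<longlongrightarrow> 0) (at 0)"
    proof (rule filterlim_split_at)
      have "\<forall>\<^sub>F h in at_left 0. 0 = flat p h / h"
        by (auto simp: eventually_at_filter flat_def)
      then show "((\<lambda>h. flat p h / h) \<longlongrightarrow> 0) (at_left 0)"
        by (rule Lim_transform_eventually[OF tendsto_const])
      have "((\<lambda>h. poly ([:0, 1:] * p) (inverse h) * exp (- inverse h)) \<longlongrightarrow> (0::real)) (at_right 0)"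
        by (rule filterlim_compose[OF poly_times_exp_minus_tendsto_0 filterlim_inverse_at_top_right])
      moreover have "\<forall>\<^sub>F h in at_right (0::real). poly ([:0, 1:] * p) (inverse h) * exp (- inverse h) = flat p h / h"
        using eventually_at_right_less[of "0::real"]
        by eventually_elim (auto simp: flat_def field_simps)
      ultimately show "((\<lambda>h. flat p h / h) \<longlongrightarrow> 0) (at_right 0)"
        by (rule Lim_transform_eventually)
    qed
    then show ?thesis
      using 2 by (simp add: DERIV_def flat_def)
  next
    case 3
    have inv: "((\<lambda>x. 1 / x) has_real_derivative - ((1 / x)\<^sup>2)) (at x)"
      using DERIV_inverse[of x UNIV] 3 by (simp add: inverse_eq_divide power_divide numeral_2_eq_2)
    have "((\<lambda>x. poly p (1 / x) * exp (- (1 / x))) has_real_derivative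
        poly (pderiv p) (1 / x) * (- ((1 / x)\<^sup>2)) * exp (- (1 / x))
        + exp (- (1 / x)) * (1 / x)\<^sup>2 * poly p (1 / x)) (at x)"
      using DERIV_mult'[OF DERIV_chain2[OF poly_DERIV inv, of p] DERIV_chain2[OF DERIV_exp DERIV_minus[OF inv]]]
      by (simp add: algebra_simps)
    moreover have "poly (pderiv p) (1 / x) * (- ((1 / x)\<^sup>2)) * exp (- (1 / x))
        + exp (- (1 / x)) * (1 / x)\<^sup>2 * poly p (1 / x) = flat ([:0, 0, 1:] * (p - pderiv p)) x"
      using 3 by (simp add: flat_def power2_eq_square algebra_simps)
    ultimately have "((\<lambda>x. poly p (1 / x) * exp (- (1 / x))) has_real_derivative
        flat ([:0, 0, 1:] * (p - pderiv p)) x) (at x)"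
      by simp
    then show ?thesis
      by (rule has_field_derivative_transform_within_open[where S="{0<..}"]) (use 3 in \<open>auto simp: flat_def\<close>)
  qed
qed

lemma Ck_fun_imp_continuous: "Ck_fun k \<phi> \<Longrightarrow> continuous_on UNIV \<phi>"
  by (cases k) (auto intro!: continuous_at_imp_continuous_on differentiable_imp_continuous_within)

lemma Ck_fun_const: "Ck_fun k (\<lambda>x::'a::euclidean_space. c)"
proof (induction k arbitrary: c)
  case (Suc k)
  have "frechet_derivative (\<lambda>x::'a. c) (at x) = (\<lambda>_. 0)" for x
    by (rule frechet_derivative_at[symmetric]) simp
  then show ?case using Suc by simp
qed simp

lemma Ck_fun_add:
  "Ck_fun k \<phi> \<Longrightarrow> Ck_fun k \<psi> \<Longrightarrow> Ck_fun k (\<lambda>x. \<phi> x + \<psi> x)"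
proof (induction k arbitrary: \<phi> \<psi>)
  case (Suc k)
  have "frechet_derivative (\<lambda>x. \<phi> x + \<psi> x) (at x) i
     = frechet_derivative \<phi> (at x) i + frechet_derivative \<psi> (at x) i" for x i
  proof -
    have "((\<lambda>x. \<phi> x + \<psi> x) has_derivative
        (\<lambda>h. frechet_derivative \<phi> (at x) h + frechet_derivative \<psi> (at x) h)) (at x)"
      using Suc.prems by (intro has_derivative_add) (auto simp: frechet_derivative_works)
    from frechet_derivative_at[OF this, symmetric] show ?thesis by (simp only:)
  qed
  then show ?case using Suc by (auto intro!: derivative_intros)
qed (auto intro: continuous_intros)

lemma Ck_fun_cmult: "Ck_fun k \<phi> \<Longrightarrow> Ck_fun k (\<lambda>x. c * \<phi> x)"
proof (induction k arbitrary: \<phi>)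
  case (Suc k)
  have "frechet_derivative (\<lambda>x. c * \<phi> x) (at x) i = c * frechet_derivative \<phi> (at x) i" for x i
  proof -
    have "((\<lambda>x. c * \<phi> x) has_derivative (\<lambda>h. c * frechet_derivative \<phi> (at x) h)) (at x)"
      using Suc.prems by (intro has_derivative_mult_right) (auto simp: frechet_derivative_works)
    from frechet_derivative_at[OF this, symmetric] show ?thesis by (simp only:)
  qed
  then show ?case using Suc by (auto intro!: derivative_intros)
qed (auto intro: continuous_intros)

lemma Ck_fun_sum: "(\<And>j. j \<in> J \<Longrightarrow> Ck_fun k (\<phi> j)) \<Longrightarrow> Ck_fun k (\<lambda>x. \<Sum>j\<in>J. \<phi> j x)"
  by (induction J rule: infinite_finite_induct) (auto intro: Ck_fun_add Ck_fun_const)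

text \<open>
  A directional derivative of such a product is a linear combination of products of the same shape in
  which one polynomial has been exchanged.  The induction on \<open>k\<close> therefore runs over all families \<open>p\<close>.
\<close>
lemma Ck_fun_prod_flat:
  fixes a :: "'j \<Rightarrow> 'a::euclidean_space"
  assumes "finite J"
  shows "Ck_fun k (\<lambda>x. \<Prod>j\<in>J. flat (p j) (x \<bullet> a j + c j))"
proof (induction k arbitrary: p)
  case 0
  have cf: "continuous_on UNIV (flat q)" for q
    using flat_has_real_derivative by (meson DERIV_isCont continuous_at_imp_continuous_on)
  show ?case
    unfolding Ck_fun.simps
    by (rule continuous_on_prod, rule continuous_on_compose2[OF cf]) (auto intro!: continuous_intros)
next
  case (Suc k)
  define q where "q j = [:0, 0, 1:] * (p j - pderiv (p j))" for j
  have d1: "((\<lambda>x. flat (p j) (x \<bullet> a j + c j)) has_derivative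
      (\<lambda>h. (h \<bullet> a j) * flat (q j) (x \<bullet> a j + c j))) (at x)" for j x
  proof -
    have "(flat (p j) has_derivative (*) (flat (q j) (x \<bullet> a j + c j))) (at (x \<bullet> a j + c j))"
      using flat_has_real_derivative[of "p j" "x \<bullet> a j + c j"]
      by (simp add: has_field_derivative_def q_def)
    moreover have "((\<lambda>x. x \<bullet> a j + c j) has_derivative (\<lambda>h. h \<bullet> a j)) (at x)"
      by (auto intro!: derivative_eq_intros)
    ultimately have "((\<lambda>x. flat (p j) (x \<bullet> a j + c j)) has_derivative
      (\<lambda>h. flat (q j) (x \<bullet> a j + c j) * (h \<bullet> a j))) (at x)"
      using has_derivative_compose by fastforce
    then show ?thesis by (simp only: mult.commute)
  qed
  have D: "((\<lambda>x. \<Prod>j\<in>J. flat (p j) (x \<bullet> a j + c j)) has_derivative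
      (\<lambda>h. \<Sum>j\<in>J. (h \<bullet> a j) * flat (q j) (x \<bullet> a j + c j) * (\<Prod>l\<in>J-{j}. flat (p l) (x \<bullet> a l + c l)))) (at x)" for x
    by (rule has_derivative_prod) (rule d1)
  have eq: "frechet_derivative (\<lambda>x. \<Prod>j\<in>J. flat (p j) (x \<bullet> a j + c j)) (at x) i
     = (\<Sum>j\<in>J. (i \<bullet> a j) * (\<Prod>l\<in>J. flat ((p(j := q j)) l) (x \<bullet> a l + c l)))" for x i
  proof -
    have "frechet_derivative (\<lambda>x. \<Prod>j\<in>J. flat (p j) (x \<bullet> a j + c j)) (at x) i
       = (\<Sum>j\<in>J. (i \<bullet> a j) * flat (q j) (x \<bullet> a j + c j) * (\<Prod>l\<in>J-{j}. flat (p l) (x \<bullet> a l + c l)))"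
      by (simp only: frechet_derivative_at[OF D[of x], symmetric])
    also have "\<dots> = (\<Sum>j\<in>J. (i \<bullet> a j) * (\<Prod>l\<in>J. flat ((p(j := q j)) l) (x \<bullet> a l + c l)))"
      by (rule sum.cong[OF refl]) (simp add: prod.remove[OF assms] mult.assoc)
    finally show ?thesis .
  qed
  show ?case
    unfolding Ck_fun.simps eq
    using D Suc by (auto simp: differentiable_def intro!: Ck_fun_sum Ck_fun_cmult)
qed

text \<open>
  The steepness \<open>Suc n\<close> makes these functions converge to the indicator of the box as \<open>n\<close> grows.
\<close>
definition box_bump :: "nat \<Rightarrow> 'a::euclidean_space \<Rightarrow> 'a \<Rightarrow> 'a \<Rightarrow> real" where
  "box_bump n p q x =
     (\<Prod>i\<in>Basis. flat 1 ((x - p) \<bullet> (real (Suc n) *\<^sub>R i)) * flat 1 ((q - x) \<bullet> (real (Suc n) *\<^sub>R i)))"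

lemma flat_one_bounds: "0 \<le> flat 1 x" "flat 1 x \<le> 1" "flat 1 x = 0 \<longleftrightarrow> x \<le> 0"
  by (auto simp: flat_def)

lemma box_bump_bounds: "0 \<le> box_bump n p q x" "box_bump n p q x \<le> 1"
  unfolding box_bump_def
  by (auto intro!: prod_nonneg prod_le_1 mult_nonneg_nonneg mult_le_one simp: flat_one_bounds)

lemma box_bump_eq_0_iff: "box_bump n p q x = 0 \<longleftrightarrow> x \<notin> box p q"
  by (auto simp: box_bump_def flat_one_bounds mem_box inner_diff_left mult_le_0_iff not_less simp del: of_nat_Suc)

lemma box_bump_tendsto_indicator: "(\<lambda>n. box_bump n p q x) \<longlonglongrightarrow> indicator (box p q) x"
proof (cases "x \<in> box p q")
  case True
  have *: "(\<lambda>n. flat 1 (real (Suc n) * r)) \<longlonglongrightarrow> 1" if "r > 0" for r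
  proof -
    have "(\<lambda>n. exp (- ((1 / r) * inverse (real (Suc n))))) \<longlonglongrightarrow> exp (- ((1 / r) * 0))"
      by (intro tendsto_intros LIMSEQ_inverse_real_of_nat)
    then show ?thesis using that by (simp add: flat_def field_simps not_le mult_le_0_iff del: of_nat_Suc)
  qed
  have "(\<lambda>n. box_bump n p q x) \<longlonglongrightarrow> (\<Prod>i\<in>(Basis::'a set). 1 * 1)"
    unfolding box_bump_def inner_scaleR_right
    by (intro tendsto_intros *) (use True in \<open>auto simp: mem_box inner_diff_left\<close>)
  then show ?thesis using True by simp
next
  case False
  then show ?thesis by (simp add: box_bump_eq_0_iff[THEN iffD2])
qed

lemma Ck_fun_box_bump: "Ck_fun k (box_bump n p (q::'a::euclidean_space))"
proof -
  let ?J = "(Basis::'a set) \<times> {True, False}"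
  let ?a = "\<lambda>(i::'a, b). if b then real (Suc n) *\<^sub>R i else - (real (Suc n) *\<^sub>R i)"
  let ?c = "\<lambda>(i::'a, b). if b then - (p \<bullet> (real (Suc n) *\<^sub>R i)) else q \<bullet> (real (Suc n) *\<^sub>R i)"
  have "box_bump n p q = (\<lambda>x. \<Prod>j\<in>?J. flat 1 (x \<bullet> ?a j + ?c j))"
  proof
    fix x
    have "(\<Prod>j\<in>?J. flat 1 (x \<bullet> ?a j + ?c j))
        = (\<Prod>i\<in>Basis. \<Prod>b\<in>{True, False}. flat 1 (x \<bullet> ?a (i, b) + ?c (i, b)))"
      by (subst prod.cartesian_product) (rule prod.cong, auto)
    then show "box_bump n p q x = (\<Prod>j\<in>?J. flat 1 (x \<bullet> ?a j + ?c j))"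
      by (simp add: box_bump_def inner_diff_left algebra_simps del: of_nat_Suc)
  qed
  then show ?thesis by (simp only:) (rule Ck_fun_prod_flat, simp)
qed

lemma test_function_box_bump:
  assumes "cbox p q \<subseteq> \<Omega>"
  shows "test_function \<Omega> (box_bump n p q)"
proof -
  have "closure {x. box_bump n p q x \<noteq> 0} \<subseteq> cbox p q"
    by (rule closure_minimal) (use box_subset_cbox in \<open>auto simp: box_bump_eq_0_iff\<close>)
  moreover from this have "bounded {x. box_bump n p q x \<noteq> 0}"
    by (meson bounded_cbox bounded_subset closure_subset)
  ultimately show ?thesis
    using assms by (auto simp: test_function_def Ck_fun_box_bump)
qed

section \<open>Square-integrable functions\<close>

text \<open>
  The discriminant criterion, in the form from which the Cauchy-Schwarz inequality follows; a constant
  quadratic (\<open>C = 0\<close>) has to be treated apart.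
\<close>
lemma quadratic_nonneg_imp:
  fixes A B C :: real
  assumes "\<And>t. 0 \<le> A + 2 * t * B + t\<^sup>2 * C" "0 \<le> C"
  shows "B\<^sup>2 \<le> A * C"
proof (cases "C = 0")
  case True
  have "B = 0"
  proof (rule ccontr)
    assume "B \<noteq> 0"
    then show False using assms(1)[of "- (A + 1) / (2 * B)"] True by (simp add: field_simps)
  qed
  then show ?thesis using True by simp
next
  case False
  then have "C > 0" using assms by simp
  then show ?thesis using assms(1)[of "- B / C"]
    by (simp add: field_simps power2_eq_square)
qed

lemma L2_spaceD:
  assumes "v \<in> L2_space \<Omega>"
  shows "v \<in> borel_measurable (lebesgue_on \<Omega>)" "integrable (lebesgue_on \<Omega>) (\<lambda>x. (norm (v x))\<^sup>2)"
  using assms by (auto simp: L2_space_def)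

lemma L2_inner_integrable:
  assumes "v \<in> L2_space \<Omega>" "w \<in> L2_space \<Omega>"
  shows "integrable (lebesgue_on \<Omega>) (\<lambda>x. v x \<bullet> w x)"
proof (rule Bochner_Integration.integrable_bound)
  show "integrable (lebesgue_on \<Omega>) (\<lambda>x. (norm (v x))\<^sup>2 + (norm (w x))\<^sup>2)"
    using assms by (intro Bochner_Integration.integrable_add L2_spaceD)
  show "(\<lambda>x. v x \<bullet> w x) \<in> borel_measurable (lebesgue_on \<Omega>)"
    using assms by (intro borel_measurable_inner L2_spaceD)
  have "\<bar>v x \<bullet> w x\<bar> \<le> (norm (v x))\<^sup>2 + (norm (w x))\<^sup>2" for x
    using Cauchy_Schwarz_ineq2[of "v x" "w x"] sum_squares_bound[of "norm (v x)" "norm (w x)"]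
      mult_nonneg_nonneg[of "norm (v x)" "norm (w x)"] by simp
  then show "AE x in lebesgue_on \<Omega>. norm (v x \<bullet> w x) \<le> norm ((norm (v x))\<^sup>2 + (norm (w x))\<^sup>2)"
    by simp
qed

lemma L2_mult_integrable:
  "v \<in> L2_space \<Omega> \<Longrightarrow> w \<in> L2_space \<Omega> \<Longrightarrow> integrable (lebesgue_on \<Omega>) (\<lambda>x. v x * (w x :: real))"
  using L2_inner_integrable[of v \<Omega> w] by simp

lemma L2_space_lincomb:
  fixes v w :: "'a::euclidean_space \<Rightarrow> 'b::euclidean_space"
  assumes "v \<in> L2_space \<Omega>" "w \<in> L2_space \<Omega>"
  shows "(\<lambda>x. a *\<^sub>R v x + b *\<^sub>R w x) \<in> L2_space \<Omega>"
proof -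
  have "(\<lambda>x. (norm (a *\<^sub>R v x + b *\<^sub>R w x))\<^sup>2)
     = (\<lambda>x. a\<^sup>2 * (norm (v x))\<^sup>2 + 2 * a * b * (v x \<bullet> w x) + b\<^sup>2 * (norm (w x))\<^sup>2)"
    unfolding power2_norm_eq_inner by (simp add: inner_add inner_commute algebra_simps power2_eq_square)
  then show ?thesis
    using assms L2_inner_integrable[OF assms]
    by (auto simp: L2_space_def)
qed

lemma L2_space_real_lincomb:
  "v \<in> L2_space \<Omega> \<Longrightarrow> w \<in> L2_space \<Omega> \<Longrightarrow> (\<lambda>x. a * v x + b * (w x::real)) \<in> L2_space \<Omega>"
  using L2_space_lincomb[of v \<Omega> w a b] by simp

lemma L2_space_diff: "v \<in> L2_space \<Omega> \<Longrightarrow> w \<in> L2_space \<Omega> \<Longrightarrow> (\<lambda>x. v x - w x) \<in> L2_space \<Omega>"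
  using L2_space_lincomb[of v \<Omega> w 1 "-1"] by simp

lemma L2_norm_nonneg [simp]: "0 \<le> L2_norm \<Omega> v"
  by (simp add: L2_norm_def)

lemma L2_norm_power2: "(L2_norm \<Omega> v)\<^sup>2 = (LINT x|lebesgue_on \<Omega>. v x \<bullet> v x)"
  by (simp add: L2_norm_def power2_norm_eq_inner)

lemma L2_norm_power2_lincomb:
  assumes "v \<in> L2_space \<Omega>" "w \<in> L2_space \<Omega>"
  shows "(L2_norm \<Omega> (\<lambda>x. a *\<^sub>R v x + b *\<^sub>R w x))\<^sup>2
     = a\<^sup>2 * (L2_norm \<Omega> v)\<^sup>2 + 2 * a * b * (LINT x|lebesgue_on \<Omega>. v x \<bullet> w x) + b\<^sup>2 * (L2_norm \<Omega> w)\<^sup>2"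
proof -
  have "(\<lambda>x. (a *\<^sub>R v x + b *\<^sub>R w x) \<bullet> (a *\<^sub>R v x + b *\<^sub>R w x))
     = (\<lambda>x. a\<^sup>2 * (v x \<bullet> v x) + 2 * a * b * (v x \<bullet> w x) + b\<^sup>2 * (w x \<bullet> w x))"
    by (simp add: inner_add inner_commute algebra_simps power2_eq_square)
  then show ?thesis
    unfolding L2_norm_power2
    using L2_inner_integrable[OF assms] L2_inner_integrable[OF assms(1) assms(1)]
      L2_inner_integrable[OF assms(2) assms(2)]
    by simp
qed

lemma L2_Cauchy_Schwarz:
  assumes "v \<in> L2_space \<Omega>" "w \<in> L2_space \<Omega>"
  shows "\<bar>LINT x|lebesgue_on \<Omega>. v x \<bullet> w x\<bar> \<le> L2_norm \<Omega> v * L2_norm \<Omega> w"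
proof -
  have "0 \<le> (L2_norm \<Omega> v)\<^sup>2 + 2 * t * (LINT x|lebesgue_on \<Omega>. v x \<bullet> w x) + t\<^sup>2 * (L2_norm \<Omega> w)\<^sup>2"
    for t
    using L2_norm_power2_lincomb[OF assms, of 1 t] by (simp) (metis zero_le_power2)
  then have "(LINT x|lebesgue_on \<Omega>. v x \<bullet> w x)\<^sup>2 \<le> (L2_norm \<Omega> v)\<^sup>2 * (L2_norm \<Omega> w)\<^sup>2"
    by (rule quadratic_nonneg_imp) simp
  then show ?thesis
    by - (rule power2_le_imp_le, simp_all add: power_mult_distrib)
qed

lemma L2_norm_triangle:
  assumes "v \<in> L2_space \<Omega>" "w \<in> L2_space \<Omega>"
  shows "L2_norm \<Omega> (\<lambda>x. v x + w x) \<le> L2_norm \<Omega> v + L2_norm \<Omega> w"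
proof (rule power2_le_imp_le)
  show "(L2_norm \<Omega> (\<lambda>x. v x + w x))\<^sup>2 \<le> (L2_norm \<Omega> v + L2_norm \<Omega> w)\<^sup>2"
    using L2_norm_power2_lincomb[OF assms, of 1 1] L2_Cauchy_Schwarz[OF assms]
    by (simp add: power2_sum)
qed simp

lemma L2_norm_cong_AE:
  fixes v w :: "'a::euclidean_space \<Rightarrow> 'b::euclidean_space"
  assumes "v \<in> borel_measurable (lebesgue_on \<Omega>)" "w \<in> borel_measurable (lebesgue_on \<Omega>)"
    "AE x in lebesgue_on \<Omega>. v x = w x"
  shows "L2_norm \<Omega> v = L2_norm \<Omega> w"
proof -
  have "(LINT x|lebesgue_on \<Omega>. (norm (v x))\<^sup>2) = (LINT x|lebesgue_on \<Omega>. (norm (w x))\<^sup>2)"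
    using assms by (intro integral_cong_AE) auto
  then show ?thesis by (simp add: L2_norm_def)
qed

lemma L2_norm_scale: "L2_norm \<Omega> (\<lambda>x. c *\<^sub>R v x) = \<bar>c\<bar> * L2_norm \<Omega> v"
  by (simp add: L2_norm_def power_mult_distrib real_sqrt_mult)

lemma finite_measure_lebesgue_on_bounded:
  "bounded \<Omega> \<Longrightarrow> open \<Omega> \<Longrightarrow> finite_measure (lebesgue_on \<Omega>)"
  by (simp add: finite_measure_lebesgue_on lmeasurable_open)

lemma L2_space_bounded_measurable:
  fixes v :: "'a::euclidean_space \<Rightarrow> 'b::euclidean_space"
  assumes "bounded \<Omega>" "open \<Omega>" "v \<in> borel_measurable (lebesgue_on \<Omega>)"
    "AE x in lebesgue_on \<Omega>. norm (v x) \<le> B"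
  shows "v \<in> L2_space \<Omega>"
proof -
  interpret finite_measure "lebesgue_on \<Omega>"
    using assms by (simp add: finite_measure_lebesgue_on_bounded)
  have "integrable (lebesgue_on \<Omega>) (\<lambda>x. (norm (v x))\<^sup>2)"
  proof (rule integrable_const_bound)
    show "AE x in lebesgue_on \<Omega>. norm ((norm (v x))\<^sup>2) \<le> B\<^sup>2"
      using assms(4) by eventually_elim (simp add: power_mono)
  qed (use assms in auto)
  then show ?thesis using assms by (simp add: L2_space_def)
qed

lemma L2_space_imp_integrable:
  fixes v :: "'a::euclidean_space \<Rightarrow> 'b::euclidean_space"
  assumes "bounded \<Omega>" "open \<Omega>" "v \<in> L2_space \<Omega>"
  shows "integrable (lebesgue_on \<Omega>) v"
proof (rule Bochner_Integration.integrable_bound)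
  interpret finite_measure "lebesgue_on \<Omega>"
    using assms by (simp add: finite_measure_lebesgue_on_bounded)
  show "integrable (lebesgue_on \<Omega>) (\<lambda>x. 1 + (norm (v x))\<^sup>2)"
    using assms by (intro Bochner_Integration.integrable_add L2_spaceD) auto
  have "norm (v x) \<le> 1 + (norm (v x))\<^sup>2" for x
    using self_le_power[of "norm (v x)" 2] zero_le_power2[of "norm (v x)"] by (cases "norm (v x) \<le> 1") linarith+
  then show "AE x in lebesgue_on \<Omega>. norm (v x) \<le> norm (1 + (norm (v x))\<^sup>2)"
    by (simp add: abs_of_nonneg)
qed (use assms in \<open>auto simp: L2_space_def\<close>)

section \<open>The fundamental lemma of the calculus of variations\<close>

text \<open>
  Open boxes are closed under intersection and generate the Borel sets, so the integral of \<open>h\<close> vanishes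
  over every Borel subset of \<open>box p q\<close>, in particular over the sets where \<open>h\<close> is positive or negative.
\<close>
lemma integral_all_boxes_0_imp_AE_0:
  fixes h :: "'a::euclidean_space \<Rightarrow> real"
  assumes h: "integrable lborel h"
    and box: "\<And>a b. (LINT x|lborel. indicator (box a b) x * (indicator (box p q) x * h x)) = 0"
  shows "AE x in lborel. x \<in> box p q \<longrightarrow> h x = 0"
proof -
  define k where "k x = indicator (box p q) x * h x" for x
  have k: "integrable lborel k"
    unfolding k_def using integrable_mult_indicator[OF _ h, of "box p q"] by simp
  have int: "integrable lborel (\<lambda>x. indicator A x * k x)" if "A \<in> sets borel" for A
    using integrable_mult_indicator[OF _ k, of A] that by simp
  have all: "(LINT x|lborel. indicator A x * k x) = 0" if "A \<in> sets borel" for A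
  proof -
    have borel: "sets borel = sigma_sets UNIV (range (\<lambda>(a, b). box a b :: 'a set))"
      by (simp add: borel_eq_box)
    with that have A: "A \<in> sigma_sets UNIV (range (\<lambda>(a, b). box a b))" by blast
    have int_stable: "Int_stable (range (\<lambda>(a, b). box a b :: 'a set))"
      unfolding Int_stable_def by (auto simp: box_Int_box)
    have "range (\<lambda>(a, b). box a b :: 'a set) \<subseteq> Pow UNIV" by simp
    from int_stable this A show ?thesis
    proof (induction rule: sigma_sets_induct_disjoint)
      case (basic A)
      then show ?case using box by (auto simp: k_def)
    next
      case empty
      show ?case by simp
    next
      case (compl A)
      then have A: "A \<in> sets borel"
        unfolding borel by blast
      have "(LINT x|lborel. k x) = 0"
        using box[of p q] by (simp add: k_def mult.assoc[symmetric] indicator_inter_arith[symmetric])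
      moreover have "(\<lambda>x. indicator (UNIV - A) x * k x) = (\<lambda>x. k x - indicator A x * k x)"
        by (auto simp: indicator_def)
      ultimately show ?case using compl k int[OF A] by simp
    next
      case (union A)
      then have A: "A i \<in> sets borel" for i
        unfolding borel by blast
      have "set_integrable lborel (\<Union>i. A i) k"
        using integrable_mult_indicator[OF _ k, of "\<Union>i. A i"] A by (simp add: set_integrable_def)
      then have "(LINT x:(\<Union>i. A i)|lborel. k x) = (\<Sum>i. (LINT x:(A i)|lborel. k x))"
        by (intro lebesgue_integral_countable_add)
          (use A union in \<open>auto simp: disjoint_family_on_def\<close>)
      then show ?case using union by (simp add: set_lebesgue_integral_def)
    qed
  qed
  have kb: "k \<in> borel_measurable borel" using k by (auto dest: borel_measurable_integrable)
  have "AE x in lborel. indicator {x. s * k x > 0} x * (s * k x) = 0" for s :: real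
  proof (subst integral_nonneg_eq_0_iff_AE[symmetric])
    have S: "{x. s * k x > 0} \<in> sets borel" using kb by measurable
    show "integrable lborel (\<lambda>x. indicator {x. s * k x > 0} x * (s * k x))"
      using int[OF S] by (simp add: mult.left_commute)
    show "(LINT x|lborel. indicator {x. s * k x > 0} x * (s * k x)) = 0"
      using all[OF S] by (simp add: mult.left_commute)
  qed (auto simp: indicator_def)
  from this[of 1] this[of "-1"] show ?thesis
    by eventually_elim (auto simp: k_def indicator_def split: if_splits)
qed

text \<open>
  Bump functions converge to the indicator of any box whose closure lies in \<open>\<Omega>\<close>; by dominated
  convergence the integral of \<open>g\<close> over that box is zero, and countably many such boxes cover \<open>\<Omega>\<close>.
\<close>
lemma fundamental_lemma_of_calculus_of_variations:
  fixes g :: "'a::euclidean_space \<Rightarrow> real"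
  assumes "open \<Omega>" and g: "integrable (lebesgue_on \<Omega>) g"
    and test: "\<And>\<phi>. test_function \<Omega> \<phi> \<Longrightarrow> (LINT x|lebesgue_on \<Omega>. g x * \<phi> x) = 0"
  shows "AE x in lebesgue_on \<Omega>. g x = 0"
proof -
  have \<Omega>: "\<Omega> \<in> sets lebesgue" using \<open>open \<Omega>\<close> by auto
  have gi: "integrable lebesgue (\<lambda>x. indicator \<Omega> x * g x)"
    using g \<Omega> by (simp add: integrable_restrict_space)
  \<comment> \<open>A Borel version \<open>h\<close> of \<open>g\<close>, continued by zero, allows induction over Borel sets.\<close>
  then obtain h where h: "h \<in> borel_measurable lborel" "AE x in lborel. indicator \<Omega> x * g x = h x"
    using completion_ex_borel_measurable_real[of "\<lambda>x. indicator \<Omega> x * g x" lborel] borel_measurable_integrable by blast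
  have hl: "AE x in lebesgue. indicator \<Omega> x * g x = h x"
    using h(2) by (rule AE_completion)
  have hint: "integrable lborel h"
  proof -
    have "integrable lebesgue h"
      using gi hl h(1) by (subst integrable_cong_AE[symmetric]) (auto intro: measurable_completion borel_measurable_integrable)
    then show ?thesis using h(1) integrable_completion by blast
  qed
  have on_box: "AE x in lborel. x \<in> box p q \<longrightarrow> h x = 0" if pq: "cbox p q \<subseteq> \<Omega>" for p q
  proof (rule integral_all_boxes_0_imp_AE_0[OF hint])
    fix a b
    obtain c d where cd: "box a b \<inter> box p q = box c d" "cbox c d \<subseteq> cbox p q \<or> box c d = {}"
    proof -
      obtain c d where cd: "box a b \<inter> box p q = box c d" by (meson box_Int_box)
      show thesis
      proof (cases "box c d = {}")
        case False
        then have "cbox c d \<subseteq> cbox p q"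
          using cd by (metis Int_lower2 box_subset_cbox closure_box closure_cbox closure_mono subset_trans)
        then show ?thesis using that cd by blast
      qed (use that cd in blast)
    qed
    show "(LINT x|lborel. indicator (box a b) x * (indicator (box p q) x * h x)) = 0"
    proof (cases "box c d = {}")
      case True
      then have "(\<lambda>x. indicator (box a b) x * (indicator (box p q) x * h x)) = (\<lambda>_. 0)"
        using cd(1) by (intro ext) (auto simp: indicator_def)
      then show ?thesis by (simp only: integral_zero)
    next
      case False
      then have tf: "test_function \<Omega> (box_bump n c d)" for n
        using cd pq by (intro test_function_box_bump) blast
      have mb: "box_bump n c d \<in> borel_measurable borel" for n
        by (intro borel_measurable_continuous_onI Ck_fun_imp_continuous[OF Ck_fun_box_bump])
      have z: "(LINT x|lborel. box_bump n c d x * h x) = 0" for n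
      proof -
        have "0 = (LINT x|lebesgue_on \<Omega>. g x * box_bump n c d x)"
          using test[OF tf] by simp
        also have "\<dots> = (LINT x|lebesgue. indicator \<Omega> x * (g x * box_bump n c d x))"
          using \<Omega> by (simp add: integral_restrict_space)
        also have "\<dots> = (LINT x|lebesgue. box_bump n c d x * h x)"
        proof (rule integral_cong_AE)
          have "box_bump n c d \<in> borel_measurable lebesgue"
            using mb by (intro measurable_completion) auto
          then have "(\<lambda>x. (indicator \<Omega> x * g x) * box_bump n c d x) \<in> borel_measurable lebesgue"
            by (rule borel_measurable_times[OF borel_measurable_integrable[OF gi]])
          then show "(\<lambda>x. indicator \<Omega> x * (g x * box_bump n c d x)) \<in> borel_measurable lebesgue"
            by (simp add: mult.assoc)
          show "AE x in lebesgue. indicator \<Omega> x * (g x * box_bump n c d x) = box_bump n c d x * h x"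
            using hl by eventually_elim (metis mult.assoc mult.commute)
          show "(\<lambda>x. box_bump n c d x * h x) \<in> borel_measurable lebesgue"
            using h(1) mb by (intro measurable_completion) auto
        qed
        also have "\<dots> = (LINT x|lborel. box_bump n c d x * h x)"
          using h(1) mb by (intro integral_completion) auto
        finally show ?thesis by simp
      qed
      have "(\<lambda>n. LINT x|lborel. box_bump n c d x * h x) \<longlonglongrightarrow> (LINT x|lborel. indicator (box c d) x * h x)"
      proof (rule integral_dominated_convergence[where w="\<lambda>x. norm (h x)"])
        show "AE x in lborel. (\<lambda>n. box_bump n c d x * h x) \<longlonglongrightarrow> indicator (box c d) x * h x"
          by (intro AE_I2 tendsto_intros box_bump_tendsto_indicator)
        show "AE x in lborel. norm (box_bump n c d x * h x) \<le> norm (h x)" for n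
          using box_bump_bounds[of n c d] by (intro AE_I2) (simp add: abs_mult mult_left_le_one_le)
      qed (use h(1) mb hint in auto)
      then have "(LINT x|lborel. indicator (box c d) x * h x) = 0"
        by (simp add: z LIMSEQ_const_iff)
      moreover have "(\<lambda>x. indicator (box a b) x * (indicator (box p q) x * h x)) = (\<lambda>x. indicator (box c d) x * h x)"
        unfolding cd(1)[symmetric] by (auto simp: indicator_def)
      ultimately show ?thesis by simp
    qed
  qed
  obtain D where D: "countable D" "D \<subseteq> Pow \<Omega>" "\<And>X. X \<in> D \<Longrightarrow> \<exists>a b. X = cbox a b" "\<Union>D = \<Omega>"
    by (rule open_countable_Union_open_cbox[OF \<open>open \<Omega>\<close>], rule that)
  have "AE x in lborel. x \<in> X \<longrightarrow> h x = 0" if X: "X \<in> D" for X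
  proof -
    obtain p q where pq: "X = cbox p q" "cbox p q \<subseteq> \<Omega>" using D(2) D(3)[OF X] X by blast
    have "AE x in lborel. x \<notin> cbox p q - box p q"
      by (intro AE_not_in) (auto simp: emeasure_lborel_cbox_eq emeasure_lborel_box_eq null_sets_def emeasure_Diff box_subset_cbox)
    with on_box[OF pq(2)] show ?thesis
      by eventually_elim (auto simp: pq(1))
  qed
  then have "AE x in lborel. \<forall>X\<in>D. x \<in> X \<longrightarrow> h x = 0"
    by (intro AE_ball_countable[OF D(1), THEN iffD2] ballI)
  then have "AE x in lebesgue. \<forall>X\<in>D. x \<in> X \<longrightarrow> h x = 0"
    by (rule AE_completion)
  with hl have "AE x in lebesgue. x \<in> \<Omega> \<longrightarrow> g x = 0"
    by eventually_elim (use D(4) in \<open>auto simp: indicator_def\<close>)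
  then show ?thesis
    using \<Omega> by (simp add: AE_restrict_space_iff)
qed

section \<open>Weak gradients\<close>

lemma compactly_supported_bounded:
  fixes F :: "'a::euclidean_space \<Rightarrow> real"
  assumes "continuous_on UNIV F" "compact K" "\<And>x. x \<notin> K \<Longrightarrow> F x = 0"
  shows "\<exists>B\<ge>0. \<forall>x. \<bar>F x\<bar> \<le> B"
proof -
  have "bounded (F ` K)"
    using assms by (intro compact_imp_bounded compact_continuous_image) (auto intro: continuous_on_subset)
  then obtain b where b: "\<And>x. x \<in> K \<Longrightarrow> \<bar>F x\<bar> \<le> b"
    by (auto simp: bounded_iff)
  have "\<bar>F x\<bar> \<le> max b 0" for x
    using b[of x] assms(3)[of x] by (cases "x \<in> K") (auto simp: max_def)
  then show ?thesis by (intro exI[of _ "max b 0"]) simp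
qed

lemma compactly_supported_integrable:
  fixes F :: "'a::euclidean_space \<Rightarrow> real"
  assumes "continuous_on UNIV F" "compact K" "\<And>x. x \<notin> K \<Longrightarrow> F x = 0"
  shows "integrable lborel F"
proof -
  obtain B where B: "0 \<le> B" "\<And>x. \<bar>F x\<bar> \<le> B" using compactly_supported_bounded[OF assms] by blast
  have "integrable lborel (\<lambda>x. B * indicator K x :: real)"
    using \<open>compact K\<close> emeasure_compact_finite[of K]
    by (intro integrable_mult_right integrable_real_indicator) (auto simp: borel_compact)
  then show ?thesis
  proof (rule Bochner_Integration.integrable_bound)
    show "F \<in> borel_measurable lborel"
      using assms(1) by (simp add: borel_measurable_continuous_onI)
    show "AE x in lborel. norm (F x) \<le> norm (B * indicator K x :: real)"
      using B assms(3) by (intro AE_I2) (auto simp: indicator_def)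
  qed
qed

text \<open>
  Difference quotients of \<open>F\<close> in the direction \<open>i\<close> have integral zero by translation invariance.  They
  converge to the derivative and, by the mean value theorem, are dominated by its maximum on a ball
  that contains all shifted supports.
\<close>
lemma integral_directional_derivative_eq_0:
  fixes F :: "'a::euclidean_space \<Rightarrow> real"
  assumes d: "\<And>x. (F has_derivative F' x) (at x)"
    and cont: "continuous_on UNIV (\<lambda>x. F' x i)"
    and K: "compact K" "\<And>x. x \<notin> K \<Longrightarrow> F x = 0" "\<And>x. x \<notin> K \<Longrightarrow> F' x i = 0"
  shows "(LINT x|lborel. F' x i) = 0"
proof -
  have cF: "continuous_on UNIV F"
    using d by (meson continuous_at_imp_continuous_on has_derivative_continuous)
  have F[measurable]: "F \<in> borel_measurable borel" and F'[measurable]: "(\<lambda>x. F' x i) \<in> borel_measurable borel"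
    using cF cont by (auto intro: borel_measurable_continuous_onI)
  have Fint: "integrable lborel F"
    by (rule compactly_supported_integrable[OF cF K(1,2)])
  obtain B where B: "0 \<le> B" "\<And>x. \<bar>F' x i\<bar> \<le> B"
    using compactly_supported_bounded[OF cont K(1,3)] by blast 
  obtain r where r: "\<And>x. x \<in> K \<Longrightarrow> norm x \<le> r"
    using compact_imp_bounded[OF K(1)] by (auto simp: bounded_iff)
  define h :: "nat \<Rightarrow> real" where "h n = inverse (real (Suc n))" for n
  have h: "0 < h n" "h n \<le> 1" for n
    by (auto simp: h_def field_simps)
  have line: "((\<lambda>s. F (x + s *\<^sub>R i)) has_real_derivative F' (x + s *\<^sub>R i) i) (at s)" for x s
  proof -
    have "((\<lambda>s. x + s *\<^sub>R i) has_derivative (\<lambda>s. s *\<^sub>R i)) (at s)"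
      by (auto intro!: derivative_eq_intros)
    from has_derivative_compose[OF this d[of "x + s *\<^sub>R i"]]
    have "((\<lambda>s. F (x + s *\<^sub>R i)) has_derivative (\<lambda>t. F' (x + s *\<^sub>R i) (t *\<^sub>R i))) (at s)" .
    moreover have "F' (x + s *\<^sub>R i) (t *\<^sub>R i) = F' (x + s *\<^sub>R i) i * t" for t
      using linear_cmul[OF has_derivative_linear[OF d[of "x + s *\<^sub>R i"]]] by simp
    ultimately show ?thesis by (simp add: has_field_derivative_def)
  qed
  define q where "q n x = (F (x + h n *\<^sub>R i) - F x) / h n" for n x
  have "(\<lambda>n. LINT x|lborel. q n x) \<longlonglongrightarrow> (LINT x|lborel. F' x i)"
  proof (rule integral_dominated_convergence[where w="\<lambda>x. B * indicator (cball 0 (r + norm i)) x"])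
    show "integrable lborel (\<lambda>x::'a. B * indicator (cball 0 (r + norm i)) x :: real)"
      by (intro integrable_mult_right integrable_real_indicator emeasure_bounded_finite) auto
    show "(\<lambda>x. F' x i) \<in> borel_measurable lborel" by simp
    show "q n \<in> borel_measurable lborel" for n
      unfolding q_def by measurable
    show "AE x in lborel. (\<lambda>n. q n x) \<longlonglongrightarrow> F' x i"
    proof (rule AE_I2)
      fix x
      have "((\<lambda>s. (F (x + s *\<^sub>R i) - F x) / s) \<longlongrightarrow> F' x i) (at 0)"
        using line[of x 0] by (simp add: DERIV_def)
      moreover have "filterlim h (at 0) sequentially"
        unfolding h_def by (intro filterlim_atI LIMSEQ_inverse_real_of_nat) simp
      ultimately show "(\<lambda>n. q n x) \<longlonglongrightarrow> F' x i"
        unfolding q_def by (rule filterlim_compose)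
    qed
    show "AE x in lborel. norm (q n x) \<le> B * indicator (cball 0 (r + norm i)) x" for n
    proof (rule AE_I2)
      fix x
      show "norm (q n x) \<le> B * indicator (cball 0 (r + norm i)) x"
      proof (cases "x \<in> cball 0 (r + norm i)")
        case True
        obtain z where z: "0 < z" "z < h n"
          "F (x + h n *\<^sub>R i) - F (x + 0 *\<^sub>R i) = (h n - 0) * F' (x + z *\<^sub>R i) i"
          using MVT2[OF h(1)[of n], of "\<lambda>s. F (x + s *\<^sub>R i)" "\<lambda>s. F' (x + s *\<^sub>R i) i"] line by blast
        then have "q n x = F' (x + z *\<^sub>R i) i"
          using h(1)[of n] by (simp add: q_def)
        then show ?thesis using B(2) True by simp
      next
        case False
        then have x: "norm x > r + norm i" by simp
        have "norm (h n *\<^sub>R i) \<le> norm i"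
          using h[of n] by (simp add: mult_left_le_one_le)
        then have "norm (x + h n *\<^sub>R i) > r"
          using x norm_triangle_ineq4[of "x + h n *\<^sub>R i" "h n *\<^sub>R i"] by simp
        moreover have "norm x > r" using x norm_ge_zero[of i] by linarith
        ultimately have "x + h n *\<^sub>R i \<notin> K" "x \<notin> K" using r by (auto simp: not_less[symmetric])
        then show ?thesis using K(2) False by (simp add: q_def)
      qed
    qed
  qed
  moreover have "(LINT x|lborel. q n x) = 0" for n
  proof -
    have s: "(LINT x|lborel. F (x + h n *\<^sub>R i)) = (LINT x|lborel. F x)"
      and si: "integrable lborel (\<lambda>x. F (x + h n *\<^sub>R i))"
      using integral_distr[of "(+) (h n *\<^sub>R i)" lborel borel F]
        integrable_distr_eq[of "(+) (h n *\<^sub>R i)" lborel borel F] Fint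
      by (simp_all add: lborel_distr_plus add.commute)
    show ?thesis
      unfolding q_def using s si Fint by simp
  qed
  ultimately show ?thesis by (simp add: LIMSEQ_const_iff)
qed

lemma test_function_derivative:
  assumes "test_function \<Omega> \<phi>"
  shows "(\<phi> has_derivative frechet_derivative \<phi> (at x)) (at x)"
    and "i \<in> Basis \<Longrightarrow> continuous_on UNIV (\<lambda>x. frechet_derivative \<phi> (at x) i)"
    and "continuous_on UNIV \<phi>"
    and "x \<notin> closure {x. \<phi> x \<noteq> 0} \<Longrightarrow> \<phi> x = 0"
    and "x \<notin> closure {x. \<phi> x \<noteq> 0} \<Longrightarrow> frechet_derivative \<phi> (at x) = (\<lambda>_. 0)"
proof -
  have "Ck_fun (Suc 0) \<phi>" using assms by (simp only: test_function_def)
  then show D: "(\<phi> has_derivative frechet_derivative \<phi> (at x)) (at x)"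
    and "i \<in> Basis \<Longrightarrow> continuous_on UNIV (\<lambda>x. frechet_derivative \<phi> (at x) i)"
    by (auto simp: frechet_derivative_works)
  show "continuous_on UNIV \<phi>"
    using assms by (auto simp: test_function_def intro: Ck_fun_imp_continuous)
  show "x \<notin> closure {x. \<phi> x \<noteq> 0} \<Longrightarrow> \<phi> x = 0"
    using closure_subset[of "{x. \<phi> x \<noteq> 0}"] by auto
  assume x: "x \<notin> closure {x. \<phi> x \<noteq> 0}"
  have "(\<phi> has_derivative (\<lambda>_. 0)) (at x)"
  proof (rule has_derivative_transform_within_open)
    show "((\<lambda>_. 0) has_derivative (\<lambda>_. 0)) (at x)" by simp
    show "open (- closure {x. \<phi> x \<noteq> 0})" by (simp add: open_closed)
  qed (use x closure_subset[of "{x. \<phi> x \<noteq> 0}"] in auto)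
  then show "frechet_derivative \<phi> (at x) = (\<lambda>_. 0)"
    using D has_derivative_unique by blast
qed

lemma test_function_L2:
  assumes "bounded \<Omega>" "open \<Omega>" "test_function \<Omega>' \<phi>"
  shows "\<phi> \<in> L2_space \<Omega>" "i \<in> Basis \<Longrightarrow> (\<lambda>x. frechet_derivative \<phi> (at x) i) \<in> L2_space \<Omega>"
proof -
  let ?K = "closure {x. \<phi> x \<noteq> 0}"
  have K: "compact ?K" using assms by (auto simp: test_function_def)
  have L2: "F \<in> L2_space \<Omega>" if F: "continuous_on UNIV F" "\<And>x. x \<notin> ?K \<Longrightarrow> F x = 0"
    for F :: "'a \<Rightarrow> real"
  proof -
    obtain B where B: "0 \<le> B" "\<And>x. \<bar>F x\<bar> \<le> B" using compactly_supported_bounded[OF F(1) K F(2)] by blast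
    show ?thesis
    proof (rule L2_space_bounded_measurable[OF assms(1,2)])
      show "F \<in> borel_measurable (lebesgue_on \<Omega>)"
        using F(1) assms(2) by (intro continuous_imp_measurable_on_sets_lebesgue) (auto intro: continuous_on_subset)
      show "AE x in lebesgue_on \<Omega>. norm (F x) \<le> B"
        using B by simp
    qed
  qed
  show "\<phi> \<in> L2_space \<Omega>"
    by (intro L2 test_function_derivative[OF assms(3)])
  show "(\<lambda>x. frechet_derivative \<phi> (at x) i) \<in> L2_space \<Omega>" if "i \<in> Basis"
    by (intro L2 test_function_derivative(2)[OF assms(3) that])
      (simp add: test_function_derivative(5)[OF assms(3)])
qed

lemma test_function_lincomb:
  assumes "test_function \<Omega> \<phi>" "test_function \<Omega> \<psi>"
  shows "test_function \<Omega> (\<lambda>x. a * \<phi> x + b * \<psi> x)"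
proof -
  let ?A = "closure {x. \<phi> x \<noteq> 0}" and ?B = "closure {x. \<psi> x \<noteq> 0}" and ?C = "closure {x. a * \<phi> x + b * \<psi> x \<noteq> 0}"
  have C: "?C \<subseteq> ?A \<union> ?B"
    unfolding closure_Un[symmetric] by (rule closure_mono) auto
  moreover have AB: "compact (?A \<union> ?B)" using assms by (auto simp: test_function_def)
  ultimately have "compact ?C"
    using compact_Int_closed[OF AB, of ?C] by (simp add: Int_absorb1)
  then show ?thesis
    using C assms by (auto simp: test_function_def intro!: Ck_fun_add Ck_fun_cmult)
qed

lemma has_weak_gradientD:
  assumes "has_weak_gradient \<Omega> v g" "test_function \<Omega> \<phi>" "i \<in> Basis"
  shows "(LINT x|lebesgue_on \<Omega>. v x * frechet_derivative \<phi> (at x) i)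
    = - (LINT x|lebesgue_on \<Omega>. (g x \<bullet> i) * \<phi> x)"
  using assms by (simp add: has_weak_gradient_def)

text \<open>
  Integration by parts: the derivative of the product of two test functions has integral zero.
\<close>
lemma test_function_has_weak_gradient:
  assumes "bounded \<Omega>" "open \<Omega>" "test_function \<Omega> \<phi>"
  shows "has_weak_gradient \<Omega> \<phi> (\<lambda>x. \<Sum>i\<in>Basis. frechet_derivative \<phi> (at x) i *\<^sub>R i)"
  unfolding has_weak_gradient_def
proof (intro conjI allI impI)
  have m: "(\<lambda>x. frechet_derivative \<phi> (at x) i) \<in> L2_space \<Omega>" if "i \<in> Basis" for i
    using test_function_L2[OF assms] that by blast
  have "(\<lambda>x. \<Sum>i\<in>B. frechet_derivative \<phi> (at x) i *\<^sub>R i) \<in> L2_space \<Omega>"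
    if "finite B" "B \<subseteq> Basis" for B
    using that
  proof (induction B)
    case empty
    show ?case by (simp add: L2_space_def)
  next
    case (insert j B)
    have "(\<lambda>x. frechet_derivative \<phi> (at x) j *\<^sub>R j) \<in> L2_space \<Omega>"
      using m[of j] insert.prems by (auto simp: L2_space_def)
    then show ?case
      using L2_space_lincomb[of "\<lambda>x. frechet_derivative \<phi> (at x) j *\<^sub>R j" \<Omega>
          "\<lambda>x. \<Sum>i\<in>B. frechet_derivative \<phi> (at x) i *\<^sub>R i" 1 1] insert by simp
  qed
  then show "(\<lambda>x. \<Sum>i\<in>Basis. frechet_derivative \<phi> (at x) i *\<^sub>R i) \<in> L2_space \<Omega>" by simp
next
  fix \<psi> :: "'a \<Rightarrow> real" and i :: 'a
  assume \<psi>: "test_function \<Omega> \<psi>" and i: "i \<in> Basis"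
  note p = test_function_derivative[OF assms(3)] and s = test_function_derivative[OF \<psi>]
  define K where "K = closure {x. \<phi> x \<noteq> 0}"
  have K: "compact K" "K \<subseteq> \<Omega>" and K0: "\<And>x. x \<notin> K \<Longrightarrow> \<phi> x = 0" "\<And>x. x \<notin> K \<Longrightarrow> frechet_derivative \<phi> (at x) = (\<lambda>_. 0)"
    unfolding K_def by (use assms(3) in \<open>simp_all only: test_function_def\<close>) (rule p(4) p(5), assumption)+
  let ?D = "\<lambda>x h. \<phi> x * frechet_derivative \<psi> (at x) h + frechet_derivative \<phi> (at x) h * \<psi> x"
  have D: "((\<lambda>x. \<phi> x * \<psi> x) has_derivative ?D x) (at x)" for x
    by (rule has_derivative_mult[OF p(1) s(1)])
  have 0: "(LINT x|lborel. ?D x i) = 0"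
  proof (rule integral_directional_derivative_eq_0[OF D])
    show "continuous_on UNIV (\<lambda>x. ?D x i)"
      using i by (intro continuous_intros p s)
    show "compact K" by (rule K)
  qed (simp_all add: K0)
  have conv: "(LINT x|lebesgue_on \<Omega>. F x) = (LINT x|lborel. F x)"
    if F: "continuous_on UNIV F" "\<And>x. x \<notin> K \<Longrightarrow> F x = 0" for F :: "'a \<Rightarrow> real"
  proof -
    have "F x = indicator \<Omega> x * F x" for x
      using F(2)[of x] K(2) by (auto simp: indicator_def)
    then have "(LINT x|lebesgue. F x) = (LINT x|lebesgue. indicator \<Omega> x *\<^sub>R F x)"
      by (intro Bochner_Integration.integral_cong) auto
    then have "(LINT x|lebesgue_on \<Omega>. F x) = (LINT x|lebesgue. F x)"
      using assms(2) by (simp add: integral_restrict_space)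
    also have "\<dots> = (LINT x|lborel. F x)"
      using F(1) by (intro integral_completion) (simp add: borel_measurable_continuous_onI)
    finally show ?thesis .
  qed
  have c1: "continuous_on UNIV (\<lambda>x. \<phi> x * frechet_derivative \<psi> (at x) i)"
    and c2: "continuous_on UNIV (\<lambda>x. frechet_derivative \<phi> (at x) i * \<psi> x)"
    using i by (intro continuous_intros p s; simp)+
  have "integrable lborel (\<lambda>x. \<phi> x * frechet_derivative \<psi> (at x) i)"
    "integrable lborel (\<lambda>x. frechet_derivative \<phi> (at x) i * \<psi> x)"
    by (auto intro!: compactly_supported_integrable[OF c1 K(1)] compactly_supported_integrable[OF c2 K(1)] simp: K0)
  then have "(LINT x|lborel. \<phi> x * frechet_derivative \<psi> (at x) i) = - (LINT x|lborel. frechet_derivative \<phi> (at x) i * \<psi> x)"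
    using 0 by simp
  moreover have "(LINT x|lebesgue_on \<Omega>. \<phi> x * frechet_derivative \<psi> (at x) i) = (LINT x|lborel. \<phi> x * frechet_derivative \<psi> (at x) i)"
    by (intro conv[OF c1]) (simp add: K0)
  moreover have "(LINT x|lebesgue_on \<Omega>. frechet_derivative \<phi> (at x) i * \<psi> x) = (LINT x|lborel. frechet_derivative \<phi> (at x) i * \<psi> x)"
    by (intro conv[OF c2]) (simp add: K0)
  ultimately show "(LINT x|lebesgue_on \<Omega>. \<phi> x * frechet_derivative \<psi> (at x) i)
     = - (LINT x|lebesgue_on \<Omega>. ((\<Sum>i\<in>Basis. frechet_derivative \<phi> (at x) i *\<^sub>R i) \<bullet> i) * \<psi> x)"
    using i by simp
qed

lemma test_function_component_integrable:
  assumes "bounded \<Omega>" "open \<Omega>" "test_function \<Omega>' \<phi>" "h \<in> L2_space \<Omega>"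
  shows "integrable (lebesgue_on \<Omega>) (\<lambda>x. (h x \<bullet> i) * \<phi> x)"
proof -
  have "(\<lambda>x. \<phi> x *\<^sub>R i) \<in> L2_space \<Omega>"
    using test_function_L2(1)[OF assms(1-3)] by (auto simp: L2_space_def power_mult_distrib)
  from L2_inner_integrable[OF assms(4) this] show ?thesis by (simp add: mult.commute)
qed

text \<open>
  This is what makes \<^const>\<open>wgrad\<close>, an arbitrary choice, linear up to null sets.
\<close>
lemma weak_gradient_unique:
  assumes "bounded \<Omega>" "open \<Omega>" "has_weak_gradient \<Omega> v g" "has_weak_gradient \<Omega> v g'"
  shows "AE x in lebesgue_on \<Omega>. g x = g' x"
proof -
  have gL: "g \<in> L2_space \<Omega>" "g' \<in> L2_space \<Omega>"
    using assms by (auto simp: has_weak_gradient_def)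
  have gi: "integrable (lebesgue_on \<Omega>) g" "integrable (lebesgue_on \<Omega>) g'"
    by (rule L2_space_imp_integrable[OF assms(1,2)] gL)+
  have "AE x in lebesgue_on \<Omega>. (g x - g' x) \<bullet> i = 0" if i: "i \<in> Basis" for i
  proof (rule fundamental_lemma_of_calculus_of_variations[OF assms(2)])
    show "integrable (lebesgue_on \<Omega>) (\<lambda>x. (g x - g' x) \<bullet> i)"
      using gi by simp
    fix \<phi> :: "'a \<Rightarrow> real" assume \<phi>: "test_function \<Omega> \<phi>"
    note int = test_function_component_integrable[OF assms(1,2) \<phi>]
    have "(LINT x|lebesgue_on \<Omega>. (g x \<bullet> i) * \<phi> x) = (LINT x|lebesgue_on \<Omega>. (g' x \<bullet> i) * \<phi> x)"
      using has_weak_gradientD[OF assms(3) \<phi> i] has_weak_gradientD[OF assms(4) \<phi> i] by simp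
    then show "(LINT x|lebesgue_on \<Omega>. ((g x - g' x) \<bullet> i) * \<phi> x) = 0"
      using int[OF gL(1)] int[OF gL(2)] by (simp add: inner_diff_left left_diff_distrib)
  qed
  then have "AE x in lebesgue_on \<Omega>. \<forall>i\<in>Basis. (g x - g' x) \<bullet> i = 0"
    by (intro AE_finite_allI) auto
  then show ?thesis
    by eventually_elim (simp add: euclidean_eq_iff[where 'a='a] inner_diff_left)
qed

lemma has_weak_gradient_lincomb:
  assumes "bounded \<Omega>" "open \<Omega>" "v \<in> L2_space \<Omega>" "w \<in> L2_space \<Omega>"
    "has_weak_gradient \<Omega> v g" "has_weak_gradient \<Omega> w h"
  shows "has_weak_gradient \<Omega> (\<lambda>x. a * v x + b * w x) (\<lambda>x. a *\<^sub>R g x + b *\<^sub>R h x)"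
  unfolding has_weak_gradient_def
proof (intro conjI allI impI)
  show "(\<lambda>x. a *\<^sub>R g x + b *\<^sub>R h x) \<in> L2_space \<Omega>"
    using assms by (intro L2_space_lincomb) (auto simp: has_weak_gradient_def)
  fix \<phi> :: "'a \<Rightarrow> real" and i :: 'a assume \<phi>: "test_function \<Omega> \<phi>" and i: "i \<in> Basis"
  have gL: "g \<in> L2_space \<Omega>" "h \<in> L2_space \<Omega>"
    using assms by (auto simp: has_weak_gradient_def)
  note int = test_function_component_integrable[OF assms(1,2) \<phi>]
  have intv: "integrable (lebesgue_on \<Omega>) (\<lambda>x. u x * frechet_derivative \<phi> (at x) i)" if "u \<in> L2_space \<Omega>" for u
    using L2_mult_integrable[OF that test_function_L2(2)[OF assms(1,2) \<phi> i]] .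
  have "(\<lambda>x. (a * v x + b * w x) * frechet_derivative \<phi> (at x) i)
      = (\<lambda>x. a * (v x * frechet_derivative \<phi> (at x) i) + b * (w x * frechet_derivative \<phi> (at x) i))"
    by (simp add: algebra_simps)
  then have "(LINT x|lebesgue_on \<Omega>. (a * v x + b * w x) * frechet_derivative \<phi> (at x) i)
     = a * (LINT x|lebesgue_on \<Omega>. v x * frechet_derivative \<phi> (at x) i)
       + b * (LINT x|lebesgue_on \<Omega>. w x * frechet_derivative \<phi> (at x) i)"
    using intv[OF assms(3)] intv[OF assms(4)] by simp
  also have "\<dots> = - (a * (LINT x|lebesgue_on \<Omega>. (g x \<bullet> i) * \<phi> x) + b * (LINT x|lebesgue_on \<Omega>. (h x \<bullet> i) * \<phi> x))"
    by (simp add: has_weak_gradientD[OF assms(5) \<phi> i] has_weak_gradientD[OF assms(6) \<phi> i])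
  also have "(\<lambda>x. ((a *\<^sub>R g x + b *\<^sub>R h x) \<bullet> i) * \<phi> x) = (\<lambda>x. a * ((g x \<bullet> i) * \<phi> x) + b * ((h x \<bullet> i) * \<phi> x))"
    by (simp add: inner_add_left algebra_simps)
  then have "a * (LINT x|lebesgue_on \<Omega>. (g x \<bullet> i) * \<phi> x) + b * (LINT x|lebesgue_on \<Omega>. (h x \<bullet> i) * \<phi> x)
     = (LINT x|lebesgue_on \<Omega>. ((a *\<^sub>R g x + b *\<^sub>R h x) \<bullet> i) * \<phi> x)"
    using int[OF gL(1)] int[OF gL(2)] by simp
  finally show "(LINT x|lebesgue_on \<Omega>. (a * v x + b * w x) * frechet_derivative \<phi> (at x) i)
     = - (LINT x|lebesgue_on \<Omega>. ((a *\<^sub>R g x + b *\<^sub>R h x) \<bullet> i) * \<phi> x)" .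
qed

lemma H1D:
  assumes "v \<in> H1 \<Omega>"
  shows "v \<in> L2_space \<Omega>" "has_weak_gradient \<Omega> v (wgrad \<Omega> v)" "wgrad \<Omega> v \<in> L2_space \<Omega>"
proof -
  show "v \<in> L2_space \<Omega>" using assms by (simp add: H1_def)
  show "has_weak_gradient \<Omega> v (wgrad \<Omega> v)"
    using assms someI_ex[of "has_weak_gradient \<Omega> v"] by (simp add: H1_def wgrad_def)
  then show "wgrad \<Omega> v \<in> L2_space \<Omega>" by (simp add: has_weak_gradient_def)
qed

lemma H1_lincomb:
  assumes "bounded \<Omega>" "open \<Omega>" "v \<in> H1 \<Omega>" "w \<in> H1 \<Omega>"
  shows "(\<lambda>x. a * v x + b * w x) \<in> H1 \<Omega>"
    and "AE x in lebesgue_on \<Omega>. wgrad \<Omega> (\<lambda>x. a * v x + b * w x) x = a *\<^sub>R wgrad \<Omega> v x + b *\<^sub>R wgrad \<Omega> w x"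
proof -
  have g: "has_weak_gradient \<Omega> (\<lambda>x. a * v x + b * w x) (\<lambda>x. a *\<^sub>R wgrad \<Omega> v x + b *\<^sub>R wgrad \<Omega> w x)"
    using assms by (intro has_weak_gradient_lincomb H1D)
  then show H: "(\<lambda>x. a * v x + b * w x) \<in> H1 \<Omega>"
    using L2_space_real_lincomb[OF H1D(1)[OF assms(3)] H1D(1)[OF assms(4)]] by (auto simp: H1_def)
  show "AE x in lebesgue_on \<Omega>. wgrad \<Omega> (\<lambda>x. a * v x + b * w x) x = a *\<^sub>R wgrad \<Omega> v x + b *\<^sub>R wgrad \<Omega> w x"
    by (rule weak_gradient_unique[OF assms(1,2) H1D(2)[OF H] g])
qed

lemma test_function_H1:
  "bounded \<Omega> \<Longrightarrow> open \<Omega> \<Longrightarrow> test_function \<Omega> \<phi> \<Longrightarrow> \<phi> \<in> H1 \<Omega>"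
  unfolding H1_def using test_function_L2(1) test_function_has_weak_gradient by blast

lemma H1_norm_nonneg [simp]: "0 \<le> H1_norm \<Omega> v"
  by (simp add: H1_norm_def)

lemma L2_norm_wgrad_lincomb:
  assumes "bounded \<Omega>" "open \<Omega>" "v \<in> H1 \<Omega>" "w \<in> H1 \<Omega>"
  shows "L2_norm \<Omega> (wgrad \<Omega> (\<lambda>x. a * v x + b * w x)) = L2_norm \<Omega> (\<lambda>x. a *\<^sub>R wgrad \<Omega> v x + b *\<^sub>R wgrad \<Omega> w x)"
  using H1_lincomb[OF assms, of a b] assms
  by (intro L2_norm_cong_AE L2_spaceD H1D L2_space_lincomb)

lemma H1_norm_triangle:
  assumes "bounded \<Omega>" "open \<Omega>" "v \<in> H1 \<Omega>" "w \<in> H1 \<Omega>"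
  shows "H1_norm \<Omega> (\<lambda>x. v x + w x) \<le> H1_norm \<Omega> v + H1_norm \<Omega> w"
proof -
  have "H1_norm \<Omega> (\<lambda>x. v x + w x)
     \<le> sqrt ((L2_norm \<Omega> v + L2_norm \<Omega> w)\<^sup>2 + (L2_norm \<Omega> (wgrad \<Omega> v) + L2_norm \<Omega> (wgrad \<Omega> w))\<^sup>2)"
    unfolding H1_norm_def
    using L2_norm_wgrad_lincomb[OF assms, of 1 1]
      L2_norm_triangle[OF H1D(3)[OF assms(3)] H1D(3)[OF assms(4)]]
      L2_norm_triangle[OF H1D(1)[OF assms(3)] H1D(1)[OF assms(4)]]
    by (intro real_sqrt_le_mono add_mono power_mono) auto
  also have "\<dots> \<le> H1_norm \<Omega> v + H1_norm \<Omega> w"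
    unfolding H1_norm_def by (rule real_sqrt_sum_squares_triangle_ineq)
  finally show ?thesis .
qed

lemma H1_scale:
  assumes "bounded \<Omega>" "open \<Omega>" "v \<in> H1 \<Omega>"
  shows "(\<lambda>x. c * v x) \<in> H1 \<Omega>" "H1_norm \<Omega> (\<lambda>x. c * v x) = \<bar>c\<bar> * H1_norm \<Omega> v"
proof -
  show "(\<lambda>x. c * v x) \<in> H1 \<Omega>" using H1_lincomb(1)[OF assms assms(3), of c 0] by simp
  have "L2_norm \<Omega> (wgrad \<Omega> (\<lambda>x. c * v x)) = \<bar>c\<bar> * L2_norm \<Omega> (wgrad \<Omega> v)"
    using L2_norm_wgrad_lincomb[OF assms assms(3), of c 0] by (simp add: L2_norm_scale)
  moreover have "L2_norm \<Omega> (\<lambda>x. c * v x) = \<bar>c\<bar> * L2_norm \<Omega> v"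
    using L2_norm_scale[of \<Omega> c v] by simp
  ultimately have "H1_norm \<Omega> (\<lambda>x. c * v x) = sqrt (\<bar>c\<bar>\<^sup>2 * ((L2_norm \<Omega> v)\<^sup>2 + (L2_norm \<Omega> (wgrad \<Omega> v))\<^sup>2))"
    by (simp add: H1_norm_def power_mult_distrib distrib_left)
  then show "H1_norm \<Omega> (\<lambda>x. c * v x) = \<bar>c\<bar> * H1_norm \<Omega> v"
    by (simp add: H1_norm_def real_sqrt_mult)
qed

lemma H1_diff:
  assumes "bounded \<Omega>" "open \<Omega>" "v \<in> H1 \<Omega>" "w \<in> H1 \<Omega>"
  shows "(\<lambda>x. v x - w x) \<in> H1 \<Omega>"
    and "H1_norm \<Omega> (\<lambda>x. v x - w x) \<le> H1_norm \<Omega> v + H1_norm \<Omega> w"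
  using H1_lincomb(1)[OF assms, of 1 "-1"] H1_norm_triangle[OF assms(1-3) H1_scale(1)[OF assms(1,2,4), of "-1"]]
    H1_scale(2)[OF assms(1,2,4), of "-1"] by simp_all

section \<open>Subspaces of \<open>H\<^sup>1\<close>\<close>

text \<open>
  The two spaces \<open>V\<close> of the boundary conditions enter the time-dependent theory only through this property.
\<close>
definition H1_subspace :: "'a::euclidean_space set \<Rightarrow> ('a \<Rightarrow> real) set \<Rightarrow> bool" where
  "H1_subspace \<Omega> V \<longleftrightarrow> V \<subseteq> H1 \<Omega> \<and> (\<forall>v\<in>V. \<forall>w\<in>V. \<forall>a b. (\<lambda>x. a * v x + b * w x) \<in> V)"

text \<open>
  The triangle inequality for \<^const>\<open>H1_norm\<close> is available for \<open>v - \<phi>\<close> because test functions belong to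
  \<open>H\<^sup>1\<close> themselves.
\<close>
lemma H1_subspace_H1_0:
  assumes "bounded \<Omega>" "open \<Omega>"
  shows "H1_subspace \<Omega> (H1_0 \<Omega>)"
  unfolding H1_subspace_def
proof (intro conjI ballI allI)
  show "H1_0 \<Omega> \<subseteq> H1 \<Omega>" by (auto simp: H1_0_def)
  fix v w a b assume "v \<in> H1_0 \<Omega>" "w \<in> H1_0 \<Omega>"
  then obtain \<phi> \<psi> :: "nat \<Rightarrow> 'a \<Rightarrow> real" where
    H: "v \<in> H1 \<Omega>" "w \<in> H1 \<Omega>" and t: "\<And>n. test_function \<Omega> (\<phi> n)" "\<And>n. test_function \<Omega> (\<psi> n)"
    and lim: "(\<lambda>n. H1_norm \<Omega> (\<lambda>x. v x - \<phi> n x)) \<longlonglongrightarrow> 0" "(\<lambda>n. H1_norm \<Omega> (\<lambda>x. w x - \<psi> n x)) \<longlonglongrightarrow> 0"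
    by (auto simp: H1_0_def)
  have le: "H1_norm \<Omega> (\<lambda>x. (a * v x + b * w x) - (a * \<phi> n x + b * \<psi> n x))
     \<le> \<bar>a\<bar> * H1_norm \<Omega> (\<lambda>x. v x - \<phi> n x) + \<bar>b\<bar> * H1_norm \<Omega> (\<lambda>x. w x - \<psi> n x)" for n
  proof -
    have d: "(\<lambda>x. v x - \<phi> n x) \<in> H1 \<Omega>" "(\<lambda>x. w x - \<psi> n x) \<in> H1 \<Omega>"
      by (intro H1_diff(1)[OF assms] H test_function_H1[OF assms] t)+
    have "(\<lambda>x. (a * v x + b * w x) - (a * \<phi> n x + b * \<psi> n x))
        = (\<lambda>x. a * (v x - \<phi> n x) + b * (w x - \<psi> n x))"
      by (simp add: algebra_simps)
    then show ?thesis
      using H1_norm_triangle[OF assms H1_scale(1)[OF assms d(1), of a] H1_scale(1)[OF assms d(2), of b]]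
      by (simp only: H1_scale(2)[OF assms d(1)] H1_scale(2)[OF assms d(2)])
  qed
  have "(\<lambda>n. \<bar>a\<bar> * H1_norm \<Omega> (\<lambda>x. v x - \<phi> n x) + \<bar>b\<bar> * H1_norm \<Omega> (\<lambda>x. w x - \<psi> n x)) \<longlonglongrightarrow> \<bar>a\<bar> * 0 + \<bar>b\<bar> * 0"
    by (intro tendsto_intros lim)
  then have bound: "(\<lambda>n. \<bar>a\<bar> * H1_norm \<Omega> (\<lambda>x. v x - \<phi> n x) + \<bar>b\<bar> * H1_norm \<Omega> (\<lambda>x. w x - \<psi> n x)) \<longlonglongrightarrow> 0"
    by simp
  have "(\<lambda>n. H1_norm \<Omega> (\<lambda>x. (a * v x + b * w x) - (a * \<phi> n x + b * \<psi> n x))) \<longlonglongrightarrow> 0"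
    by (rule Lim_null_comparison[OF _ bound]) (simp add: le)
  then show "(\<lambda>x. a * v x + b * w x) \<in> H1_0 \<Omega>"
    unfolding H1_0_def using H1_lincomb(1)[OF assms H, of a b] test_function_lincomb[OF t]
    by (auto intro!: exI[of _ "\<lambda>n x. a * \<phi> n x + b * \<psi> n x"])
qed

lemma H1_subspace_H1_per:
  "H1_subspace (box a b) (H1_per a b)"
  unfolding H1_subspace_def
proof (intro conjI ballI allI)
  show "H1_per a b \<subseteq> H1 (box a b)" by (auto simp: H1_per_def)
  fix v w s t assume "v \<in> H1_per a b" "w \<in> H1_per a b"
  then obtain v' w' where H: "v \<in> H1 (box a b)" "w \<in> H1 (box a b)"
    and v': "box_periodic a b v'" "\<And>r. r > 0 \<Longrightarrow> v' \<in> H1 (ball 0 r)" "AE x in lebesgue_on (box a b). v x = v' x"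
    and w': "box_periodic a b w'" "\<And>r. r > 0 \<Longrightarrow> w' \<in> H1 (ball 0 r)" "AE x in lebesgue_on (box a b). w x = w' x"
    unfolding H1_per_def by blast
  have 1: "box_periodic a b (\<lambda>x. s * v' x + t * w' x)"
    using v'(1) w'(1) by (simp add: box_periodic_def)
  have 2: "(\<lambda>x. s * v' x + t * w' x) \<in> H1 (ball 0 r)" if "r > 0" for r
    using v'(2) w'(2) that by (intro H1_lincomb) auto
  have 3: "AE x in lebesgue_on (box a b). s * v x + t * w x = s * v' x + t * w' x"
    using v'(3) w'(3) by eventually_elim simp
  show "(\<lambda>x. s * v x + t * w x) \<in> H1_per a b"
    unfolding H1_per_def using H1_lincomb(1)[OF _ _ H, of s t] 1 2 3 by auto
qed

section \<open>Integrals over the time interval\<close>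

lemma continuous_imp_antiderivative:
  fixes f :: "real \<Rightarrow> real"
  assumes "continuous_on UNIV f"
  obtains F where "\<And>x. (F has_real_derivative f x) (at x)"
proof -
  have "isCont f x" for x
    using assms by (simp add: continuous_on_eq_continuous_at)
  then have "\<exists>F. \<forall>x::real. -\<infinity> < ereal x \<longrightarrow> ereal x < \<infinity> \<longrightarrow> (F has_vector_derivative f x) (at x)"
    by (intro einterval_antiderivative) auto
  then show ?thesis
    using that by (auto simp: has_real_derivative_iff_has_vector_derivative)
qed

lemma has_bochner_integral_time_interval:
  fixes f F :: "real \<Rightarrow> real"
  assumes "0 \<le> a" "a \<le> b" "b < T"
    and F: "\<And>x. (F has_real_derivative f x) (at x)" and f: "continuous_on UNIV f"
  shows "has_bochner_integral (lebesgue_on {0<..<T}) (\<lambda>t. indicator {a<..b} t * f t) (F b - F a)"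
proof -
  have "has_bochner_integral lborel (\<lambda>x. f x * indicator {a..b} x) (F b - F a)"
    using assms f by (intro has_bochner_integral_FTC_Icc_real) (auto simp: continuous_on_eq_continuous_at)
  then have 1: "has_bochner_integral lebesgue (\<lambda>x. f x * indicator {a..b} x) (F b - F a)"
    using integrable_completion[OF borel_measurable_has_bochner_integral] integral_completion[OF borel_measurable_has_bochner_integral]
    by (metis has_bochner_integral_iff)
  have m: "f \<in> borel_measurable lebesgue"
    using f by (intro measurable_completion) (simp add: borel_measurable_continuous_onI)
  have "has_bochner_integral lebesgue (\<lambda>x. indicator {0<..<T} x *\<^sub>R (indicator {a<..b} x * f x)) (F b - F a)"
  proof (rule has_bochner_integral_cong_AE[THEN iffD1, OF _ _ _ 1])
    show "(\<lambda>x. f x * indicator {a..b} x) \<in> borel_measurable lebesgue"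
      "(\<lambda>x. indicator {0<..<T} x *\<^sub>R (indicator {a<..b} x * f x)) \<in> borel_measurable lebesgue"
      using m by (auto intro!: borel_measurable_times borel_measurable_indicator)
    have "AE x in lebesgue. x \<noteq> a"
      by (rule AE_not_in[of "{a}", simplified]) (simp add: null_sets_completionI)
    then show "AE x in lebesgue. f x * indicator {a..b} x = indicator {0<..<T} x *\<^sub>R (indicator {a<..b} x * f x)"
      by eventually_elim (use assms(1,3) in \<open>auto simp: indicator_def\<close>)
  qed
  then show ?thesis
    by (simp add: has_bochner_integral_iff integrable_restrict_space integral_restrict_space)
qed

lemma finite_measure_time: "finite_measure (lebesgue_on {0<..<T::real})"
  by (rule finite_measure_lebesgue_on) auto

lemma interval_sets_time: "0 \<le> a \<Longrightarrow> b < T \<Longrightarrow> {a<..b} \<in> sets (lebesgue_on {0<..<T::real})"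
  by (auto simp: sets_restrict_space intro!: image_eqI[of _ _ "{a<..b}"])

lemma integrable_indicator_time:
  fixes f :: "'a \<Rightarrow> real"
  shows "integrable M f \<Longrightarrow> A \<in> sets M \<Longrightarrow> integrable M (\<lambda>t. indicator A t * f t)"
  using integrable_mult_indicator[of A M f] by simp

lemma continuous_measurable_time:
  "continuous_on UNIV f \<Longrightarrow> (f :: real \<Rightarrow> real) \<in> borel_measurable (lebesgue_on {0<..<T})"
  by (intro continuous_imp_measurable_on_sets_lebesgue) (auto intro: continuous_on_subset)

lemma continuous_integrable_time:
  assumes "continuous_on UNIV f"
  shows "integrable (lebesgue_on {0<..<T}) (f :: real \<Rightarrow> real)"
proof -
  interpret finite_measure "lebesgue_on {0<..<T::real}" by (rule finite_measure_time)
  have "bounded (f ` {0..T})"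
    using assms by (intro compact_imp_bounded compact_continuous_image) (auto intro: continuous_on_subset)
  then obtain B where "\<forall>x\<in>{0..T}. \<bar>f x\<bar> \<le> B" by (auto simp: bounded_iff)
  then show ?thesis
    using continuous_measurable_time[OF assms] by (intro integrable_const_bound[of _ B]) (auto intro!: AE_I2)
qed

section \<open>From distributional to integrated time derivatives\<close>

text \<open>
  A mollified Heaviside function \<open>S\<close> that rises from 0 to 1 on \<open>[0,h]\<close>, with derivative \<open>\<beta>\<close>, a mollifier
  of mass one.
\<close>
definition smooth_step :: "real \<Rightarrow> (real \<Rightarrow> real) \<Rightarrow> (real \<Rightarrow> real) \<Rightarrow> bool" where
  "smooth_step h S \<beta> \<longleftrightarrow> (\<forall>x. (S has_real_derivative \<beta> x) (at x)) \<and> (\<forall>k s. Ck_fun k (\<lambda>x. \<beta> (x - s))) \<and>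
     (\<forall>x\<le>0. S x = 0) \<and> (\<forall>x\<ge>h. S x = 1) \<and> (\<forall>x. 0 \<le> S x \<and> S x \<le> 1) \<and>
     (\<forall>x. 0 \<le> \<beta> x) \<and> (\<forall>x. x \<le> 0 \<or> h \<le> x \<longrightarrow> \<beta> x = 0)"

lemma smooth_stepD:
  assumes "smooth_step h S \<beta>"
  shows "(S has_real_derivative \<beta> x) (at x)" "Ck_fun k (\<lambda>x. \<beta> (x - s))" "x \<le> 0 \<Longrightarrow> S x = 0" "h \<le> x \<Longrightarrow> S x = 1"
    "0 \<le> S x" "S x \<le> 1" "0 \<le> \<beta> x" "x \<le> 0 \<or> h \<le> x \<Longrightarrow> \<beta> x = 0"
  using assms unfolding smooth_step_def by blast+

text \<open>
  \<open>S\<close> is the antiderivative of a bump, normalised to have total increment one.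
\<close>
lemma smooth_step_exists:
  fixes h :: real
  assumes "h > 0"
  shows "\<exists>S \<beta>. smooth_step h S \<beta>"
proof -
  define b where "b = box_bump 0 (0::real) h"
  have b0: "b x = 0 \<longleftrightarrow> x \<le> 0 \<or> h \<le> x" for x
    by (auto simp: b_def box_bump_eq_0_iff mem_box)
  have bpos: "0 \<le> b x" for x by (simp add: b_def box_bump_bounds)
  have bk: "Ck_fun k (\<lambda>x. b (x - s))" for k s
  proof -
    have "(\<lambda>x. b (x - s)) = box_bump 0 s (s + h)"
      by (rule ext) (simp add: b_def box_bump_def algebra_simps)
    then show ?thesis by (simp only: Ck_fun_box_bump)
  qed
  have "continuous_on UNIV b" using bk[of 0 0] by simp
  then obtain F where F: "\<And>x. (F has_real_derivative b x) (at x)"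
    using continuous_imp_antiderivative by blast
  have mono: "F x \<le> F y" if "x \<le> y" for x y
    using that F bpos by (intro DERIV_nonneg_imp_nondecreasing[of x y F]) blast+
  have mvt: "\<exists>z. x < z \<and> z < y \<and> F y - F x = (y - x) * b z" if "x < y" for x y
    using MVT2[OF that, of F b] F by blast
  have c0: "F x = F 0" if "x \<le> 0" for x
  proof (cases "x = 0")
    case False
    then obtain z where "z < 0" "F 0 - F x = (0 - x) * b z" using mvt[of x 0] \<open>x \<le> 0\<close> by auto
    then show ?thesis using b0[of z] by simp
  qed simp
  have c1: "F x = F h" if "h \<le> x" for x
  proof (cases "x = h")
    case False
    then obtain z where "h < z" "F x - F h = (x - h) * b z" using mvt[of h x] \<open>h \<le> x\<close> by auto
    then show ?thesis using b0[of z] by simp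
  qed simp
  have lt: "F 0 < F h"
  proof -
    obtain z where z: "0 < z" "z < h" "F h - F 0 = (h - 0) * b z" using mvt[OF assms] by blast
    then have "b z > 0" using b0[of z] bpos[of z] by simp
    then show ?thesis using z(3) mult_pos_pos[OF assms \<open>b z > 0\<close>] by simp
  qed
  define m where "m = F h - F 0"
  have m: "m > 0" using lt by (simp add: m_def)
  have "smooth_step h (\<lambda>x. (F x - F 0) / m) (\<lambda>x. b x / m)"
    unfolding smooth_step_def
  proof (intro conjI allI impI)
    show "((\<lambda>x. (F x - F 0) / m) has_real_derivative b x / m) (at x)" for x
      using DERIV_cdivide[OF DERIV_diff[OF F[of x] DERIV_const[of "F 0"]], of m] by simp
    show "Ck_fun k (\<lambda>x. b (x - s) / m)" for k s
      using Ck_fun_cmult[OF bk[of k s], of "1 / m"] by simp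
    show "x \<le> 0 \<Longrightarrow> (F x - F 0) / m = 0" for x using c0[of x] by simp
    show "h \<le> x \<Longrightarrow> (F x - F 0) / m = 1" for x using c1[of x] m by (simp add: m_def)
    show "0 \<le> (F x - F 0) / m" for x
      using m mono[of 0 x] c0[of x] by (cases "x \<le> 0") auto
    show "(F x - F 0) / m \<le> 1" for x
      using m mono[of x h] c1[of x] by (cases "x \<le> h") (auto simp: m_def field_simps)
    show "0 \<le> b x / m" for x using bpos m by simp
    show "x \<le> 0 \<or> h \<le> x \<Longrightarrow> b x / m = 0" for x using b0 by simp
  qed
  then show ?thesis by blast
qed

text \<open>
  The difference of two shifted steps is a mollified indicator of \<open>(s,t]\<close>.
\<close>
lemma test_function_plateau:
  assumes "0 < s" "s \<le> t" "t < T" "0 < h" "t + h < T" and "smooth_step h S \<beta>"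
  shows "test_function {0<..<T} (\<lambda>x. S (x - s) - S (x - t))"
    and "deriv (\<lambda>x. S (x - s) - S (x - t)) = (\<lambda>x. \<beta> (x - s) - \<beta> (x - t))"
proof -
  note S = smooth_stepD[OF assms(6)]
  let ?\<psi> = "\<lambda>x. S (x - s) - S (x - t)"
  have D: "(?\<psi> has_real_derivative \<beta> (x - s) - \<beta> (x - t)) (at x)" for x
  proof -
    have "((\<lambda>x. S (x - r)) has_real_derivative \<beta> (x - r)) (at x)" for r
      using S(1)[of "x - r"] DERIV_shift[of S "\<beta> (x - r)" x "- r"] by simp
    then show ?thesis by (intro DERIV_diff)
  qed
  show "deriv ?\<psi> = (\<lambda>x. \<beta> (x - s) - \<beta> (x - t))"
    by (rule ext) (rule DERIV_imp_deriv[OF D])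
  have fd: "frechet_derivative ?\<psi> (at x) = (*) (\<beta> (x - s) - \<beta> (x - t))" for x
    using D[of x] unfolding has_field_derivative_def by (rule frechet_derivative_at[symmetric])
  have ck: "Ck_fun k (\<lambda>x. \<beta> (x - s) - \<beta> (x - t))" for k
    using Ck_fun_add[OF S(2)[of k s] Ck_fun_cmult[OF S(2)[of k t], of "-1"]] by simp
  have "Ck_fun (Suc k) ?\<psi>" for k
    unfolding Ck_fun.simps fd
    using ck[of k] D unfolding has_field_derivative_def differentiable_def by auto
  note cks = this
  have "Ck_fun k ?\<psi>" for k
  proof (cases k)
    case 0
    then show ?thesis using Ck_fun_imp_continuous[OF cks[of 0]] by simp
  qed (use cks in \<open>simp only:\<close>)
  moreover have sup: "closure {x. ?\<psi> x \<noteq> 0} \<subseteq> {s..t + h}"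
  proof (rule closure_minimal)
    show "{x. ?\<psi> x \<noteq> 0} \<subseteq> {s..t + h}"
    proof (rule ccontr)
      assume "\<not> ?thesis"
      then obtain x where x: "?\<psi> x \<noteq> 0" "x < s \<or> t + h < x" by force
      from x(2) show False
      proof
        assume "x < s" then show False using x(1) S(3)[of "x - s"] S(3)[of "x - t"] assms(2) by simp
      next
        assume "t + h < x" then show False using x(1) S(4)[of "x - s"] S(4)[of "x - t"] assms(2) by simp
      qed
    qed
  qed simp
  moreover have "compact (closure {x. ?\<psi> x \<noteq> 0})"
    using compact_Int_closed[OF compact_Icc closed_closure, of s "t + h" "{x. ?\<psi> x \<noteq> 0}"] sup
    by (simp add: Int_absorb1)
  ultimately show "test_function {0<..<T} ?\<psi>"
    using assms by (auto simp: test_function_def)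
qed

text \<open>
  Testing with plateaus of edge width \<open>h n\<close> turns the right-hand side into the integral of \<open>k\<close> over \<open>(s,t]\<close>.
  On the left, the derivative of a plateau is a mollifier at \<open>s\<close> minus a mollifier at \<open>t\<close>, so that
  continuity of \<open>g\<close> gives \<open>g s - g t\<close>.
\<close>
lemma weak_derivative_imp_FTC:
  fixes g k :: "real \<Rightarrow> real"
  assumes st: "0 < s" "s \<le> t" "t < T" and g: "continuous_on UNIV g"
    and k: "integrable (lebesgue_on {0<..<T}) k"
    and weak: "\<And>\<psi>. test_function {0<..<T} \<psi> \<Longrightarrow>
      (LINT r|lebesgue_on {0<..<T}. g r * deriv \<psi> r) = - (LINT r|lebesgue_on {0<..<T}. k r * \<psi> r)"
  shows "g t - g s = (LINT r|lebesgue_on {0<..<T}. indicator {s<..t} r * k r)"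
proof -
  let ?M = "lebesgue_on {0<..<T}"
  \<comment> \<open>The right edge \<open>t + h n\<close> has to stay below \<open>T\<close>, hence \<open>Suc (Suc n)\<close>.\<close>
  define h where "h n = (T - t) * inverse (real (Suc (Suc n)))" for n
  have h: "0 < h n" "t + h n < T" for n
  proof -
    have "inverse (real (Suc (Suc n))) < 1" by (simp add: field_simps)
    then have "(T - t) * inverse (real (Suc (Suc n))) < (T - t) * 1"
      using st by (intro mult_strict_left_mono) auto
    then have "h n < T - t" by (simp only: h_def mult_1_right)
    then show "t + h n < T" by linarith
    show "0 < h n" using st by (simp add: h_def)
  qed
  have h0: "h \<longlonglongrightarrow> 0"
    using tendsto_mult_left[OF LIMSEQ_Suc[OF LIMSEQ_inverse_real_of_nat], of "T - t"] by (simp add: h_def[abs_def])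
  have "\<forall>n. \<exists>S \<beta>. smooth_step (h n) S \<beta>"
    using smooth_step_exists[OF h(1)] by blast
  then obtain S \<beta> where Sb: "\<And>n. smooth_step (h n) (S n) (\<beta> n)"
    using choice by meson
  note S = smooth_stepD[OF Sb]
  have \<beta>c: "continuous_on UNIV (\<lambda>x. \<beta> n (x - r))" for n r
    using S(2) Ck_fun_imp_continuous by blast
  have Sc: "continuous_on UNIV (\<lambda>x. S n (x - r))" for n r
  proof -
    have "continuous_on UNIV (S n)"
      using S(1) by (meson DERIV_isCont continuous_at_imp_continuous_on)
    then show ?thesis by (rule continuous_on_compose2) (auto intro!: continuous_intros)
  qed
  define \<psi> where "\<psi> n x = S n (x - s) - S n (x - t)" for n x
  note tf = test_function_plateau[OF st h Sb, folded \<psi>_def]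
  have kl: "(\<lambda>n. LINT r|?M. k r * \<psi> n r) \<longlonglongrightarrow> (LINT r|?M. indicator {s<..t} r * k r)"
  proof (rule integral_dominated_convergence[where w="\<lambda>r. norm (k r)"])
    show "(\<lambda>r. indicator {s<..t} r * k r) \<in> borel_measurable ?M"
      using st by (intro borel_measurable_integrable integrable_indicator_time[OF k interval_sets_time]) auto
    show "(\<lambda>r. k r * \<psi> n r) \<in> borel_measurable ?M" for n
      unfolding \<psi>_def using k Sc
      by (intro borel_measurable_times borel_measurable_integrable[OF k] borel_measurable_diff continuous_measurable_time)
    show "AE r in ?M. (\<lambda>n. k r * \<psi> n r) \<longlonglongrightarrow> indicator {s<..t} r * k r"
    proof (rule AE_I2)
      fix r
      have "\<forall>\<^sub>F n in sequentially. \<psi> n r = indicator {s<..t} r"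
      proof -
        consider "r \<le> s" | "s < r" "r \<le> t" | "t < r" by linarith
        then show ?thesis
        proof cases
          case 1 then show ?thesis using S(3) st by (simp add: \<psi>_def)
        next
          case 2
          then have "\<forall>\<^sub>F n in sequentially. h n < r - s"
            using h0 by (intro order_tendstoD(2)) auto
          then show ?thesis by eventually_elim (use 2 S(3,4) in \<open>simp add: \<psi>_def\<close>)
        next
          case 3
          then have "\<forall>\<^sub>F n in sequentially. h n < r - t"
            using h0 by (intro order_tendstoD(2)) auto
          then show ?thesis by eventually_elim (use 3 S(4) st in \<open>simp add: \<psi>_def\<close>)
        qed
      qed
      then have "(\<lambda>n. \<psi> n r) \<longlonglongrightarrow> indicator {s<..t} r"
        by (rule tendsto_eventually)
      then show "(\<lambda>n. k r * \<psi> n r) \<longlonglongrightarrow> indicator {s<..t} r * k r"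
        by (subst mult.commute[of _ "k r"]) (intro tendsto_mult tendsto_const)
    qed
    have "\<bar>\<psi> n r\<bar> \<le> 1" for n r
      unfolding \<psi>_def using S(5)[of n "r - s"] S(5)[of n "r - t"] S(6)[of n "r - s"] S(6)[of n "r - t"] by simp
    then show "AE r in ?M. norm (k r * \<psi> n r) \<le> norm (k r)" for n
      by (intro AE_I2) (simp add: abs_mult mult_left_le)
  qed (use k in simp)
  have gl: "(\<lambda>n. LINT x|?M. g x * \<beta> n (x - r)) \<longlonglongrightarrow> g r" if r: "s \<le> r" "r \<le> t" for r
  proof (rule LIMSEQ_I)
    fix e :: real assume "e > 0"
    have one: "has_bochner_integral ?M (\<lambda>x. indicator {r<..r + h n} x * \<beta> n (x - r)) 1" for n
    proof -
      have "((\<lambda>x. S n (x - r)) has_real_derivative \<beta> n (x - r)) (at x)" for x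
        using S(1)[of n "x - r"] DERIV_shift[of "S n" "\<beta> n (x - r)" x "- r"] by simp
      from has_bochner_integral_time_interval[OF _ _ _ this \<beta>c, of r "r + h n" T]
      show ?thesis using r st h[of n] S(3)[of 0 n] S(4)[of n "h n"] by simp
    qed
    have ind: "indicator {r<..r + h n} x * \<beta> n (x - r) = \<beta> n (x - r)" for n x
    proof (cases "r < x \<and> x \<le> r + h n")
      case False
      then have "x - r \<le> 0 \<or> h n \<le> x - r" by linarith
      then show ?thesis by (simp add: S(8))
    qed simp
    have one': "integrable ?M (\<lambda>x. \<beta> n (x - r))" "(LINT x|?M. \<beta> n (x - r)) = 1" for n
      using one[of n] unfolding ind by (auto simp: has_bochner_integral_iff)
    obtain d where d: "d > 0" "\<And>x. \<bar>x - r\<bar> < d \<Longrightarrow> \<bar>g x - g r\<bar> < e / 2"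
      using g \<open>e > 0\<close> unfolding continuous_on_iff by (metis UNIV_I dist_real_def half_gt_zero)
    obtain n0 where n0: "\<And>n. n \<ge> n0 \<Longrightarrow> h n < d"
      using order_tendstoD(2)[OF h0 d(1)] by (auto simp: eventually_sequentially)
    have "norm ((LINT x|?M. g x * \<beta> n (x - r)) - g r) < e" if "n \<ge> n0" for n
    proof -
      have gi: "integrable ?M (\<lambda>x. g x * \<beta> n (x - r))"
        by (intro continuous_integrable_time continuous_on_mult g \<beta>c)
      have di: "integrable ?M (\<lambda>x. (g x - g r) * \<beta> n (x - r))"
        by (intro continuous_integrable_time continuous_on_mult continuous_on_diff continuous_on_const g \<beta>c)
      have "(LINT x|?M. g x * \<beta> n (x - r)) - g r = (LINT x|?M. (g x - g r) * \<beta> n (x - r))"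
        using gi one'[of n] by (simp add: left_diff_distrib)
      moreover have "\<bar>LINT x|?M. (g x - g r) * \<beta> n (x - r)\<bar> \<le> (LINT x|?M. e / 2 * \<beta> n (x - r))"
      proof (rule integral_abs_bound[THEN order_trans], rule integral_mono)
        show "integrable ?M (\<lambda>x. \<bar>(g x - g r) * \<beta> n (x - r)\<bar>)" using di by simp
        show "integrable ?M (\<lambda>x. e / 2 * \<beta> n (x - r))" using one' by simp
        fix x
        show "\<bar>(g x - g r) * \<beta> n (x - r)\<bar> \<le> e / 2 * \<beta> n (x - r)"
        proof (cases "r < x \<and> x < r + h n")
          case True
          then have "\<bar>g x - g r\<bar> \<le> e / 2"
            using d(2)[of x] n0[OF that] by simp
          then have "\<bar>g x - g r\<bar> * \<beta> n (x - r) \<le> e / 2 * \<beta> n (x - r)"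
            by (rule mult_right_mono) (rule S(7))
          then show ?thesis using S(7)[of n "x - r"] by (simp add: abs_mult)
        next
          case False
          then have "x - r \<le> 0 \<or> h n \<le> x - r" by linarith
          then have "\<beta> n (x - r) = 0" by (rule S(8))
          then show ?thesis by simp
        qed
      qed
      ultimately show ?thesis using one'[of n] \<open>e > 0\<close> by simp
    qed
    then show "\<exists>no. \<forall>n\<ge>no. norm ((LINT x|?M. g x * \<beta> n (x - r)) - g r) < e" by blast
  qed
  have "(LINT x|?M. g x * \<beta> n (x - s)) - (LINT x|?M. g x * \<beta> n (x - t)) = - (LINT r|?M. k r * \<psi> n r)" for n
  proof -
    have "integrable ?M (\<lambda>x. g x * \<beta> n (x - r))" for r
      by (intro continuous_integrable_time continuous_on_mult g \<beta>c)
    then show ?thesis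
      using weak[OF tf(1)[of n]] tf(2)[of n] by (simp add: right_diff_distrib)
  qed
  then have "g s - g t = - (LINT r|?M. indicator {s<..t} r * k r)"
    using LIMSEQ_unique[OF tendsto_diff[OF gl[of s] gl[of t]]] tendsto_minus[OF kl] st by simp
  then show ?thesis by simp
qed

section \<open>Backward difference quotients\<close>

text \<open>
  Quotients of an antiderivative \<open>G\<close> are antiderivatives of the quotients of \<open>g\<close>.
\<close>
lemma difference_quotient_integral:
  fixes g G :: "real \<Rightarrow> real"
  assumes "0 \<le> c" "c \<le> d" "d < T" and g: "continuous_on UNIV g"
    and G: "\<And>x. (G has_real_derivative g x) (at x)"
  shows "has_bochner_integral (lebesgue_on {0<..<T})
     (\<lambda>t. indicator {c<..d} t * ((g t - g (t - h)) / h))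
     (((G d - G (d - h)) - (G c - G (c - h))) / h)"
proof -
  have "has_bochner_integral (lebesgue_on {0<..<T})
     (\<lambda>t. indicator {c<..d} t * ((g t - g (t - h)) / h))
     ((G d - G (d - h)) / h - (G c - G (c - h)) / h)"
  proof (rule has_bochner_integral_time_interval[OF assms(1-3)])
    show "((\<lambda>x. (G x - G (x - h)) / h) has_real_derivative (g x - g (x - h)) / h) (at x)" for x
    proof -
      have "((\<lambda>x. G (x - h)) has_real_derivative g (x - h)) (at x)"
        using G[of "x - h"] DERIV_shift[of G "g (x - h)" x "- h"] by simp
      with G show ?thesis by (intro DERIV_cdivide DERIV_diff)
    qed
    have "continuous_on UNIV (\<lambda>x. g (x - h))"
      by (rule continuous_on_compose2[OF g]) (auto intro!: continuous_intros)
    then have "continuous_on UNIV (\<lambda>x. (1 / h) * (g x - g (x - h)))"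
      using g by (intro continuous_on_mult continuous_on_diff continuous_on_const)
    then show "continuous_on UNIV (\<lambda>x. (g x - g (x - h)) / h)" by simp
  qed
  then show ?thesis by (simp add: diff_divide_distrib)
qed

text \<open>
  The boundary terms are difference quotients of an antiderivative of \<open>g\<close> at \<open>d\<close> and at \<open>c\<close>.
\<close>
lemma difference_quotient_integral_tendsto:
  fixes g :: "real \<Rightarrow> real"
  assumes "0 \<le> c" "c \<le> d" "d < T" and g: "continuous_on UNIV g"
    and h: "h \<longlonglongrightarrow> 0" "\<And>n. 0 < h n"
  shows "(\<lambda>n. LINT t|lebesgue_on {0<..<T}. indicator {c<..d} t * ((g t - g (t - h n)) / h n)) \<longlonglongrightarrow> g d - g c"
proof -
  obtain G where G: "\<And>x. (G has_real_derivative g x) (at x)"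
    using continuous_imp_antiderivative[OF g] by blast
  have lim: "(\<lambda>n. (G x - G (x - h n)) / h n) \<longlonglongrightarrow> g x" for x
  proof -
    have "((\<lambda>y. (G (x + y) - G x) / y) \<longlongrightarrow> g x) (at 0)"
      using G[of x] by (simp add: DERIV_def)
    moreover have "filterlim (\<lambda>n. - h n) (at 0) sequentially"
      using tendsto_minus[OF h(1)] h(2) by (intro filterlim_atI) (auto simp: less_imp_neq[symmetric])
    ultimately have "(\<lambda>n. (G (x + - h n) - G x) / (- h n)) \<longlonglongrightarrow> g x"
      by (rule filterlim_compose)
    then show ?thesis by (simp add: minus_divide_left[symmetric] diff_divide_distrib)
  qed
  have "(LINT t|lebesgue_on {0<..<T}. indicator {c<..d} t * ((g t - g (t - h n)) / h n))
     = (G d - G (d - h n)) / h n - (G c - G (c - h n)) / h n" for n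
    using difference_quotient_integral[OF assms(1-4) G, of "h n"]
    by (simp add: has_bochner_integral_iff diff_divide_distrib)
  then show ?thesis
    using tendsto_diff[OF lim[of d] lim[of c]] by simp
qed

text \<open>
  The primitive of \<open>\<mu>\<close>, continued constantly outside \<open>(0,T)\<close> so that it is continuous on the whole line.
\<close>
lemma primitive_time:
  fixes \<mu> :: "real \<Rightarrow> real"
  assumes \<mu>: "integrable (lebesgue_on {0<..<T}) \<mu>" and nn: "AE t in lebesgue_on {0<..<T}. 0 \<le> \<mu> t"
  obtains P where "continuous_on UNIV P" "\<And>t. 0 \<le> P t" "\<And>t. P t \<le> (LINT r|lebesgue_on {0<..<T}. \<mu> r)"
    "\<And>s t. 0 \<le> s \<Longrightarrow> s \<le> t \<Longrightarrow> t < T \<Longrightarrow> P t - P s = (LINT r|lebesgue_on {0<..<T}. indicator {s<..t} r * \<mu> r)"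
    "\<And>t. P t = (LINT r|lebesgue_on {0<..<T}. indicator {..t} r * \<mu> r)" "\<And>s t. s \<le> t \<Longrightarrow> P s \<le> P t"
proof -
  let ?M = "lebesgue_on {0<..<T}"
  define P where "P t = (LINT r|?M. indicator {..t} r * \<mu> r)" for t
  have S: "{..t} \<inter> {0<..<T} \<in> sets ?M" for t
    by (auto simp: sets_restrict_space intro!: image_eqI[of _ _ "{..t}"])
  have eq: "(LINT r|?M. indicator {..t} r * \<mu> r) = (LINT r|?M. indicator ({..t} \<inter> {0<..<T}) r * \<mu> r)" for t
    by (intro Bochner_Integration.integral_cong) (auto simp: indicator_def)
  have int: "integrable ?M (\<lambda>r. indicator {..t} r * \<mu> r)" for t
    using integrable_indicator_time[OF \<mu> S[of t]]
    by (rule Bochner_Integration.integrable_cong[THEN iffD1, OF refl, rotated]) (auto simp: indicator_def)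
  show ?thesis
  proof
    show "continuous_on UNIV P"
      unfolding continuous_on_sequentially
    proof (intro allI ballI impI)
      fix x :: "nat \<Rightarrow> real" and a assume "(\<forall>n. x n \<in> UNIV) \<and> x \<longlonglongrightarrow> a"
      then have x: "x \<longlonglongrightarrow> a" by simp
      have "AE r in lebesgue. r \<noteq> a"
        by (rule AE_not_in[of "{a}", simplified]) (simp add: null_sets_completionI)
      then have ne: "AE r in ?M. r \<noteq> a"
        by (simp add: AE_restrict_space_iff) (auto elim: eventually_mono)
      have "(\<lambda>n. P (x n)) \<longlonglongrightarrow> P a"
        unfolding P_def
      proof (rule integral_dominated_convergence[where w="\<lambda>r. norm (\<mu> r)"])
        show "AE r in ?M. (\<lambda>n. indicator {..x n} r * \<mu> r) \<longlonglongrightarrow> indicator {..a} r * \<mu> r"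
          using ne
        proof eventually_elim
          fix r assume "r \<noteq> a"
          then consider "r < a" | "a < r" by linarith
          then have "\<forall>\<^sub>F n in sequentially. indicator {..x n} r * \<mu> r = indicator {..a} r * \<mu> r"
          proof cases
            case 1
            then have "\<forall>\<^sub>F n in sequentially. r < x n" using x by (intro order_tendstoD(1))
            then show ?thesis by eventually_elim (use 1 in \<open>simp add: indicator_def\<close>)
          next
            case 2
            then have "\<forall>\<^sub>F n in sequentially. x n < r" using x by (intro order_tendstoD(2))
            then show ?thesis by eventually_elim (use 2 in \<open>simp add: indicator_def\<close>)
          qed
          then show "(\<lambda>n. indicator {..x n} r * \<mu> r) \<longlonglongrightarrow> indicator {..a} r * \<mu> r"
            by (rule tendsto_eventually)
        qed
        show "AE r in ?M. norm (indicator {..x n} r * \<mu> r) \<le> norm (\<mu> r)" for n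
          by (intro AE_I2) (simp add: indicator_def)
      qed (use int \<mu> in \<open>auto intro: borel_measurable_integrable\<close>)
      then show "(P \<circ> x) \<longlonglongrightarrow> P a" by (simp add: o_def)
    qed
    show "P t = (LINT r|?M. indicator {..t} r * \<mu> r)" for t by (rule P_def)
    show "P s \<le> P t" if "s \<le> t" for s t
      unfolding P_def using nn that by (intro integral_mono_AE int) (auto simp: indicator_def elim: eventually_mono)
    show "0 \<le> P t" for t
      unfolding P_def using nn by (intro integral_nonneg_AE) (auto simp: indicator_def elim: eventually_mono)
    show "P t \<le> (LINT r|?M. \<mu> r)" for t
      unfolding P_def using nn by (intro integral_mono_AE int \<mu>) (auto simp: indicator_def elim: eventually_mono)
    show "P t - P s = (LINT r|?M. indicator {s<..t} r * \<mu> r)" if "0 \<le> s" "s \<le> t" "t < T" for s t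
    proof -
      have "(\<lambda>r. indicator {s<..t} r * \<mu> r) = (\<lambda>r. indicator {..t} r * \<mu> r - indicator {..s} r * \<mu> r)"
        using that by (auto simp: indicator_def)
      then show ?thesis using int by (simp add: P_def)
    qed
  qed
qed

text \<open>
  The quotient of \<open>g\<close> is the mean of \<open>k\<close> over \<open>(t - h, t]\<close>, and the quotient of \<open>P\<close> is that of \<open>\<mu>\<close>.
\<close>
lemma difference_quotient_dominated:
  fixes g k \<mu> :: "real \<Rightarrow> real"
  assumes k: "integrable (lebesgue_on {0<..<T}) k" and \<mu>: "integrable (lebesgue_on {0<..<T}) \<mu>"
    and P: "P t - P (t - h) = (LINT r|lebesgue_on {0<..<T}. indicator {t - h<..t} r * \<mu> r)"
    and g: "g t - g (t - h) = (LINT r|lebesgue_on {0<..<T}. indicator {t - h<..t} r * k r)"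
    and bound: "AE r in lebesgue_on {0<..<T}. \<bar>k r\<bar> \<le> \<delta> * \<mu> r + C"
    and "0 < h" "0 \<le> t - h" "t < T"
  shows "\<bar>(g t - g (t - h)) / h\<bar> \<le> \<delta> * ((P t - P (t - h)) / h) + C"
proof -
  let ?M = "lebesgue_on {0<..<T}"
  have S: "{t - h<..t} \<in> sets ?M" using assms(7,8) by (rule interval_sets_time)
  have one: "has_bochner_integral ?M (\<lambda>r. indicator {t - h<..t} r * 1) (t - (t - h))"
    using assms(6-8) by (intro has_bochner_integral_time_interval) (auto intro!: derivative_eq_intros)
  have int: "integrable ?M (\<lambda>r. \<delta> * (indicator {t - h<..t} r * \<mu> r) + C * (indicator {t - h<..t} r * 1))"
    by (intro Bochner_Integration.integrable_add integrable_mult_right integrable_indicator_time[OF \<mu> S]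
        integrable.intros[OF one])
  have "\<bar>g t - g (t - h)\<bar> \<le> (LINT r|?M. \<bar>indicator {t - h<..t} r * k r\<bar>)"
    unfolding g by (rule integral_abs_bound)
  also have "\<dots> \<le> (LINT r|?M. \<delta> * (indicator {t - h<..t} r * \<mu> r) + C * (indicator {t - h<..t} r * 1))"
  proof (rule integral_mono_AE[OF _ int])
    show "integrable ?M (\<lambda>r. \<bar>indicator {t - h<..t} r * k r\<bar>)"
      by (intro integrable_abs integrable_indicator_time k S)
    show "AE r in ?M. \<bar>indicator {t - h<..t} r * k r\<bar> \<le> \<delta> * (indicator {t - h<..t} r * \<mu> r) + C * (indicator {t - h<..t} r * 1)"
      using bound by eventually_elim (auto simp: indicator_def)
  qed
  also have "\<dots> = \<delta> * (P t - P (t - h)) + C * h"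
    using one integrable_indicator_time[OF \<mu> S] by (simp add: P has_bochner_integral_iff)
  finally show ?thesis
    using \<open>0 < h\<close> by (simp add: field_simps)
qed

text \<open>
  By the mean value theorem the two boundary terms, divided by \<open>h\<close>, are values of \<open>P\<close>, which lie
  between 0 and \<open>K\<close>.  The bound does not involve \<open>h\<close>; this is the source of all uniformity in the step size.
\<close>
lemma primitive_difference_quotient_le:
  fixes P :: "real \<Rightarrow> real"
  assumes "0 \<le> c" "c \<le> d" "d < T" "0 < h" and P: "continuous_on UNIV P" and b: "\<And>t. 0 \<le> P t" "\<And>t. P t \<le> K"
  shows "integrable (lebesgue_on {0<..<T}) (\<lambda>t. indicator {c<..d} t * ((P t - P (t - h)) / h))"
    and "(LINT t|lebesgue_on {0<..<T}. indicator {c<..d} t * ((P t - P (t - h)) / h)) \<le> K"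
proof -
  obtain Q where Q: "\<And>x. (Q has_real_derivative P x) (at x)"
    using continuous_imp_antiderivative[OF P] by blast
  note H = difference_quotient_integral[OF assms(1-3) P Q, of h]
  show "integrable (lebesgue_on {0<..<T}) (\<lambda>t. indicator {c<..d} t * ((P t - P (t - h)) / h))"
    using H by (simp add: has_bochner_integral_iff)
  have "\<exists>z. Q x - Q (x - h) = h * P z" for x
    using MVT2[of "x - h" x Q P] Q \<open>0 < h\<close> by auto
  then obtain z1 z2 where z: "Q d - Q (d - h) = h * P z1" "Q c - Q (c - h) = h * P z2"
    by meson
  have "((Q d - Q (d - h)) - (Q c - Q (c - h))) / h = P z1 - P z2"
    unfolding z using \<open>0 < h\<close> by (simp add: field_simps)
  also have "\<dots> \<le> K" using b[of z1] b[of z2] by simp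
  finally show "(LINT t|lebesgue_on {0<..<T}. indicator {c<..d} t * ((P t - P (t - h)) / h)) \<le> K"
    unfolding has_bochner_integral_integral_eq[OF H] .
qed

lemma integrable_indicator_borel_time:
  fixes f :: "real \<Rightarrow> real"
  assumes f: "integrable (lebesgue_on {0<..<T}) f" and A: "A \<in> sets borel"
  shows "integrable (lebesgue_on {0<..<T}) (\<lambda>t. indicator A t * f t)"
proof -
  have "A \<inter> {0<..<T} \<in> sets (lebesgue_on {0<..<T})"
    using A by (auto simp: sets_restrict_space)
  from integrable_indicator_time[OF f this] show ?thesis
    by (rule Bochner_Integration.integrable_cong[THEN iffD1, OF refl, rotated]) (auto simp: indicator_def)
qed

lemma sets_time_borel_AE:
  assumes "A \<in> sets (lebesgue_on {0<..<T::real})"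
  obtains B where "B \<in> sets borel" "AE t in lebesgue_on {0<..<T}. (indicator A t :: real) = indicator B t"
proof -
  have "A \<in> sets lebesgue"
    using assms by (auto simp: sets_restrict_space)
  then have "(indicator A :: real \<Rightarrow> real) \<in> borel_measurable lebesgue" by simp
  then obtain f where f: "f \<in> borel_measurable lborel" "AE t in lborel. (indicator A t :: real) = f t"
    using completion_ex_borel_measurable_real[of "indicator A :: real \<Rightarrow> real" lborel] by blast
  have "f -` {1} \<in> sets borel"
    using f(1) by (metis borel_closed closed_singleton measurable_lborel2 measurable_sets_borel)
  moreover have "AE t in lebesgue. (indicator A t :: real) = indicator (f -` {1}) t"
    using AE_completion[OF f(2)]
  proof eventually_elim
    case (elim t)
    then show ?case by (cases "t \<in> A") (auto simp: indicator_def)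
  qed
  then have "AE t in lebesgue_on {0<..<T}. (indicator A t :: real) = indicator (f -` {1}) t"
    by (simp add: AE_restrict_space_iff) (auto elim: eventually_mono)
  ultimately show ?thesis by (rule that)
qed

text \<open>
  For a half-line the assertion is the fundamental theorem of calculus.  Passing to complements is linear
  algebra; for countable disjoint unions the tail has to be small uniformly in \<open>n\<close>, which the bound on
  \<open>k\<close> provides: first \<open>\<delta>\<close> is chosen to make the contribution of \<open>\<mu>\<close> small, then the tail to make its
  measure small compared with \<open>\<delta>/C\<close>.
\<close>
lemma difference_quotient_tendsto_borel:
  fixes g k \<mu> :: "real \<Rightarrow> real"
  assumes ab: "0 < a" "a \<le> b" "b < T" and g: "continuous_on UNIV g"
    and k: "integrable (lebesgue_on {0<..<T}) k" and \<mu>: "integrable (lebesgue_on {0<..<T}) \<mu>"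
    and nn: "AE t in lebesgue_on {0<..<T}. 0 \<le> \<mu> t"
    and ftc: "\<And>s t. 0 < s \<Longrightarrow> s \<le> t \<Longrightarrow> t < T \<Longrightarrow>
      g t - g s = (LINT r|lebesgue_on {0<..<T}. indicator {s<..t} r * k r)"
    and bound: "\<And>\<delta>. 0 < \<delta> \<Longrightarrow> AE r in lebesgue_on {0<..<T}. \<bar>k r\<bar> \<le> \<delta> * \<mu> r + C / \<delta>" and "0 \<le> C"
    and h: "h \<longlonglongrightarrow> 0" "\<And>n. 0 < h n" "\<And>n. h n < a"
    and "A \<in> sets borel"
  shows "(\<lambda>n. LINT t|lebesgue_on {0<..<T}. indicator A t * (indicator {a<..b} t * ((g t - g (t - h n)) / h n)))
    \<longlonglongrightarrow> (LINT t|lebesgue_on {0<..<T}. indicator A t * (indicator {a<..b} t * k t))"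
proof -
  let ?M = "lebesgue_on {0<..<T}"
  interpret finite_measure ?M by (rule finite_measure_time)
  define q where "q n t = indicator {a<..b} t * ((g t - g (t - h n)) / h n)" for n t
  define \<kappa> where "\<kappa> t = indicator {a<..b} t * k t" for t
  define K where "K = (LINT r|?M. \<mu> r)"
  obtain P where P: "continuous_on UNIV P" "\<And>t. 0 \<le> P t" "\<And>t. P t \<le> K"
    "\<And>s t. 0 \<le> s \<Longrightarrow> s \<le> t \<Longrightarrow> t < T \<Longrightarrow> P t - P s = (LINT r|?M. indicator {s<..t} r * \<mu> r)"
    unfolding K_def by (rule primitive_time[OF \<mu> nn]) blast
  have K: "0 \<le> K" using P(2,3)[of 0] by linarith
  have Pmono: "0 \<le> P t - P s" if "0 \<le> s" "s \<le> t" "t < T" for s t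
    unfolding P(4)[OF that] using nn by (intro integral_nonneg_AE) (auto simp: indicator_def elim: eventually_mono)
  have Sab: "{a<..b} \<in> sets ?M" using ab by (intro interval_sets_time) auto
  obtain G where G: "\<And>x. (G has_real_derivative g x) (at x)"
    using continuous_imp_antiderivative[OF g] by blast
  have q: "integrable ?M (q n)" for n
    using difference_quotient_integral[OF less_imp_le[OF ab(1)] ab(2,3) g G, of "h n"]
    by (simp add: q_def[abs_def] has_bochner_integral_iff)
  have \<kappa>: "integrable ?M \<kappa>"
    unfolding \<kappa>_def using integrable_indicator_time[OF k Sab] .
  note int = integrable_indicator_borel_time[OF q] integrable_indicator_borel_time[OF \<kappa>]
  \<comment> \<open>\<open>D n\<close> is the deviation from the limit.  It is finitely additive and, by \<open>D_bound\<close>, small on sets of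
    small measure uniformly in \<open>n\<close>.\<close>
  define D where "D n E = (LINT t|?M. indicator E t * q n t) - (LINT t|?M. indicator E t * \<kappa> t)" for n E
  have D_add: "D n (E \<union> F) = D n E + D n F" if "E \<inter> F = {}" "E \<in> sets borel" "F \<in> sets borel" for n E F
  proof -
    have "(\<lambda>t. indicator (E \<union> F) t * f t) = (\<lambda>t. indicator E t * f t + indicator F t * f t)"
      for f :: "real \<Rightarrow> real"
    proof
      fix t
      show "indicator (E \<union> F) t * f t = indicator E t * f t + indicator F t * f t"
        using that(1) by (cases "t \<in> E"; cases "t \<in> F") auto
    qed
    then show ?thesis using int[OF that(2)] int[OF that(3)] by (simp add: D_def)
  qed
  have q_bound: "\<bar>q n t\<bar> \<le> \<delta> * (indicator {a<..b} t * ((P t - P (t - h n)) / h n)) + C / \<delta>"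
    if "0 < \<delta>" for n t \<delta>
  proof (cases "t \<in> {a<..b}")
    case True
    then have "0 < t - h n" "t < T" using h(3)[of n] ab by auto
    then have "\<bar>(g t - g (t - h n)) / h n\<bar> \<le> \<delta> * ((P t - P (t - h n)) / h n) + C / \<delta>"
      using h(2)[of n] by (intro difference_quotient_dominated[OF k \<mu> P(4) ftc bound[OF that]]) auto
    then show ?thesis using True by (simp add: q_def)
  qed (use \<open>0 \<le> C\<close> that in \<open>simp add: q_def\<close>)
  have D_bound: "\<bar>D n E\<bar> \<le> 2 * \<delta> * K + 2 * (C / \<delta>) * measure ?M (E \<inter> {0<..<T})"
    if \<delta>: "0 < \<delta>" and E: "E \<in> sets borel" for n \<delta> E
  proof -
    have E': "E \<inter> {0<..<T} \<in> sets ?M" using E by (auto simp: sets_restrict_space)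
    have ind: "integrable ?M (\<lambda>t. indicator (E \<inter> {0<..<T}) t :: real)"
      by (rule integrable_real_indicator[OF E']) (metis emeasure_finite infinity_ennreal_def top.not_eq_extremum)
    have one: "(LINT t|?M. C / \<delta> * indicator (E \<inter> {0<..<T}) t) = C / \<delta> * measure ?M (E \<inter> {0<..<T})"
    proof -
      have "E \<inter> {0<..<T} \<inter> space ?M = E \<inter> {0<..<T}" by auto
      then show ?thesis
        by (simp only: integral_mult_right_zero Bochner_Integration.integral_indicator)
    qed
    have Pq: "integrable ?M (\<lambda>t. indicator {a<..b} t * ((P t - P (t - h n)) / h n))"
      "(LINT t|?M. indicator {a<..b} t * ((P t - P (t - h n)) / h n)) \<le> K"
      using primitive_difference_quotient_le[OF less_imp_le[OF ab(1)] ab(2,3) h(2)[of n] P(1-3)] by auto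
    have "\<bar>LINT t|?M. indicator E t * q n t\<bar> \<le> (LINT t|?M. \<bar>indicator E t * q n t\<bar>)"
      by (rule integral_abs_bound)
    also have "\<dots> \<le> (LINT t|?M. \<delta> * (indicator {a<..b} t * ((P t - P (t - h n)) / h n)) + C / \<delta> * indicator (E \<inter> {0<..<T}) t)"
    proof (rule integral_mono)
      show "integrable ?M (\<lambda>t. \<bar>indicator E t * q n t\<bar>)" using int(1)[OF E] by (rule integrable_abs)
      show "integrable ?M (\<lambda>t. \<delta> * (indicator {a<..b} t * ((P t - P (t - h n)) / h n)) + C / \<delta> * indicator (E \<inter> {0<..<T}) t)"
        by (intro Bochner_Integration.integrable_add integrable_mult_right Pq ind)
      fix t assume "t \<in> space ?M"
      then have t: "t \<in> {0<..<T}" by simp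
      have "0 \<le> indicator {a<..b} t * ((P t - P (t - h n)) / h n)"
        using Pmono[of "t - h n" t] h(2,3)[of n] ab by (auto simp: indicator_def)
      then have "0 \<le> \<delta> * (indicator {a<..b} t * ((P t - P (t - h n)) / h n))"
        by (rule mult_nonneg_nonneg[OF less_imp_le[OF \<delta>]])
      then show "\<bar>indicator E t * q n t\<bar> \<le> \<delta> * (indicator {a<..b} t * ((P t - P (t - h n)) / h n)) + C / \<delta> * indicator (E \<inter> {0<..<T}) t"
        using q_bound[OF \<delta>, of n t] \<delta> t by (cases "t \<in> E") auto
    qed
    also have "\<dots> = \<delta> * (LINT t|?M. indicator {a<..b} t * ((P t - P (t - h n)) / h n)) + C / \<delta> * measure ?M (E \<inter> {0<..<T})"
      unfolding Bochner_Integration.integral_add[OF integrable_mult_right[OF Pq(1)] integrable_mult_right[OF ind]]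
      unfolding one by (simp only: integral_mult_right_zero)
    also have "\<dots> \<le> \<delta> * K + C / \<delta> * measure ?M (E \<inter> {0<..<T})"
      by (intro add_right_mono mult_left_mono[OF Pq(2)] less_imp_le[OF \<delta>])
    finally have 1: "\<bar>LINT t|?M. indicator E t * q n t\<bar> \<le> \<delta> * K + C / \<delta> * measure ?M (E \<inter> {0<..<T})" .
    have "\<bar>LINT t|?M. indicator E t * \<kappa> t\<bar> \<le> (LINT t|?M. \<bar>indicator E t * \<kappa> t\<bar>)"
      by (rule integral_abs_bound)
    also have "\<dots> \<le> (LINT t|?M. \<delta> * \<mu> t + C / \<delta> * indicator (E \<inter> {0<..<T}) t)"
    proof (rule integral_mono_AE)
      show "integrable ?M (\<lambda>t. \<bar>indicator E t * \<kappa> t\<bar>)" using int(2)[OF E] by (rule integrable_abs)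
      show "integrable ?M (\<lambda>t. \<delta> * \<mu> t + C / \<delta> * indicator (E \<inter> {0<..<T}) t)"
        by (intro Bochner_Integration.integrable_add integrable_mult_right \<mu> ind)
      have "AE t in ?M. t \<in> {0<..<T}" by (rule AE_I2) simp
      then show "AE t in ?M. \<bar>indicator E t * \<kappa> t\<bar> \<le> \<delta> * \<mu> t + C / \<delta> * indicator (E \<inter> {0<..<T}) t"
        using bound[OF \<delta>] nn
      proof eventually_elim
        case (elim t)
        have "0 \<le> \<delta> * \<mu> t" "0 \<le> C / \<delta>" using elim \<delta> \<open>0 \<le> C\<close> by auto
        then show ?case using elim by (auto simp: \<kappa>_def indicator_def)
      qed
    qed
    also have "\<dots> = \<delta> * K + C / \<delta> * measure ?M (E \<inter> {0<..<T})"
      unfolding Bochner_Integration.integral_add[OF integrable_mult_right[OF \<mu>] integrable_mult_right[OF ind]] K_def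
      unfolding one by (simp only: integral_mult_right_zero)
    finally show ?thesis using 1 unfolding D_def by linarith
  qed
  have "(\<lambda>n. D n A) \<longlonglongrightarrow> 0"
  proof -
    have borel: "sets borel = sigma_sets UNIV (range (\<lambda>x::real. {..x}))"
      by (simp add: borel_eq_atMost)
    have int_stable: "Int_stable (range (\<lambda>x::real. {..x}))"
      unfolding Int_stable_def by (auto intro!: image_eqI[of _ _ "min _ _"])
    have A: "A \<in> sigma_sets UNIV (range (\<lambda>x. {..x}))" using \<open>A \<in> sets borel\<close> borel by blast
    have "range (\<lambda>x::real. {..x}) \<subseteq> Pow UNIV" by simp
    from int_stable this A show ?thesis
    proof (induction rule: sigma_sets_induct_disjoint)
      case (basic A)
      then obtain x where A: "A = {..x}" by blast
      show ?case
      proof (cases "x \<le> a")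
        case True
        then have "(\<lambda>t. indicator A t * q n t) = (\<lambda>_. 0)" "(\<lambda>t. indicator A t * \<kappa> t) = (\<lambda>_. 0)" for n
          by (auto simp: A q_def \<kappa>_def indicator_def)
        then have "D n A = 0" for n by (simp only: D_def)
        then show ?thesis by simp
      next
        case False
        then have x: "0 \<le> a" "a \<le> min x b" "min x b < T" using ab by auto
        have ind: "indicator A t * (indicator {a<..b} t * y) = indicator {a<..min x b} t * y" for t y :: real
          by (auto simp: A indicator_def)
        have "(LINT t|?M. indicator A t * \<kappa> t) = g (min x b) - g a"
          unfolding \<kappa>_def ind using ftc[OF ab(1) x(2,3)] by simp
        moreover have "(\<lambda>n. LINT t|?M. indicator A t * q n t) \<longlonglongrightarrow> g (min x b) - g a"
          unfolding q_def ind by (rule difference_quotient_integral_tendsto[OF x g h(1,2)])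
        ultimately show ?thesis unfolding D_def by (simp add: LIM_zero_iff)
      qed
    next
      case empty
      show ?case by (simp add: D_def)
    next
      case (compl A)
      then have A: "A \<in> sets borel" unfolding borel by blast
      have "D n (UNIV - A) = D n {..b} - D n A" for n
      proof -
        have "(\<lambda>t. indicator {..b} t * q n t) = (\<lambda>t. indicator UNIV t * q n t)"
          "(\<lambda>t. indicator {..b} t * \<kappa> t) = (\<lambda>t. indicator UNIV t * \<kappa> t)"
          by (auto simp: q_def \<kappa>_def indicator_def)
        then have "D n {..b} = D n UNIV" by (simp only: D_def)
        then show ?thesis using D_add[of A "UNIV - A" n] A by simp
      qed
      moreover have "(\<lambda>n. D n {..b}) \<longlonglongrightarrow> 0"
      proof -
        have ind: "indicator {..b} t * (indicator {a<..b} t * y) = indicator {a<..b} t * y" for t y :: real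
          by (auto simp: indicator_def)
        have "(LINT t|?M. indicator {..b} t * \<kappa> t) = g b - g a"
          unfolding \<kappa>_def ind using ftc[OF ab] by simp
        moreover have "(\<lambda>n. LINT t|?M. indicator {..b} t * q n t) \<longlonglongrightarrow> g b - g a"
          unfolding q_def ind by (rule difference_quotient_integral_tendsto[OF less_imp_le[OF ab(1)] ab(2,3) g h(1,2)])
        ultimately show ?thesis unfolding D_def by (simp add: LIM_zero_iff)
      qed
      ultimately show ?case using tendsto_diff[of "\<lambda>n. D n {..b}" 0 sequentially "\<lambda>n. D n A" 0] compl(2) by simp
    next
      case (union A)
      then have A: "A i \<in> sets borel" for i unfolding borel by blast
      \<comment> \<open>\<open>U J\<close> is the tail of the union; the first \<open>J\<close> sets are handled by the induction hypothesis.\<close>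
      define U where "U J = (\<Union>i\<in>{J..}. A i)" for J :: nat
      have U: "U J \<in> sets borel" for J unfolding U_def using A by blast
      have split: "D n (U 0) = (\<Sum>i<J. D n (A i)) + D n (U J)" for n J
      proof (induction J)
        case (Suc J)
        have "{J..} = insert J {Suc J..}" by auto
        then have "U J = A J \<union> U (Suc J)" by (simp add: U_def)
        moreover have "A J \<inter> A i = {}" if "i \<in> {Suc J..}" for i
          using union(1) that disjoint_family_onD[of A UNIV J i] by simp
        then have "A J \<inter> U (Suc J) = {}" unfolding U_def by blast
        ultimately show ?case using Suc D_add[of "A J" "U (Suc J)" n] A U by simp
      qed simp
      have mU: "(\<lambda>J. measure ?M (U J \<inter> {0<..<T})) \<longlonglongrightarrow> 0"
      proof -
        have "(\<lambda>J. measure ?M (U J \<inter> {0<..<T})) \<longlonglongrightarrow> measure ?M (\<Inter>J. U J \<inter> {0<..<T})"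
        proof (rule finite_Lim_measure_decseq)
          show "range (\<lambda>J. U J \<inter> {0<..<T}) \<subseteq> sets ?M"
            using U by (auto simp: sets_restrict_space)
          show "decseq (\<lambda>J. U J \<inter> {0<..<T})"
            unfolding decseq_def U_def by (intro allI impI Int_mono UN_mono) auto
        qed
        moreover have "(\<Inter>J. U J \<inter> {0<..<T}) = {}"
        proof (rule ccontr)
          assume "\<not> ?thesis"
          then obtain x where x: "\<And>J. x \<in> U J" by blast
          then obtain i where i: "x \<in> A i" using x[of 0] by (auto simp: U_def)
          obtain j where "x \<in> A j" "j \<ge> Suc i" using x[of "Suc i"] by (auto simp: U_def)
          then show False using i union(1) disjoint_family_onD[of A UNIV i j] by auto
        qed
        ultimately show ?thesis by simp
      qed
      have "(\<lambda>n. D n (U 0)) \<longlonglongrightarrow> 0"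
      proof (rule LIMSEQ_I)
        fix e :: real assume e: "0 < e"
        define \<delta> where "\<delta> = e / (8 * (K + 1))"
        have \<delta>: "0 < \<delta>" using e K by (simp add: \<delta>_def)
        have \<delta>K: "2 * \<delta> * K \<le> e / 4"
          using e K by (simp add: \<delta>_def field_simps)
        have "(\<lambda>J. 2 * (C / \<delta>) * measure ?M (U J \<inter> {0<..<T})) \<longlonglongrightarrow> 2 * (C / \<delta>) * 0"
          by (intro tendsto_intros mU)
        then have "\<forall>\<^sub>F J in sequentially. 2 * (C / \<delta>) * measure ?M (U J \<inter> {0<..<T}) < e / 4"
          using e by (intro order_tendstoD(2)) auto
        then obtain J where J: "2 * (C / \<delta>) * measure ?M (U J \<inter> {0<..<T}) < e / 4"
          by (auto simp: eventually_sequentially)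
        have "(\<lambda>n. \<Sum>i<J. D n (A i)) \<longlonglongrightarrow> (\<Sum>i<J. 0)"
          by (intro tendsto_sum union)
        from LIMSEQ_D[OF this half_gt_zero[OF e]]
        obtain n0 where n0: "\<forall>n\<ge>n0. \<bar>\<Sum>i<J. D n (A i)\<bar> < e / 2" by auto
        have "norm (D n (U 0) - 0) < e" if "n \<ge> n0" for n
          using n0[rule_format, OF that] D_bound[OF \<delta> U[of J], of n] J \<delta>K split[of n J] by simp
        then show "\<exists>no. \<forall>n\<ge>no. norm (D n (U 0) - 0) < e" by blast
      qed
      then show ?case by (simp add: U_def)
    qed
  qed
  then show ?thesis unfolding D_def q_def \<kappa>_def by (simp add: LIM_zero_iff)
qed

text \<open>
  Lebesgue measurable sets differ from Borel sets by null sets only.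
\<close>
lemma difference_quotient_tendsto:
  fixes g k \<mu> :: "real \<Rightarrow> real"
  assumes ab: "0 < a" "a \<le> b" "b < T" and g: "continuous_on UNIV g"
    and k: "integrable (lebesgue_on {0<..<T}) k" and \<mu>: "integrable (lebesgue_on {0<..<T}) \<mu>"
    and nn: "AE t in lebesgue_on {0<..<T}. 0 \<le> \<mu> t"
    and ftc: "\<And>s t. 0 < s \<Longrightarrow> s \<le> t \<Longrightarrow> t < T \<Longrightarrow>
      g t - g s = (LINT r|lebesgue_on {0<..<T}. indicator {s<..t} r * k r)"
    and bound: "\<And>\<delta>. 0 < \<delta> \<Longrightarrow> AE r in lebesgue_on {0<..<T}. \<bar>k r\<bar> \<le> \<delta> * \<mu> r + C / \<delta>" and C: "0 \<le> C"
    and h: "h \<longlonglongrightarrow> 0" "\<And>n. 0 < h n" "\<And>n. h n < a"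
    and A: "A \<in> sets (lebesgue_on {0<..<T})"
  shows "(\<lambda>n. LINT t|lebesgue_on {0<..<T}. indicator A t * (indicator {a<..b} t * ((g t - g (t - h n)) / h n)))
    \<longlonglongrightarrow> (LINT t|lebesgue_on {0<..<T}. indicator A t * (indicator {a<..b} t * k t))"
proof -
  let ?M = "lebesgue_on {0<..<T}"
  obtain B where B: "B \<in> sets borel" and AB: "AE t in ?M. (indicator A t :: real) = indicator B t"
    using A by (rule sets_time_borel_AE)
  have eq: "(LINT t|?M. indicator A t * F t) = (LINT t|?M. indicator B t * F t)" if "integrable ?M F" for F :: "real \<Rightarrow> real"
  proof (rule integral_cong_AE)
    show "(\<lambda>t. indicator A t * F t) \<in> borel_measurable ?M"
      using integrable_indicator_time[OF that A] by (rule borel_measurable_integrable)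
    show "(\<lambda>t. indicator B t * F t) \<in> borel_measurable ?M"
      using integrable_indicator_borel_time[OF that B] by (rule borel_measurable_integrable)
    show "AE t in ?M. indicator A t * F t = indicator B t * F t"
      using AB by eventually_elim simp
  qed
  obtain G where G: "\<And>x. (G has_real_derivative g x) (at x)"
    using continuous_imp_antiderivative[OF g] by blast
  have q: "integrable ?M (\<lambda>t. indicator {a<..b} t * ((g t - g (t - h n)) / h n))" for n
    by (rule integrable.intros[OF difference_quotient_integral[OF less_imp_le[OF ab(1)] ab(2,3) g G]])
  have kk: "integrable ?M (\<lambda>t. indicator {a<..b} t * k t)"
    using integrable_indicator_time[OF k interval_sets_time[of a b T]] ab by simp
  show ?thesis
    unfolding eq[OF q] eq[OF kk]
    by (rule difference_quotient_tendsto_borel[OF ab g k \<mu> nn ftc bound C h B])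
qed

section \<open>The energy inequality\<close>

text \<open>
  Completeness of Lebesgue measure allows the exceptional null set.
\<close>
lemma borel_measurable_lebesgue_on_AE_limit:
  fixes f :: "nat \<Rightarrow> 'a::euclidean_space \<Rightarrow> real"
  assumes S: "S \<in> sets lebesgue" and f: "\<And>n. f n \<in> borel_measurable (lebesgue_on S)"
    and lim: "AE x in lebesgue_on S. (\<lambda>n. f n x) \<longlonglongrightarrow> g x"
  shows "g \<in> borel_measurable (lebesgue_on S)"
proof -
  define l where "l x = lim (\<lambda>n. f n x)" for x
  have "l \<in> borel_measurable (lebesgue_on S)"
    unfolding l_def using f by (rule borel_measurable_lim_metric)
  then have m: "(\<lambda>x. if x \<in> S then l x else 0) \<in> borel_measurable lebesgue"
    using S by (simp add: borel_measurable_if)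
  have "AE x in lebesgue. x \<in> S \<longrightarrow> (\<lambda>n. f n x) \<longlonglongrightarrow> g x"
    using lim S by (simp add: AE_restrict_space_iff)
  then have "AE x in lebesgue. (if x \<in> S then l x else 0) = (if x \<in> S then g x else 0)"
    by eventually_elim (auto simp: l_def limI)
  from borel_measurable_AE[OF m this] show ?thesis
    using S by (simp add: borel_measurable_if)
qed

lemma simple_function_repr:
  assumes "simple_function M \<sigma>" "t \<in> space M"
  shows "(F (\<sigma> t) :: real) = (\<Sum>c\<in>\<sigma> ` space M. indicator (\<sigma> -` {c} \<inter> space M) t * F c)"
proof -
  have "finite (\<sigma> ` space M)" using assms(1) by (simp add: simple_function_def)
  moreover have "(\<Sum>c\<in>\<sigma> ` space M. indicator (\<sigma> -` {c} \<inter> space M) t * F c) = (\<Sum>c\<in>\<sigma> ` space M. if c = \<sigma> t then F c else 0)"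
    using assms(2) by (intro sum.cong) (auto simp: indicator_def)
  ultimately show ?thesis using assms(2) by simp
qed

lemma integral_compose_simple_function:
  fixes F :: "'c \<Rightarrow> 'b \<Rightarrow> real"
  assumes \<sigma>: "simple_function M \<sigma>" and F: "\<And>c. c \<in> \<sigma> ` space M \<Longrightarrow> integrable M (F c)"
  shows "integrable M (\<lambda>t. F (\<sigma> t) t)"
    and "(LINT t|M. F (\<sigma> t) t) = (\<Sum>c\<in>\<sigma> ` space M. LINT t|M. indicator (\<sigma> -` {c} \<inter> space M) t * F c t)"
proof -
  have int: "integrable M (\<lambda>t. indicator (\<sigma> -` {c} \<inter> space M) t * F c t)" if "c \<in> \<sigma> ` space M" for c
    using \<sigma> that by (intro integrable_indicator_time F) (auto simp: simple_function_def)
  have repr: "F (\<sigma> t) t = (\<Sum>c\<in>\<sigma> ` space M. indicator (\<sigma> -` {c} \<inter> space M) t * F c t)"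
    if "t \<in> space M" for t
    using simple_function_repr[OF \<sigma> that, of "\<lambda>c. F c t"] .
  have "integrable M (\<lambda>t. \<Sum>c\<in>\<sigma> ` space M. indicator (\<sigma> -` {c} \<inter> space M) t * F c t)"
    using int by (rule Bochner_Integration.integrable_sum)
  then show "integrable M (\<lambda>t. F (\<sigma> t) t)"
    by (subst Bochner_Integration.integrable_cong[OF refl repr])
  have "(LINT t|M. F (\<sigma> t) t) = (LINT t|M. (\<Sum>c\<in>\<sigma> ` space M. indicator (\<sigma> -` {c} \<inter> space M) t * F c t))"
    by (rule Bochner_Integration.integral_cong[OF refl repr])
  also have "\<dots> = (\<Sum>c\<in>\<sigma> ` space M. LINT t|M. indicator (\<sigma> -` {c} \<inter> space M) t * F c t)"
    using int by (rule Bochner_Integration.integral_sum)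
  finally show "(LINT t|M. F (\<sigma> t) t) = (\<Sum>c\<in>\<sigma> ` space M. LINT t|M. indicator (\<sigma> -` {c} \<inter> space M) t * F c t)" .
qed

text \<open>
  The form \<open>ip\<close> stands for the \<open>L\<^sup>2\<close> inner product, \<open>N\<close> for the norm of \<open>V\<close> and \<open>W t\<close> for the time derivative
  of \<open>w\<close> at time \<open>t\<close> as a functional on \<open>V\<close>.  The hypothesis \<open>bound\<close> is \<open>\<bar>W r v\<bar> \<le> \<surd>(\<mu> r) N v\<close> after Young's
  inequality; carrying the free parameter \<open>\<delta>\<close> along avoids Cauchy-Schwarz for integrals over time.  The
  hypothesis \<open>conv\<close> is the convexity of the squared norm, which reduces the problem to quotients that are
  linear in their second argument.  There \<open>w t\<close> is replaced by \<open>\<sigma> m t\<close>, once for every \<open>h\<close> and once again in the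
  limit \<open>h \<rightarrow> 0\<close>; each replacement costs \<open>\<delta> K + E m / \<delta>\<close> with \<open>K\<close> the
  integral of \<open>\<mu>\<close> and \<open>E m\<close> that of the squared distance from \<open>w\<close> to \<open>\<sigma> m\<close>, and \<open>m \<rightarrow> \<infinity>\<close> followed by \<open>\<delta> \<rightarrow> 0\<close> removes the costs.
\<close>
lemma energy_inequality:
  fixes w :: "real \<Rightarrow> 'x \<Rightarrow> real" and ip :: "('x \<Rightarrow> real) \<Rightarrow> ('x \<Rightarrow> real) \<Rightarrow> real"
    and N :: "('x \<Rightarrow> real) \<Rightarrow> real" and W :: "real \<Rightarrow> ('x \<Rightarrow> real) \<Rightarrow> real"
  assumes ab: "0 < a" "a \<le> b" "b < T"
    and q: "continuous_on UNIV (\<lambda>t. ip (w t) (w t))"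
    and shift: "\<And>h. continuous_on UNIV (\<lambda>t. ip (w (t - h)) (w t))"
    and conv: "\<And>s t. ip (w t) (w t) - ip (w s) (w s) \<le> 2 * (ip (w t) (w t) - ip (w s) (w t))"
    and gv: "\<And>v. v \<in> V \<Longrightarrow> continuous_on UNIV (\<lambda>t. ip (w t) v)"
    and k: "\<And>v. v \<in> V \<Longrightarrow> integrable (lebesgue_on {0<..<T}) (\<lambda>t. W t v)"
    and ftc: "\<And>v s t. v \<in> V \<Longrightarrow> 0 < s \<Longrightarrow> s \<le> t \<Longrightarrow> t < T \<Longrightarrow>
      ip (w t) v - ip (w s) v = (LINT r|lebesgue_on {0<..<T}. indicator {s<..t} r * W r v)"
    and \<mu>: "integrable (lebesgue_on {0<..<T}) \<mu>" and nn: "AE t in lebesgue_on {0<..<T}. 0 \<le> \<mu> t"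
    and bound: "AE r in lebesgue_on {0<..<T}. \<forall>v\<in>V. \<forall>\<delta>>0. \<bar>W r v\<bar> \<le> \<delta> * \<mu> r + (N v)\<^sup>2 / \<delta>"
    and Npos: "\<And>v. 0 \<le> N v"
    and wV: "AE t in lebesgue_on {0<..<T}. w t \<in> V"
    and sub: "\<And>u v. u \<in> V \<Longrightarrow> v \<in> V \<Longrightarrow> (\<lambda>x. u x - v x) \<in> V"
    and ipsub: "\<And>s u v. u \<in> V \<Longrightarrow> v \<in> V \<Longrightarrow> ip (w s) (\<lambda>x. u x - v x) = ip (w s) u - ip (w s) v"
    and Wsub: "AE t in lebesgue_on {0<..<T}. \<forall>u\<in>V. \<forall>v\<in>V. W t (\<lambda>x. u x - v x) = W t u - W t v"
    and \<sigma>: "\<And>m. simple_function (lebesgue_on {0<..<T}) (\<sigma> m)" "\<And>m t. t \<in> {0<..<T} \<Longrightarrow> \<sigma> m t \<in> V"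
    and dint: "\<And>m. integrable (lebesgue_on {0<..<T}) (\<lambda>t. (N (\<lambda>x. w t x - \<sigma> m t x))\<^sup>2)"
    and dlim: "(\<lambda>m. LINT t|lebesgue_on {0<..<T}. (N (\<lambda>x. w t x - \<sigma> m t x))\<^sup>2) \<longlonglongrightarrow> 0"
    and dpt: "AE t in lebesgue_on {0<..<T}. (\<lambda>m. N (\<lambda>x. w t x - \<sigma> m t x)) \<longlonglongrightarrow> 0"
  shows "integrable (lebesgue_on {0<..<T}) (\<lambda>t. W t (w t)) \<and>
    ip (w b) (w b) - ip (w a) (w a) \<le> 2 * (LINT t|lebesgue_on {0<..<T}. indicator {a<..b} t * W t (w t))"
proof -
  let ?M = "lebesgue_on {0<..<T}"
  define K where "K = (LINT r|?M. \<mu> r)"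
  define E where "E m = (LINT t|?M. (N (\<lambda>x. w t x - \<sigma> m t x))\<^sup>2)" for m
  have in_time: "AE t in ?M. t \<in> {0<..<T}" by (rule AE_I2) simp
  have \<sigma>V: "c \<in> V" if "c \<in> \<sigma> m ` space ?M" for c m
    using that \<sigma>(2)[of _ m] by auto
  have Wsig: "integrable ?M (\<lambda>t. W t (\<sigma> m t))" for m
    by (rule integral_compose_simple_function(1)[OF \<sigma>(1), of m "\<lambda>c t. W t c"]) (intro k \<sigma>V)
  have diff: "AE t in ?M. \<forall>\<delta>>0. \<bar>W t (w t) - W t (\<sigma> m t)\<bar> \<le> \<delta> * \<mu> t + (N (\<lambda>x. w t x - \<sigma> m t x))\<^sup>2 / \<delta>"
    for m
    using in_time bound wV Wsub
  proof eventually_elim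
    case (elim t)
    then have s: "\<sigma> m t \<in> V" using \<sigma>(2) by blast
    then have "W t (\<lambda>x. w t x - \<sigma> m t x) = W t (w t) - W t (\<sigma> m t)" using elim by blast
    moreover have "(\<lambda>x. w t x - \<sigma> m t x) \<in> V" using elim s sub by blast
    ultimately show ?case using elim(2) by metis
  qed
  have meas: "(\<lambda>t. W t (w t)) \<in> borel_measurable ?M"
  proof (rule borel_measurable_lebesgue_on_AE_limit)
    show "(\<lambda>t. W t (\<sigma> m t)) \<in> borel_measurable ?M" for m
      using Wsig by (rule borel_measurable_integrable)
    have "AE t in ?M. \<forall>m. \<forall>\<delta>>0. \<bar>W t (w t) - W t (\<sigma> m t)\<bar> \<le> \<delta> * \<mu> t + (N (\<lambda>x. w t x - \<sigma> m t x))\<^sup>2 / \<delta>"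
      using diff by (simp add: AE_all_countable)
    with dpt show "AE t in ?M. (\<lambda>m. W t (\<sigma> m t)) \<longlonglongrightarrow> W t (w t)"
    proof eventually_elim
      case (elim t)
      define n where "n m = N (\<lambda>x. w t x - \<sigma> m t x)" for m
      \<comment> \<open>A choice of \<open>\<delta>\<close> that is positive, tends to zero and keeps \<open>(n m)\<^sup>2 / \<delta>\<close> below \<open>n m\<close>.\<close>
      define d where "d m = n m + inverse (real (Suc m))" for m
      have d: "0 < d m" "n m \<le> d m" "0 \<le> n m" for m
        using Npos[of "\<lambda>x. w t x - \<sigma> m t x"] by (auto simp: d_def n_def add_nonneg_pos)
      have "\<bar>W t (w t) - W t (\<sigma> m t)\<bar> \<le> d m * \<mu> t + n m" for m
      proof -
        have "\<bar>W t (w t) - W t (\<sigma> m t)\<bar> \<le> d m * \<mu> t + (n m)\<^sup>2 / d m"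
          using elim(2) d(1)[of m] by (simp add: n_def)
        also have "(n m)\<^sup>2 / d m \<le> n m"
          using d[of m] by (simp add: divide_le_eq power2_eq_square mult_left_mono)
        finally show ?thesis by simp
      qed
      then have le: "norm (W t (\<sigma> m t) - W t (w t)) \<le> d m * \<mu> t + n m" for m
        by (simp add: abs_minus_commute)
      have n0: "n \<longlonglongrightarrow> 0" using elim(1) by (simp add: n_def[abs_def])
      have "d \<longlonglongrightarrow> 0 + 0" unfolding d_def by (intro tendsto_add n0 LIMSEQ_inverse_real_of_nat)
      then have "(\<lambda>m. d m * \<mu> t + n m) \<longlonglongrightarrow> 0 * \<mu> t + 0"
        by (intro tendsto_add tendsto_mult_right n0) simp
      then have "(\<lambda>m. W t (\<sigma> m t) - W t (w t)) \<longlonglongrightarrow> 0"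
        by (intro Lim_null_comparison[OF always_eventually[OF allI[OF le]]]) simp
      then show ?case by (simp add: LIM_zero_iff)
    qed
  qed simp
  have Wint: "integrable ?M (\<lambda>t. W t (w t))"
  proof (rule Bochner_Integration.integrable_bound[OF _ meas])
    show "integrable ?M (\<lambda>t. \<bar>W t (\<sigma> 0 t)\<bar> + (\<mu> t + (N (\<lambda>x. w t x - \<sigma> 0 t x))\<^sup>2))"
      by (intro Bochner_Integration.integrable_add integrable_abs Wsig \<mu> dint)
    show "AE t in ?M. norm (W t (w t)) \<le> norm (\<bar>W t (\<sigma> 0 t)\<bar> + (\<mu> t + (N (\<lambda>x. w t x - \<sigma> 0 t x))\<^sup>2))"
      using diff[of 0]
    proof eventually_elim
      case (elim t)
      then have "\<bar>W t (w t) - W t (\<sigma> 0 t)\<bar> \<le> 1 * \<mu> t + (N (\<lambda>x. w t x - \<sigma> 0 t x))\<^sup>2 / 1"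
        using zero_less_one by blast
      then show ?case by simp
    qed
  qed
  obtain P where P: "continuous_on UNIV P" "\<And>t. 0 \<le> P t" "\<And>t. P t \<le> K"
    "\<And>s t. 0 \<le> s \<Longrightarrow> s \<le> t \<Longrightarrow> t < T \<Longrightarrow> P t - P s = (LINT r|?M. indicator {s<..t} r * \<mu> r)"
    unfolding K_def by (rule primitive_time[OF \<mu> nn]) blast
  have K: "0 \<le> K" using P(2,3)[of 0] by linarith
  have Sab: "{a<..b} \<in> sets ?M" using ab by (intro interval_sets_time) auto
  \<comment> \<open>Step sizes below \<open>a\<close>, so that \<open>t - h n\<close> stays in \<open>(0,T)\<close> for \<open>t\<close> in \<open>(a,b]\<close>.\<close>
  define h where "h n = a * inverse (real (Suc (Suc n)))" for n
  have h: "h \<longlonglongrightarrow> 0" "0 < h n" "h n < a" for n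
  proof -
    show "h \<longlonglongrightarrow> 0"
      using tendsto_mult_left[OF LIMSEQ_Suc[OF LIMSEQ_inverse_real_of_nat], of a] by (simp add: h_def[abs_def])
    show "0 < h n" using ab by (simp add: h_def)
    have "inverse (real (Suc (Suc n))) < 1" by (simp add: field_simps)
    then have "a * inverse (real (Suc (Suc n))) < a * 1"
      using ab by (intro mult_strict_left_mono) auto
    then show "h n < a" by (simp only: h_def mult_1_right)
  qed
  let ?q = "\<lambda>t. ip (w t) (w t)"
  have gap: "?q b - ?q a \<le> 2 * (LINT t|?M. indicator {a<..b} t * W t (w t)) + 4 * (\<delta> * K + E m / \<delta>)"
    if \<delta>: "0 < \<delta>" for \<delta> m
  proof -
    define Y where "Y n t = (ip (w t) (w t) - ip (w (t - h n)) (w t)) / h n" for n t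
    define Z where "Z n v t = (ip (w t) v - ip (w (t - h n)) v) / h n" for n v t
    define Pq where "Pq n t = indicator {a<..b} t * ((P t - P (t - h n)) / h n)" for n t
    define err where "err t = (N (\<lambda>x. w t x - \<sigma> m t x))\<^sup>2" for t
    have Pq: "integrable ?M (Pq n)" "(LINT t|?M. Pq n t) \<le> K" for n
      unfolding Pq_def
      using primitive_difference_quotient_le[OF less_imp_le[OF ab(1)] ab(2,3) h(2)[of n] P(1-3)] by auto
    have err: "integrable ?M err" "(LINT t|?M. err t) = E m"
      using dint[of m] by (simp_all add: err_def[abs_def] E_def)
    have cshift: "continuous_on UNIV (\<lambda>t. g (t - r))" if "continuous_on UNIV g" for g :: "real \<Rightarrow> real" and r
      by (rule continuous_on_compose2[OF that]) (auto intro!: continuous_intros)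
    have Zint: "integrable ?M (\<lambda>t. indicator {a<..b} t * Z n v t)" if "v \<in> V" for n v
      unfolding Z_def using gv[OF that] cshift[OF gv[OF that], of "h n"] h(2)[of n]
      by (intro integrable_indicator_time[OF _ Sab] continuous_integrable_time continuous_on_divide continuous_on_diff continuous_on_const) auto
    have Yint: "integrable ?M (\<lambda>t. indicator {a<..b} t * Y n t)" for n
      unfolding Y_def using q shift[of "h n"] h(2)[of n]
      by (intro integrable_indicator_time[OF _ Sab] continuous_integrable_time continuous_on_divide continuous_on_diff continuous_on_const) auto
    have Xint: "integrable ?M (\<lambda>t. indicator {a<..b} t * ((?q t - ?q (t - h n)) / h n))" for n
      using q cshift[OF q, of "h n"] h(2)[of n]
      by (intro integrable_indicator_time[OF _ Sab] continuous_integrable_time continuous_on_divide continuous_on_diff continuous_on_const) auto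
    have Zs: "integrable ?M (\<lambda>t. indicator {a<..b} t * Z n (\<sigma> m t) t)"
      "(LINT t|?M. indicator {a<..b} t * Z n (\<sigma> m t) t)
        = (\<Sum>c\<in>\<sigma> m ` space ?M. LINT t|?M. indicator (\<sigma> m -` {c} \<inter> space ?M) t * (indicator {a<..b} t * Z n c t))" for n
      by (rule integral_compose_simple_function[OF \<sigma>(1), of m "\<lambda>c t. indicator {a<..b} t * Z n c t"]; intro Zint \<sigma>V; assumption)+
    have Ws: "integrable ?M (\<lambda>t. indicator {a<..b} t * W t (\<sigma> m t))"
      "(LINT t|?M. indicator {a<..b} t * W t (\<sigma> m t))
        = (\<Sum>c\<in>\<sigma> m ` space ?M. LINT t|?M. indicator (\<sigma> m -` {c} \<inter> space ?M) t * (indicator {a<..b} t * W t c))"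
      by (rule integral_compose_simple_function[OF \<sigma>(1), of m "\<lambda>c t. indicator {a<..b} t * W t c"];
          intro integrable_indicator_time[OF k Sab] \<sigma>V; assumption)+
    have Zlim: "(\<lambda>n. LINT t|?M. indicator {a<..b} t * Z n (\<sigma> m t) t) \<longlonglongrightarrow> (LINT t|?M. indicator {a<..b} t * W t (\<sigma> m t))"
      unfolding Zs(2) Ws(2)
    proof (rule tendsto_sum)
      fix c assume "c \<in> \<sigma> m ` space ?M"
      then have c: "c \<in> V" by (rule \<sigma>V)
      show "(\<lambda>n. LINT t|?M. indicator (\<sigma> m -` {c} \<inter> space ?M) t * (indicator {a<..b} t * Z n c t))
        \<longlonglongrightarrow> (LINT t|?M. indicator (\<sigma> m -` {c} \<inter> space ?M) t * (indicator {a<..b} t * W t c))"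
        unfolding Z_def
      proof (rule difference_quotient_tendsto[OF ab gv[OF c] k[OF c] \<mu> nn ftc[OF c] _ _ h])
        show "AE r in ?M. \<bar>W r c\<bar> \<le> \<delta> * \<mu> r + (N c)\<^sup>2 / \<delta>" if "0 < \<delta>" for \<delta>
          using bound by eventually_elim (use c that in blast)
        show "\<sigma> m -` {c} \<inter> space ?M \<in> sets ?M"
          using \<sigma>(1)[of m] by (rule simple_functionD)
        show "0 \<le> (N c)\<^sup>2" by (rule zero_le_power2)
      qed
    qed
    \<comment> \<open>The difference between \<open>Y\<close> and \<open>Z\<close> is a quotient with the fixed second argument \<open>w t - \<sigma> m t\<close>.\<close>
    have step: "(LINT t|?M. indicator {a<..b} t * ((?q t - ?q (t - h n)) / h n))
        \<le> 2 * ((LINT t|?M. indicator {a<..b} t * Z n (\<sigma> m t) t) + (\<delta> * K + E m / \<delta>))" for n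
    proof -
      have "(LINT t|?M. indicator {a<..b} t * ((?q t - ?q (t - h n)) / h n))
         \<le> (LINT t|?M. 2 * (indicator {a<..b} t * Y n t))"
      proof (rule integral_mono[OF Xint integrable_mult_right[OF Yint]])
        fix t
        have "(?q t - ?q (t - h n)) / h n \<le> 2 * Y n t"
          using divide_right_mono[OF conv[of t "t - h n"], of "h n"] h(2)[of n] by (simp add: Y_def)
        then show "indicator {a<..b} t * ((?q t - ?q (t - h n)) / h n) \<le> 2 * (indicator {a<..b} t * Y n t)"
          by (simp add: indicator_def)
      qed
      also have "\<dots> = 2 * (LINT t|?M. indicator {a<..b} t * Y n t)" by (rule integral_mult_right_zero)
      finally have 1: "(LINT t|?M. indicator {a<..b} t * ((?q t - ?q (t - h n)) / h n))
         \<le> 2 * (LINT t|?M. indicator {a<..b} t * Y n t)" .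
      have "(LINT t|?M. indicator {a<..b} t * Y n t)
         \<le> (LINT t|?M. indicator {a<..b} t * Z n (\<sigma> m t) t + (\<delta> * Pq n t + inverse \<delta> * err t))"
      proof (rule integral_mono_AE[OF Yint])
        show "integrable ?M (\<lambda>t. indicator {a<..b} t * Z n (\<sigma> m t) t + (\<delta> * Pq n t + inverse \<delta> * err t))"
          by (intro Bochner_Integration.integrable_add integrable_mult_right Zs(1) Pq err)
        show "AE t in ?M. indicator {a<..b} t * Y n t
           \<le> indicator {a<..b} t * Z n (\<sigma> m t) t + (\<delta> * Pq n t + inverse \<delta> * err t)"
          using in_time wV
        proof eventually_elim
          case (elim t)
          show ?case
          proof (cases "t \<in> {a<..b}")
            case True
            let ?v = "\<lambda>x. w t x - \<sigma> m t x"
            have s: "\<sigma> m t \<in> V" using elim \<sigma>(2) by blast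
            have v: "?v \<in> V" using elim s sub by blast
            have "0 < t - h n" "t < T" using True h(3)[of n] ab by auto
            then have "\<bar>Z n ?v t\<bar> \<le> \<delta> * ((P t - P (t - h n)) / h n) + (N ?v)\<^sup>2 / \<delta>"
              unfolding Z_def using h(2)[of n]
            proof (intro difference_quotient_dominated[OF k[OF v] \<mu> P(4) ftc[OF v]])
              show "AE r in ?M. \<bar>W r ?v\<bar> \<le> \<delta> * \<mu> r + (N ?v)\<^sup>2 / \<delta>"
                using bound by eventually_elim (use v \<delta> in blast)
            qed auto
            moreover have "Y n t = Z n (\<sigma> m t) t + Z n ?v t"
              unfolding Y_def Z_def ipsub[OF elim(2) s] by (simp add: diff_divide_distrib)
            ultimately show ?thesis using True by (simp add: Pq_def err_def divide_inverse mult.commute)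
          next
            case False
            then show ?thesis using \<delta> by (simp add: Pq_def err_def)
          qed
        qed
      qed
      also have "\<dots> = (LINT t|?M. indicator {a<..b} t * Z n (\<sigma> m t) t) + (\<delta> * (LINT t|?M. Pq n t) + inverse \<delta> * (LINT t|?M. err t))"
        unfolding Bochner_Integration.integral_add[OF Zs(1) Bochner_Integration.integrable_add[OF integrable_mult_right[OF Pq(1)] integrable_mult_right[OF err(1)]]]
          Bochner_Integration.integral_add[OF integrable_mult_right[OF Pq(1)] integrable_mult_right[OF err(1)]]
        by (simp only: integral_mult_right_zero)
      also have "\<dots> \<le> (LINT t|?M. indicator {a<..b} t * Z n (\<sigma> m t) t) + (\<delta> * K + E m / \<delta>)"
        unfolding err(2)
        using mult_left_mono[OF Pq(2) less_imp_le[OF \<delta>]] by (simp add: divide_inverse mult.commute)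
      finally have 2: "(LINT t|?M. indicator {a<..b} t * Y n t)
        \<le> (LINT t|?M. indicator {a<..b} t * Z n (\<sigma> m t) t) + (\<delta> * K + E m / \<delta>)" .
      show ?thesis by (rule order_trans[OF 1 mult_left_mono[OF 2]]) simp
    qed
    have "(\<lambda>n. LINT t|?M. indicator {a<..b} t * ((?q t - ?q (t - h n)) / h n)) \<longlonglongrightarrow> ?q b - ?q a"
      by (rule difference_quotient_integral_tendsto[OF less_imp_le[OF ab(1)] ab(2,3) q h(1,2)])
    moreover have "(\<lambda>n. 2 * ((LINT t|?M. indicator {a<..b} t * Z n (\<sigma> m t) t) + (\<delta> * K + E m / \<delta>)))
      \<longlonglongrightarrow> 2 * ((LINT t|?M. indicator {a<..b} t * W t (\<sigma> m t)) + (\<delta> * K + E m / \<delta>))"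
      by (intro tendsto_intros Zlim)
    ultimately have A: "?q b - ?q a \<le> 2 * ((LINT t|?M. indicator {a<..b} t * W t (\<sigma> m t)) + (\<delta> * K + E m / \<delta>))"
      by (rule LIMSEQ_le) (use step in blast)
    have "(LINT t|?M. indicator {a<..b} t * W t (\<sigma> m t))
       \<le> (LINT t|?M. indicator {a<..b} t * W t (w t) + (\<delta> * \<mu> t + inverse \<delta> * err t))"
    proof (rule integral_mono_AE[OF Ws(1)])
      show "integrable ?M (\<lambda>t. indicator {a<..b} t * W t (w t) + (\<delta> * \<mu> t + inverse \<delta> * err t))"
        by (intro Bochner_Integration.integrable_add integrable_mult_right integrable_indicator_time[OF Wint Sab] \<mu> err)
      show "AE t in ?M. indicator {a<..b} t * W t (\<sigma> m t) \<le> indicator {a<..b} t * W t (w t) + (\<delta> * \<mu> t + inverse \<delta> * err t)"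
        using diff[of m] nn
      proof eventually_elim
        case (elim t)
        have "0 \<le> \<delta> * \<mu> t" "0 \<le> inverse \<delta> * err t" using elim \<delta> by (auto simp: err_def)
        moreover have "\<bar>W t (w t) - W t (\<sigma> m t)\<bar> \<le> \<delta> * \<mu> t + inverse \<delta> * err t"
          using elim \<delta> by (simp add: err_def divide_inverse mult.commute)
        ultimately show ?case by (auto simp: indicator_def)
      qed
    qed
    also have "\<dots> = (LINT t|?M. indicator {a<..b} t * W t (w t)) + (\<delta> * K + E m / \<delta>)"
      unfolding Bochner_Integration.integral_add[OF integrable_indicator_time[OF Wint Sab] Bochner_Integration.integrable_add[OF integrable_mult_right[OF \<mu>] integrable_mult_right[OF err(1)]]]
        Bochner_Integration.integral_add[OF integrable_mult_right[OF \<mu>] integrable_mult_right[OF err(1)]]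
      by (simp add: err(2) K_def divide_inverse mult.commute)
    finally have B: "(LINT t|?M. indicator {a<..b} t * W t (\<sigma> m t))
      \<le> (LINT t|?M. indicator {a<..b} t * W t (w t)) + (\<delta> * K + E m / \<delta>)" .
    show ?thesis
      by (rule order_trans[OF A order_trans[OF mult_left_mono[OF add_right_mono[OF B]]]]) simp_all
  qed
  have gap2: "?q b - ?q a \<le> 2 * (LINT t|?M. indicator {a<..b} t * W t (w t)) + 4 * (\<delta> * K)" if \<delta>: "0 < \<delta>"
    for \<delta>
  proof (rule LIMSEQ_le_const)
    have "(\<lambda>m. 2 * (LINT t|?M. indicator {a<..b} t * W t (w t)) + 4 * (\<delta> * K + E m / \<delta>))
      \<longlonglongrightarrow> 2 * (LINT t|?M. indicator {a<..b} t * W t (w t)) + 4 * (\<delta> * K + 0 / \<delta>)"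
      using dlim \<delta> unfolding E_def[symmetric] by (intro tendsto_intros) auto
    then show "(\<lambda>m. 2 * (LINT t|?M. indicator {a<..b} t * W t (w t)) + 4 * (\<delta> * K + E m / \<delta>))
      \<longlonglongrightarrow> 2 * (LINT t|?M. indicator {a<..b} t * W t (w t)) + 4 * (\<delta> * K)" by simp
  qed (use gap[OF \<delta>] in blast)
  have "ip (w b) (w b) - ip (w a) (w a) \<le> 2 * (LINT t|?M. indicator {a<..b} t * W t (w t))"
  proof (rule field_le_epsilon)
    fix e :: real assume "0 < e"
    have "4 * (e / (4 * (K + 1)) * K) \<le> e"
      using \<open>0 < e\<close> K by (simp add: field_simps)
    then show "ip (w b) (w b) - ip (w a) (w a) \<le> 2 * (LINT t|?M. indicator {a<..b} t * W t (w t)) + e"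
      using gap2[of "e / (4 * (K + 1))"] \<open>0 < e\<close> K by simp
  qed
  with Wint show ?thesis by blast
qed

lemma Lim_null_squeeze:
  fixes f :: "'b \<Rightarrow> real"
  assumes "\<And>s. norm (f s) \<le> g s" "(g \<longlongrightarrow> 0) F"
  shows "(f \<longlongrightarrow> 0) F"
  by (rule Lim_null_comparison[OF always_eventually[OF allI[OF assms(1)]] assms(2)])

lemma H1_subspaceD:
  assumes "H1_subspace \<Omega> V"
  shows "v \<in> V \<Longrightarrow> v \<in> H1 \<Omega>" "v \<in> V \<Longrightarrow> w \<in> V \<Longrightarrow> (\<lambda>x. v x - w x) \<in> V" "v \<in> V \<Longrightarrow> (\<lambda>x. c * v x) \<in> V"
proof -
  have lin: "(\<lambda>x. a * v x + b * w x) \<in> V" if "v \<in> V" "w \<in> V" for a b v w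
    using assms that unfolding H1_subspace_def by blast
  show "v \<in> V \<Longrightarrow> v \<in> H1 \<Omega>" using assms unfolding H1_subspace_def by blast
  show "v \<in> V \<Longrightarrow> w \<in> V \<Longrightarrow> (\<lambda>x. v x - w x) \<in> V" using lin[of v w 1 "-1"] by simp
  show "v \<in> V \<Longrightarrow> (\<lambda>x. c * v x) \<in> V" using lin[of v v c 0] by simp
qed

section \<open>Functionals on subspaces of \<open>H\<^sup>1\<close>\<close>

lemma dual_spaceD:
  assumes "F \<in> dual_space \<Omega> V"
  shows "v \<in> V \<Longrightarrow> w \<in> V \<Longrightarrow> F (\<lambda>x. v x + w x) = F v + F w" "v \<in> V \<Longrightarrow> F (\<lambda>x. c * v x) = c * F v"
    "\<exists>C. \<forall>v\<in>V. \<bar>F v\<bar> \<le> C * H1_norm \<Omega> v"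
  using assms by (simp_all add: dual_space_def)

lemma dual_space_diff_arg:
  assumes "H1_subspace \<Omega> V" "F \<in> dual_space \<Omega> V" "u \<in> V" "v \<in> V"
  shows "F (\<lambda>x. u x - v x) = F u - F v"
proof -
  have "(\<lambda>x. -1 * v x) \<in> V" using assms by (intro H1_subspaceD)
  then have "F (\<lambda>x. u x + -1 * v x) = F u + F (\<lambda>x. -1 * v x)"
    by (intro dual_spaceD(1)[OF assms(2)] assms(3))
  also have "F (\<lambda>x. -1 * v x) = -1 * F v"
    by (rule dual_spaceD(2)[OF assms(2,4)])
  finally show ?thesis by simp
qed

lemma dual_norm_bound:
  assumes "bounded \<Omega>" "open \<Omega>" and V: "H1_subspace \<Omega> V" and F: "F \<in> dual_space \<Omega> V" and v: "v \<in> V"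
  shows "\<bar>F v\<bar> \<le> dual_norm \<Omega> V F * H1_norm \<Omega> v"
proof -
  obtain C where C: "\<And>v. v \<in> V \<Longrightarrow> \<bar>F v\<bar> \<le> C * H1_norm \<Omega> v"
    using dual_spaceD(3)[OF F] by blast
  show ?thesis
  proof (cases "H1_norm \<Omega> v = 0")
    case True
    then show ?thesis using C[OF v] by simp
  next
    case False
    then have N: "H1_norm \<Omega> v > 0" using H1_norm_nonneg[of \<Omega> v] by linarith
    let ?u = "\<lambda>x. (1 / H1_norm \<Omega> v) * v x"
    have u: "?u \<in> V" using V v by (intro H1_subspaceD)
    have Nu: "H1_norm \<Omega> ?u = 1"
      using H1_scale(2)[OF assms(1,2) H1_subspaceD(1)[OF V v], of "1 / H1_norm \<Omega> v"] N by simp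
    have "\<bar>F ?u\<bar> \<le> dual_norm \<Omega> V F"
      unfolding dual_norm_def
    proof (rule cSUP_upper)
      show "?u \<in> {v \<in> V. H1_norm \<Omega> v \<le> 1}" using u Nu by simp
      show "bdd_above ((\<lambda>v. \<bar>F v\<bar>) ` {v \<in> V. H1_norm \<Omega> v \<le> 1})"
      proof (rule bdd_aboveI2)
        fix y assume "y \<in> {v \<in> V. H1_norm \<Omega> v \<le> 1}"
        then have y: "y \<in> V" "H1_norm \<Omega> y \<le> 1" by auto
        have "\<bar>F y\<bar> \<le> C * H1_norm \<Omega> y" by (rule C[OF y(1)])
        also have "\<dots> \<le> \<bar>C\<bar> * 1" using y(2) by (intro mult_mono) auto
        finally show "\<bar>F y\<bar> \<le> \<bar>C\<bar>" by simp
      qed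
    qed
    then have "\<bar>(1 / H1_norm \<Omega> v) * F v\<bar> \<le> dual_norm \<Omega> V F"
      by (simp only: dual_spaceD(2)[OF F v])
    then show ?thesis using N by (simp add: abs_mult divide_le_eq)
  qed
qed

lemma dual_space_diff:
  assumes "F \<in> dual_space \<Omega> V" "G \<in> dual_space \<Omega> V"
  shows "(\<lambda>v. F v - G v) \<in> dual_space \<Omega> V"
proof -
  obtain C D where C: "\<And>v. v \<in> V \<Longrightarrow> \<bar>F v\<bar> \<le> C * H1_norm \<Omega> v" and D: "\<And>v. v \<in> V \<Longrightarrow> \<bar>G v\<bar> \<le> D * H1_norm \<Omega> v"
    using dual_spaceD(3)[OF assms(1)] dual_spaceD(3)[OF assms(2)] by blast
  have "\<bar>F v - G v\<bar> \<le> (C + D) * H1_norm \<Omega> v" if "v \<in> V" for v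
    using C[OF that] D[OF that] by (simp add: distrib_right)
  then show ?thesis
    using assms unfolding dual_space_def by (auto simp: right_diff_distrib)
qed

text \<open>
  Evaluation at \<open>v\<close> turns the approximating simple functionals into simple scalar functions, which gives
  measurability; the bound by the dual norm gives integrability.
\<close>
lemma bochner_dual_facts:
  assumes \<Omega>: "bounded \<Omega>" "open \<Omega>" and V: "H1_subspace \<Omega> V"
    and F: "F \<in> bochner_L2 (dual_space \<Omega> V) (dual_norm \<Omega> V) T"
  shows "AE t in lebesgue_on {0<..<T}. F t \<in> dual_space \<Omega> V"
    and "integrable (lebesgue_on {0<..<T}) (\<lambda>t. (dual_norm \<Omega> V (F t))\<^sup>2)"
    and "v \<in> V \<Longrightarrow> integrable (lebesgue_on {0<..<T}) (\<lambda>t. F t v)"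
proof -
  let ?M = "lebesgue_on {0<..<T}"
  show dual: "AE t in ?M. F t \<in> dual_space \<Omega> V" and int: "integrable ?M (\<lambda>t. (dual_norm \<Omega> V (F t))\<^sup>2)"
    using F by (auto simp: bochner_L2_def)
  obtain s where s: "\<And>n. simple_function ?M (s n)" "\<And>n t. t \<in> space ?M \<Longrightarrow> s n t \<in> dual_space \<Omega> V"
    "AE t in ?M. (\<lambda>n. dual_norm \<Omega> V (\<lambda>x. F t x - s n t x)) \<longlonglongrightarrow> 0"
    using F unfolding bochner_L2_def bochner_measurable_def by blast
  assume v: "v \<in> V"
  have meas: "(\<lambda>t. F t v) \<in> borel_measurable ?M"
  proof (rule borel_measurable_lebesgue_on_AE_limit)
    show "(\<lambda>t. s n t v) \<in> borel_measurable ?M" for n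
      by (rule borel_measurable_simple_function) (rule simple_function_compose1[OF s(1)])
    have "AE t in ?M. t \<in> {0<..<T}" by (rule AE_I2) simp
    with dual s(3) show "AE t in ?M. (\<lambda>n. s n t v) \<longlonglongrightarrow> F t v"
    proof eventually_elim
      case (elim t)
      have "norm (s n t v - F t v) \<le> dual_norm \<Omega> V (\<lambda>x. F t x - s n t x) * H1_norm \<Omega> v" for n
        using dual_norm_bound[OF \<Omega> V dual_space_diff[OF elim(1) s(2)[of t n]] v] elim(3)
        by (simp add: abs_minus_commute)
      moreover have "(\<lambda>n. dual_norm \<Omega> V (\<lambda>x. F t x - s n t x) * H1_norm \<Omega> v) \<longlonglongrightarrow> 0"
        using tendsto_mult_right[OF elim(2)] by simp
      ultimately have "(\<lambda>n. s n t v - F t v) \<longlonglongrightarrow> 0"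
        by - (rule Lim_null_squeeze)
      then show ?case by (simp add: LIM_zero_iff)
    qed
  qed simp
  interpret finite_measure ?M by (rule finite_measure_time)
  show "integrable ?M (\<lambda>t. F t v)"
  proof (rule Bochner_Integration.integrable_bound[OF _ meas])
    show "integrable ?M (\<lambda>t. (dual_norm \<Omega> V (F t))\<^sup>2 + (H1_norm \<Omega> v)\<^sup>2)"
      by (intro Bochner_Integration.integrable_add int) simp
    show "AE t in ?M. norm (F t v) \<le> norm ((dual_norm \<Omega> V (F t))\<^sup>2 + (H1_norm \<Omega> v)\<^sup>2)"
      using dual
    proof eventually_elim
      case (elim t)
      have "\<bar>F t v\<bar> \<le> dual_norm \<Omega> V (F t) * H1_norm \<Omega> v"
        by (rule dual_norm_bound[OF \<Omega> V elim v])
      also have "\<dots> \<le> (dual_norm \<Omega> V (F t))\<^sup>2 + (H1_norm \<Omega> v)\<^sup>2"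
        using sum_squares_bound[of "dual_norm \<Omega> V (F t)" "H1_norm \<Omega> v"]
          zero_le_power2[of "dual_norm \<Omega> V (F t)"] zero_le_power2[of "H1_norm \<Omega> v"] by linarith
      finally show ?case by simp
    qed
  qed
qed

lemma Young_weighted:
  fixes m n \<delta> :: real
  assumes "0 < \<delta>"
  shows "m * n \<le> \<delta> / 2 * m\<^sup>2 + n\<^sup>2 / (2 * \<delta>)"
proof -
  have "0 \<le> (\<delta> * m - n)\<^sup>2 / (2 * \<delta>)" using assms by simp
  then show ?thesis using assms by (simp add: field_simps power2_eq_square)
qed

section \<open>Simple approximations with values in a subspace\<close>

lemma H1_norm_diff_commute:
  "H1_norm \<Omega> (\<lambda>x. v x - w x) = H1_norm \<Omega> (\<lambda>x. w x - v x)"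
    if "bounded \<Omega>" "open \<Omega>" "v \<in> H1 \<Omega>" "w \<in> H1 \<Omega>"
  using H1_scale(2)[OF that(1,2) H1_diff(1)[OF that], of "-1"] by simp

lemma H1_norm_diff_triangle:
  assumes "bounded \<Omega>" "open \<Omega>" "u \<in> H1 \<Omega>" "v \<in> H1 \<Omega>" "w \<in> H1 \<Omega>"
  shows "H1_norm \<Omega> (\<lambda>x. u x - w x) \<le> H1_norm \<Omega> (\<lambda>x. u x - v x) + H1_norm \<Omega> (\<lambda>x. v x - w x)"
  using H1_norm_triangle[OF assms(1,2) H1_diff(1)[OF assms(1-4)] H1_diff(1)[OF assms(1,2,4,5)]] by simp

lemma H1_norm_reverse_triangle:
  assumes "bounded \<Omega>" "open \<Omega>" "u \<in> H1 \<Omega>" "v \<in> H1 \<Omega>" "w \<in> H1 \<Omega>"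
  shows "\<bar>H1_norm \<Omega> (\<lambda>x. u x - w x) - H1_norm \<Omega> (\<lambda>x. v x - w x)\<bar> \<le> H1_norm \<Omega> (\<lambda>x. u x - v x)"
  using H1_norm_diff_triangle[OF assms] H1_norm_diff_triangle[OF assms(1,2,4,3,5)]
    H1_norm_diff_commute[OF assms(1-4)] by linarith

text \<open>
  A substitute for the orthogonal projection of \<open>c\<close> onto \<open>V\<close>.
\<close>
lemma near_best_approximation:
  assumes "bounded \<Omega>" "open \<Omega>" "V \<noteq> {}" "0 < e"
  obtains p where "p \<in> V" "\<And>v. v \<in> V \<Longrightarrow> H1_norm \<Omega> (\<lambda>x. c x - p x) \<le> H1_norm \<Omega> (\<lambda>x. c x - v x) + e"
proof -
  let ?D = "(\<lambda>v. H1_norm \<Omega> (\<lambda>x. c x - v x)) ` V"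
  have bdd: "bdd_below ?D" by (rule bdd_belowI2[of _ 0]) simp
  have "Inf ?D < Inf ?D + e" using \<open>0 < e\<close> by simp
  then obtain y where y: "y \<in> ?D" "y < Inf ?D + e"
    using \<open>V \<noteq> {}\<close> cInf_lessD[of ?D] by blast
  then obtain p where p: "p \<in> V" "H1_norm \<Omega> (\<lambda>x. c x - p x) < Inf ?D + e" by auto
  have "Inf ?D \<le> H1_norm \<Omega> (\<lambda>x. c x - v x)" if "v \<in> V" for v
    by (rule cInf_lower[OF _ bdd]) (use that in blast)
  then show ?thesis using p that by fastforce
qed

text \<open>
  The approximants \<open>s n\<close> may leave \<open>V\<close>.  Replacing each of their finitely many values by a nearly closest
  element of \<open>V\<close> at most doubles the distance to \<open>w t \<in> V\<close>, up to \<open>1/(m+1)\<close>.  Cutting off where the result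
  exceeds twice the norm of \<open>w t\<close> then provides a dominating function for convergence of the squared
  distances in mean.
\<close>
lemma simple_approximation_in_subspace:
  fixes w :: "real \<Rightarrow> 'a::euclidean_space \<Rightarrow> real"
  assumes \<Omega>: "bounded \<Omega>" "open \<Omega>" and V: "H1_subspace \<Omega> V" and V0: "(\<lambda>x. 0) \<in> V"
    and wV: "AE t in lebesgue_on {0<..<T}. w t \<in> V"
    and s: "\<And>n. simple_function (lebesgue_on {0<..<T}) (s n)" "\<And>n t. t \<in> {0<..<T} \<Longrightarrow> s n t \<in> H1 \<Omega>"
      "AE t in lebesgue_on {0<..<T}. (\<lambda>n. H1_norm \<Omega> (\<lambda>x. w t x - s n t x)) \<longlonglongrightarrow> 0"
    and D: "integrable (lebesgue_on {0<..<T}) D" "AE t in lebesgue_on {0<..<T}. (H1_norm \<Omega> (w t))\<^sup>2 \<le> D t"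
  shows "\<exists>\<sigma>. (\<forall>m::nat. simple_function (lebesgue_on {0<..<T}) (\<sigma> m)) \<and> (\<forall>m. \<forall>t\<in>{0<..<T}. \<sigma> m t \<in> V) \<and>
     (\<forall>m. integrable (lebesgue_on {0<..<T}) (\<lambda>t. (H1_norm \<Omega> (\<lambda>x. w t x - \<sigma> m t x))\<^sup>2)) \<and>
     (\<lambda>m. LINT t|lebesgue_on {0<..<T}. (H1_norm \<Omega> (\<lambda>x. w t x - \<sigma> m t x))\<^sup>2) \<longlonglongrightarrow> 0 \<and>
     (AE t in lebesgue_on {0<..<T}. (\<lambda>m. H1_norm \<Omega> (\<lambda>x. w t x - \<sigma> m t x)) \<longlonglongrightarrow> 0)"
proof -
  let ?M = "lebesgue_on {0<..<T}" and ?N = "H1_norm \<Omega>"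
  have time: "AE t in ?M. t \<in> {0<..<T}" by (rule AE_I2) simp
  have VH: "v \<in> V \<Longrightarrow> v \<in> H1 \<Omega>" for v by (rule H1_subspaceD(1)[OF V])
  have H0: "(\<lambda>x. 0) \<in> H1 \<Omega>" by (rule VH[OF V0])
  have dist_meas: "(\<lambda>t. ?N (\<lambda>x. w t x - \<tau> t x)) \<in> borel_measurable ?M"
    if \<tau>: "simple_function ?M \<tau>" "\<And>t. t \<in> {0<..<T} \<Longrightarrow> \<tau> t \<in> H1 \<Omega>" for \<tau>
  proof (rule borel_measurable_lebesgue_on_AE_limit)
    show "(\<lambda>t. ?N (\<lambda>x. s n t x - \<tau> t x)) \<in> borel_measurable ?M" for n
      by (rule borel_measurable_simple_function)
        (rule simple_function_compose2[OF s(1) \<tau>(1), of "\<lambda>c d. ?N (\<lambda>x. c x - d x)"])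
    show "AE t in ?M. (\<lambda>n. ?N (\<lambda>x. s n t x - \<tau> t x)) \<longlonglongrightarrow> ?N (\<lambda>x. w t x - \<tau> t x)"
      using time wV s(3)
    proof eventually_elim
      case (elim t)
      have "norm (?N (\<lambda>x. s n t x - \<tau> t x) - ?N (\<lambda>x. w t x - \<tau> t x)) \<le> ?N (\<lambda>x. w t x - s n t x)" for n
        using H1_norm_reverse_triangle[OF \<Omega> VH[OF elim(2)] s(2)[OF elim(1), of n] \<tau>(2)[OF elim(1)]]
        by (simp add: abs_minus_commute)
      then have "(\<lambda>n. ?N (\<lambda>x. s n t x - \<tau> t x) - ?N (\<lambda>x. w t x - \<tau> t x)) \<longlonglongrightarrow> 0"
        by - (rule Lim_null_squeeze[OF _ elim(3)])
      then show ?case by (simp add: LIM_zero_iff)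
    qed
  qed simp
  have w_meas: "(\<lambda>t. ?N (w t)) \<in> borel_measurable ?M"
    using dist_meas[of "\<lambda>_ _. 0"] H0 by simp
  have ex: "\<exists>p. p \<in> V \<and> (\<forall>v\<in>V. ?N (\<lambda>x. c x - p x) \<le> ?N (\<lambda>x. c x - v x) + inverse (real (Suc m)))"
    for m :: nat and c
  proof -
    obtain p where "p \<in> V" "\<And>v. v \<in> V \<Longrightarrow> ?N (\<lambda>x. c x - p x) \<le> ?N (\<lambda>x. c x - v x) + inverse (real (Suc m))"
      using near_best_approximation[OF \<Omega>, of V "inverse (real (Suc m))" c] V0 by auto
    then show ?thesis by blast
  qed
  define p where "p m c = (SOME p. p \<in> V \<and> (\<forall>v\<in>V. ?N (\<lambda>x. c x - p x) \<le> ?N (\<lambda>x. c x - v x) + inverse (real (Suc m))))"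
    for m :: nat and c
  have pm: "p m c \<in> V \<and> (\<forall>v\<in>V. ?N (\<lambda>x. c x - p m c x) \<le> ?N (\<lambda>x. c x - v x) + inverse (real (Suc m)))"
    for m c
    unfolding p_def by (rule someI_ex[OF ex])
  have p: "p m c \<in> V" "v \<in> V \<Longrightarrow> ?N (\<lambda>x. c x - p m c x) \<le> ?N (\<lambda>x. c x - v x) + inverse (real (Suc m))"
    for m c v
    using pm[of m c] by auto
  define \<rho> where "\<rho> m t = p m (s m t)" for m t
  have \<rho>V: "\<rho> m t \<in> V" for m t by (simp add: \<rho>_def p)
  have \<rho>s: "simple_function ?M (\<rho> m)" for m
    unfolding \<rho>_def by (rule simple_function_compose1[OF s(1)])
  have \<rho>lim: "AE t in ?M. (\<lambda>m. ?N (\<lambda>x. w t x - \<rho> m t x)) \<longlonglongrightarrow> 0"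
    using time wV s(3)
  proof eventually_elim
    case (elim t)
    have "norm (?N (\<lambda>x. w t x - \<rho> m t x)) \<le> 2 * ?N (\<lambda>x. w t x - s m t x) + inverse (real (Suc m))" for m
      using H1_norm_diff_triangle[OF \<Omega> VH[OF elim(2)] s(2)[OF elim(1), of m] VH[OF \<rho>V[of m t]]]
        p(2)[OF elim(2), of "s m t" m] H1_norm_diff_commute[OF \<Omega> VH[OF elim(2)] s(2)[OF elim(1), of m]]
      by (simp add: \<rho>_def)
    moreover have "(\<lambda>m. 2 * ?N (\<lambda>x. w t x - s m t x) + inverse (real (Suc m))) \<longlonglongrightarrow> 2 * 0 + 0"
      by (intro tendsto_add tendsto_mult_left elim LIMSEQ_inverse_real_of_nat)
    moreover from this have "(\<lambda>m. 2 * ?N (\<lambda>x. w t x - s m t x) + inverse (real (Suc m))) \<longlonglongrightarrow> 0"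
      by simp
    ultimately show ?case by - (rule Lim_null_squeeze)
  qed
  define \<sigma> where "\<sigma> m t = (if ?N (\<rho> m t) \<le> 2 * ?N (w t) then \<rho> m t else (\<lambda>x. 0))" for m t
  have \<sigma>V: "\<sigma> m t \<in> V" for m t by (simp add: \<sigma>_def \<rho>V V0)
  have \<sigma>s: "simple_function ?M (\<sigma> m)" for m
    unfolding \<sigma>_def
  proof (rule simple_function_If[OF \<rho>s])
    have "(\<lambda>t. ?N (\<rho> m t)) \<in> borel_measurable ?M"
      by (rule borel_measurable_simple_function) (rule simple_function_compose1[OF \<rho>s])
    then show "{t \<in> space ?M. ?N (\<rho> m t) \<le> 2 * ?N (w t)} \<in> sets ?M"
      using w_meas by measurable
  qed simp
  \<comment> \<open>The factor 3 is the sum of 1 for \<open>w t\<close> and 2 for the cut-off.\<close>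
  have \<sigma>3: "?N (\<lambda>x. w t x - \<sigma> m t x) \<le> 3 * ?N (w t)" if "w t \<in> V" for m t
    using H1_diff(2)[OF \<Omega> VH[OF that] VH[OF \<rho>V[of m t]]] H1_norm_nonneg[of \<Omega> "w t"] by (simp add: \<sigma>_def)
  have \<sigma>lim: "AE t in ?M. (\<lambda>m. ?N (\<lambda>x. w t x - \<sigma> m t x)) \<longlonglongrightarrow> 0"
    using wV \<rho>lim
  proof eventually_elim
    case (elim t)
    show ?case
    proof (cases "?N (w t) = 0")
      case True
      then have "?N (\<lambda>x. w t x - \<sigma> m t x) = 0" for m
        using \<sigma>3[OF elim(1), of m] H1_norm_nonneg[of \<Omega> "\<lambda>x. w t x - \<sigma> m t x"] by simp
      then show ?thesis by simp
    next
      case False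
      then have "0 < ?N (w t)" using H1_norm_nonneg[of \<Omega> "w t"] by linarith
      then have "\<forall>\<^sub>F m in sequentially. ?N (\<lambda>x. w t x - \<rho> m t x) < ?N (w t)"
        by (rule order_tendstoD(2)[OF elim(2)])
      then have "\<forall>\<^sub>F m in sequentially. ?N (\<lambda>x. w t x - \<rho> m t x) = ?N (\<lambda>x. w t x - \<sigma> m t x)"
      proof eventually_elim
        case (elim m)
        have "?N (\<rho> m t) \<le> ?N (w t) + ?N (\<lambda>x. w t x - \<rho> m t x)"
          using H1_norm_reverse_triangle[OF \<Omega> VH[OF \<open>w t \<in> V\<close>] VH[OF \<rho>V[of m t]] H0] by simp
        then show ?case using elim by (simp add: \<sigma>_def)
      qed
      then show ?thesis by (rule Lim_transform_eventually[OF elim(2)])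
    qed
  qed
  have dom: "AE t in ?M. norm ((?N (\<lambda>x. w t x - \<sigma> m t x))\<^sup>2) \<le> 9 * D t" for m
    using wV D(2)
  proof eventually_elim
    case (elim t)
    have "(?N (\<lambda>x. w t x - \<sigma> m t x))\<^sup>2 \<le> (3 * ?N (w t))\<^sup>2"
      by (intro power_mono \<sigma>3[OF elim(1)]) simp
    then show ?case using elim(2) by (simp add: power_mult_distrib)
  qed
  have \<sigma>m: "(\<lambda>t. (?N (\<lambda>x. w t x - \<sigma> m t x))\<^sup>2) \<in> borel_measurable ?M" for m
    using dist_meas[OF \<sigma>s VH[OF \<sigma>V], of m] by simp
  have D9: "integrable ?M (\<lambda>t. 9 * D t)" using D(1) by simp
  have \<sigma>int: "integrable ?M (\<lambda>t. (?N (\<lambda>x. w t x - \<sigma> m t x))\<^sup>2)" for m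
    by (rule Bochner_Integration.integrable_bound[OF D9 \<sigma>m])
      (use dom[of m] in \<open>auto elim!: eventually_mono\<close>)
  have "(\<lambda>m. LINT t|?M. (?N (\<lambda>x. w t x - \<sigma> m t x))\<^sup>2) \<longlonglongrightarrow> (LINT t|?M. 0)"
  proof (rule integral_dominated_convergence[OF _ \<sigma>m D9 _ dom])
    show "AE t in ?M. (\<lambda>m. (?N (\<lambda>x. w t x - \<sigma> m t x))\<^sup>2) \<longlonglongrightarrow> 0"
      using \<sigma>lim
    proof eventually_elim
      case (elim t)
      from tendsto_power[OF elim, of 2] show ?case by simp
    qed
  qed simp
  then show ?thesis
    using \<sigma>s \<sigma>V \<sigma>int \<sigma>lim by (intro exI[of _ \<sigma>]) simp
qed

section \<open>Continuity in time with values in \<open>L\<^sup>2\<close>\<close>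

text \<open>
  Continuity on the whole line, so that backward shifts in time are defined everywhere.  A function on
  \<open>[0,T]\<close> is continued by its end values.
\<close>
definition L2_continuous :: "'a::euclidean_space set \<Rightarrow> (real \<Rightarrow> 'a \<Rightarrow> real) \<Rightarrow> bool" where
  "L2_continuous \<Omega> A \<longleftrightarrow> (\<forall>t. A t \<in> L2_space \<Omega>) \<and> (\<forall>t. ((\<lambda>s. L2_norm \<Omega> (\<lambda>x. A s x - A t x)) \<longlongrightarrow> 0) (at t))"

lemma L2_continuous_clamp:
  assumes "continuous_L2 \<Omega> T w" "0 < T"
  shows "L2_continuous \<Omega> (\<lambda>t. w (max 0 (min T t)))"
  unfolding L2_continuous_def
proof (intro conjI allI)
  have c: "max 0 (min T t) \<in> {0..T}" for t using \<open>0 < T\<close> by auto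
  show "w (max 0 (min T t)) \<in> L2_space \<Omega>" for t
    using assms(1) c[of t] unfolding continuous_L2_def by blast
  fix t
  let ?t = "max 0 (min T t)"
  have lim: "((\<lambda>s. L2_norm \<Omega> (\<lambda>x. w s x - w ?t x)) \<longlongrightarrow> 0) (at ?t within {0..T})"
    using assms(1) c[of t] unfolding continuous_L2_def by blast
  show "((\<lambda>s. L2_norm \<Omega> (\<lambda>x. w (max 0 (min T s)) x - w ?t x)) \<longlongrightarrow> 0) (at t)"
  proof (rule LIM_I)
    fix e :: real assume e: "0 < e"
    obtain d where d: "0 < d" "\<And>s. s \<in> {0..T} \<Longrightarrow> s \<noteq> ?t \<Longrightarrow> dist s ?t < d \<Longrightarrow> L2_norm \<Omega> (\<lambda>x. w s x - w ?t x) < e"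
      using lim e unfolding Lim_within by (auto simp: dist_real_def)
    have "norm (L2_norm \<Omega> (\<lambda>x. w (max 0 (min T s)) x - w ?t x) - 0) < e" if "norm (s - t) < d" for s
    proof (cases "max 0 (min T s) = ?t")
      case True
      then show ?thesis using e by (simp add: L2_norm_def)
    next
      case False
      have "dist (max 0 (min T s)) ?t < d" using that by (auto simp: dist_real_def)
      then show ?thesis using d(2)[OF c[of s] False] by simp
    qed
    then show "\<exists>d>0. \<forall>s. s \<noteq> t \<and> norm (s - t) < d \<longrightarrow> norm (L2_norm \<Omega> (\<lambda>x. w (max 0 (min T s)) x - w ?t x) - 0) < e"
      using d(1) by blast
  qed
qed

lemma L2_continuous_diff:
  assumes "L2_continuous \<Omega> A" "L2_continuous \<Omega> B"
  shows "L2_continuous \<Omega> (\<lambda>t x. A t x - B t x)"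
  unfolding L2_continuous_def
proof (intro conjI allI)
  have A: "A t \<in> L2_space \<Omega>" "((\<lambda>s. L2_norm \<Omega> (\<lambda>x. A s x - A t x)) \<longlongrightarrow> 0) (at t)"
    and B: "B t \<in> L2_space \<Omega>" "((\<lambda>s. L2_norm \<Omega> (\<lambda>x. B s x - B t x)) \<longlongrightarrow> 0) (at t)" for t
    using assms by (auto simp: L2_continuous_def)
  show "(\<lambda>x. A t x - B t x) \<in> L2_space \<Omega>" for t using A B by (intro L2_space_diff)
  fix t
  have "norm (L2_norm \<Omega> (\<lambda>x. (A s x - B s x) - (A t x - B t x)))
     \<le> L2_norm \<Omega> (\<lambda>x. A s x - A t x) + L2_norm \<Omega> (\<lambda>x. B s x - B t x)" for s
  proof -
    have eq: "(\<lambda>x. (A s x - B s x) - (A t x - B t x)) = (\<lambda>x. (A s x - A t x) + (-1) *\<^sub>R (B s x - B t x))"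
      by (auto simp: algebra_simps)
    have "(\<lambda>x. (-1) *\<^sub>R (B s x - B t x)) \<in> L2_space \<Omega>"
      using L2_space_diff[OF B(1)[of t] B(1)[of s]] by simp
    from L2_norm_triangle[OF L2_space_diff[OF A(1)[of s] A(1)[of t]] this]
    show ?thesis unfolding eq L2_norm_scale by simp
  qed
  moreover have "((\<lambda>s. L2_norm \<Omega> (\<lambda>x. A s x - A t x) + L2_norm \<Omega> (\<lambda>x. B s x - B t x)) \<longlongrightarrow> 0) (at t)"
    using tendsto_add[OF A(2)[of t] B(2)[of t]] by simp
  ultimately show "((\<lambda>s. L2_norm \<Omega> (\<lambda>x. (A s x - B s x) - (A t x - B t x))) \<longlongrightarrow> 0) (at t)"
    by - (rule Lim_null_squeeze)
qed

lemma L2_continuous_inner: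
  assumes "L2_continuous \<Omega> A" "L2_continuous \<Omega> B"
  shows "continuous_on UNIV (\<lambda>t. LINT x|lebesgue_on \<Omega>. A t x * B t x)"
  unfolding continuous_on_def
proof (intro ballI)
  fix t
  have A: "A t \<in> L2_space \<Omega>" "((\<lambda>s. L2_norm \<Omega> (\<lambda>x. A s x - A t x)) \<longlongrightarrow> 0) (at t)"
    and B: "B t \<in> L2_space \<Omega>" "((\<lambda>s. L2_norm \<Omega> (\<lambda>x. B s x - B t x)) \<longlongrightarrow> 0) (at t)" for t
    using assms by (auto simp: L2_continuous_def)
  let ?a = "\<lambda>s. L2_norm \<Omega> (\<lambda>x. A s x - A t x)" and ?b = "\<lambda>s. L2_norm \<Omega> (\<lambda>x. B s x - B t x)"
  have "norm ((LINT x|lebesgue_on \<Omega>. A s x * B s x) - (LINT x|lebesgue_on \<Omega>. A t x * B t x))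
     \<le> ?a s * (L2_norm \<Omega> (B t) + ?b s) + L2_norm \<Omega> (A t) * ?b s" for s
  proof -
    have dA: "(\<lambda>x. A s x - A t x) \<in> L2_space \<Omega>" and dB: "(\<lambda>x. B s x - B t x) \<in> L2_space \<Omega>"
      using A B by (auto intro: L2_space_diff)
    have eq: "(LINT x|lebesgue_on \<Omega>. A s x * B s x) - (LINT x|lebesgue_on \<Omega>. A t x * B t x)
       = (LINT x|lebesgue_on \<Omega>. (A s x - A t x) * B s x) + (LINT x|lebesgue_on \<Omega>. A t x * (B s x - B t x))"
      using L2_mult_integrable[OF A(1) B(1), of s s] L2_mult_integrable[OF A(1) B(1), of t t]
        L2_mult_integrable[OF A(1) B(1), of t s]
      by (simp add: left_diff_distrib right_diff_distrib)
    have "L2_norm \<Omega> (B s) \<le> L2_norm \<Omega> (B t) + ?b s"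
      using L2_norm_triangle[OF B(1)[of t] dB] by simp
    then have "?a s * L2_norm \<Omega> (B s) \<le> ?a s * (L2_norm \<Omega> (B t) + ?b s)"
      by (rule mult_left_mono) simp
    then show ?thesis
      unfolding eq using L2_Cauchy_Schwarz[OF dA B(1)[of s]] L2_Cauchy_Schwarz[OF A(1)[of t] dB] by simp
  qed
  moreover have "((\<lambda>s. ?a s * (L2_norm \<Omega> (B t) + ?b s) + L2_norm \<Omega> (A t) * ?b s) \<longlongrightarrow>
     0 * (L2_norm \<Omega> (B t) + 0) + L2_norm \<Omega> (A t) * 0) (at t)"
    by (intro tendsto_intros A B)
  moreover from this have "((\<lambda>s. ?a s * (L2_norm \<Omega> (B t) + ?b s) + L2_norm \<Omega> (A t) * ?b s) \<longlongrightarrow> 0) (at t)"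
    by simp
  ultimately have "((\<lambda>s. (LINT x|lebesgue_on \<Omega>. A s x * B s x) - (LINT x|lebesgue_on \<Omega>. A t x * B t x)) \<longlongrightarrow> 0) (at t)"
    by - (rule Lim_null_squeeze)
  then show "((\<lambda>t. LINT x|lebesgue_on \<Omega>. A t x * B t x) \<longlongrightarrow> (LINT x|lebesgue_on \<Omega>. A t x * B t x)) (at t within UNIV)"
    by (simp add: LIM_zero_iff)
qed

lemma L2_continuous_const: "v \<in> L2_space \<Omega> \<Longrightarrow> L2_continuous \<Omega> (\<lambda>t. v)"
  by (simp add: L2_continuous_def L2_norm_def)

lemma L2_continuous_shift:
  assumes "L2_continuous \<Omega> A"
  shows "L2_continuous \<Omega> (\<lambda>t. A (t - h))"
  unfolding L2_continuous_def
proof (intro conjI allI)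
  show "A (t - h) \<in> L2_space \<Omega>" for t using assms by (simp add: L2_continuous_def)
  fix t
  have "((\<lambda>s. L2_norm \<Omega> (\<lambda>x. A s x - A (t - h) x)) \<longlongrightarrow> 0) (at (t - h))"
    using assms by (simp add: L2_continuous_def)
  then show "((\<lambda>s. L2_norm \<Omega> (\<lambda>x. A (s - h) x - A (t - h) x)) \<longlongrightarrow> 0) (at t)"
    using LIM_offset[of "\<lambda>s. L2_norm \<Omega> (\<lambda>x. A s x - A (t - h) x)" 0 "t - h" "- h"] by simp
qed

lemma evolution_class_FTC:
  assumes \<Omega>: "bounded \<Omega>" "open \<Omega>" and V: "H1_subspace \<Omega> V" and "0 < T"
    and ev: "evolution_class \<Omega> V X T w w'" and v: "v \<in> V" and st: "0 < s" "s \<le> t" "t < T"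
  shows "(LINT x|lebesgue_on \<Omega>. w t x * v x) - (LINT x|lebesgue_on \<Omega>. w s x * v x)
    = (LINT r|lebesgue_on {0<..<T}. indicator {s<..t} r * w' r v)"
proof -
  define g where "g t = (LINT x|lebesgue_on \<Omega>. w (max 0 (min T t)) x * v x)" for t
  have gw: "g t = (LINT x|lebesgue_on \<Omega>. w t x * v x)" if "t \<in> {0<..<T}" for t
    using that by (simp add: g_def min_def max_def)
  have "v \<in> L2_space \<Omega>" using H1D(1)[OF H1_subspaceD(1)[OF V v]] .
  then have g: "continuous_on UNIV g"
    unfolding g_def using ev L2_continuous_clamp[OF _ \<open>0 < T\<close>]
    by (intro L2_continuous_inner L2_continuous_const) (auto simp: evolution_class_def)
  have k: "integrable (lebesgue_on {0<..<T}) (\<lambda>t. w' t v)"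
    using ev v by (intro bochner_dual_facts(3)[OF \<Omega> V]) (auto simp: evolution_class_def)
  have "g t - g s = (LINT r|lebesgue_on {0<..<T}. indicator {s<..t} r * w' r v)"
  proof (rule weak_derivative_imp_FTC[OF st g k])
    fix \<psi> :: "real \<Rightarrow> real" assume \<psi>: "test_function {0<..<T} \<psi>"
    have "(LINT r|lebesgue_on {0<..<T}. g r * deriv \<psi> r)
       = (LINT r|lebesgue_on {0<..<T}. (LINT x|lebesgue_on \<Omega>. w r x * v x) * deriv \<psi> r)"
      using gw by (intro Bochner_Integration.integral_cong) auto
    then show "(LINT r|lebesgue_on {0<..<T}. g r * deriv \<psi> r) = - (LINT r|lebesgue_on {0<..<T}. w' r v * \<psi> r)"
      using ev v \<psi> by (simp add: evolution_class_def has_weak_time_derivative_def)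
  qed
  then show ?thesis using gw[of s] gw[of t] st by simp
qed

section \<open>Gronwall's inequality\<close>

text \<open>
  The majorant \<open>z s = A + \<kappa> (\<Phi> s - \<Phi> 0)\<close> satisfies \<open>z' \<le> \<kappa> z\<close>, so \<open>z s exp(-\<kappa> s)\<close> is nonincreasing.
\<close>
lemma Gronwall_primitive:
  fixes \<phi> \<Phi> :: "real \<Rightarrow> real"
  assumes \<Phi>: "\<And>x. (\<Phi> has_real_derivative \<phi> x) (at x)" and "0 \<le> \<kappa>" "0 \<le> t"
    and le: "\<And>s. 0 \<le> s \<Longrightarrow> s \<le> t \<Longrightarrow> \<phi> s \<le> A + \<kappa> * (\<Phi> s - \<Phi> 0)"
  shows "\<phi> t \<le> A * exp (\<kappa> * t)"
proof -
  define z where "z s = A + \<kappa> * (\<Phi> s - \<Phi> 0)" for s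
  have "z t * exp (- (\<kappa> * t)) \<le> z 0 * exp (- (\<kappa> * 0))"
  proof (rule DERIV_nonpos_imp_nonincreasing[OF \<open>0 \<le> t\<close>])
    fix s assume s: "0 \<le> s" "s \<le> t"
    have "((\<lambda>s. z s * exp (- (\<kappa> * s))) has_real_derivative
        \<kappa> * \<phi> s * exp (- (\<kappa> * s)) + exp (- (\<kappa> * s)) * (- \<kappa>) * z s) (at s)"
      unfolding z_def by (rule derivative_eq_intros \<Phi> refl | simp)+
    moreover have "\<kappa> * \<phi> s * exp (- (\<kappa> * s)) + exp (- (\<kappa> * s)) * (- \<kappa>) * z s
        = \<kappa> * exp (- (\<kappa> * s)) * (\<phi> s - z s)"
      by (simp add: algebra_simps)
    moreover have "\<kappa> * exp (- (\<kappa> * s)) * (\<phi> s - z s) \<le> 0"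
      using le[OF s] \<open>0 \<le> \<kappa>\<close> by (intro mult_nonneg_nonpos) (auto simp: z_def)
    ultimately show "\<exists>y. ((\<lambda>s. z s * exp (- (\<kappa> * s))) has_real_derivative y) (at s) \<and> y \<le> 0"
      by auto
  qed
  then have "z t \<le> A * exp (\<kappa> * t)"
    by (simp add: z_def exp_minus field_simps)
  then show ?thesis using le[OF \<open>0 \<le> t\<close> order_refl] by (simp add: z_def)
qed

text \<open>
  Monotonicity extends to the end points 0 and \<open>T\<close> because both conditions describe closed sets.
\<close>
lemma nonincreasing_on_closed_interval:
  fixes f :: "real \<Rightarrow> real"
  assumes f: "continuous_on UNIV f" and dec: "\<And>a b. 0 < a \<Longrightarrow> a \<le> b \<Longrightarrow> b < T \<Longrightarrow> f b \<le> f a"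
    and "0 < T" "0 \<le> t" "t \<le> T"
  shows "f t \<le> f 0"
proof -
  have "f s \<le> f 0" if s: "0 < s" "s < T" for s
  proof -
    have "closed {a. f s \<le> f a}"
      by (intro closed_Collect_le f continuous_on_const)
    moreover have "{0<..<s} \<subseteq> {a. f s \<le> f a}" using dec s by auto
    ultimately have "closure {0<..<s} \<subseteq> {a. f s \<le> f a}" by (rule closure_minimal[rotated])
    moreover have "0 \<in> closure {0<..<s}" using s by simp
    ultimately show ?thesis by blast
  qed
  then have "{0<..<T} \<subseteq> {s. f s \<le> f 0}" by auto
  moreover have "closed {s. f s \<le> f 0}"
    by (intro closed_Collect_le f continuous_on_const)
  ultimately have "closure {0<..<T} \<subseteq> {s. f s \<le> f 0}" by (rule closure_minimal)
  then show ?thesis using assms by auto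
qed

section \<open>The flux\<close>

text \<open>
  The derivative is bounded on the compact closure of \<open>I\<close>, which makes the supremum an upper bound.  The
  estimate is stated with \<open>\<bar>L\<bar>\<close> since the supremum over an empty \<open>I\<close> is an unspecified number.
\<close>
lemma C1_Lipschitz_on_bounded_interval:
  fixes f :: "real \<Rightarrow> 'a::euclidean_space"
  assumes f: "f C1_differentiable_on UNIV" and I: "is_interval I" "bounded I"
    and L: "L = (SUP s\<in>I. norm (vector_derivative f (at s)))" and "p \<in> I" "q \<in> I"
  shows "norm (f p - f q) \<le> \<bar>L\<bar> * \<bar>p - q\<bar>"
proof -
  obtain D where D: "\<And>x. (f has_vector_derivative D x) (at x)" "continuous_on UNIV D"
    using f by (auto simp: C1_differentiable_on_def)
  have vd: "vector_derivative f (at s) = D s" for s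
    using D(1) by (rule vector_derivative_at)
  have "compact (closure I)" using I(2) by simp
  then have "compact (D ` closure I)"
    by (rule compact_continuous_image[OF continuous_on_subset[OF D(2)], rotated]) simp
  then have "bounded (D ` I)"
    using bounded_subset[OF compact_imp_bounded image_mono[OF closure_subset]] by blast
  then obtain B where B: "\<And>s. s \<in> I \<Longrightarrow> norm (D s) \<le> B"
    by (auto simp: bounded_iff)
  have bdd: "bdd_above ((\<lambda>s. norm (vector_derivative f (at s))) ` I)"
    by (rule bdd_aboveI2[of _ _ B]) (simp add: vd B)
  have le: "norm (D s) \<le> \<bar>L\<bar>" if "s \<in> I" for s
    using cSUP_upper[OF that bdd] by (simp add: L vd)
  have "norm (f p - f q) \<le> \<bar>L\<bar> * norm (p - q)"
  proof (rule differentiable_bound)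
    show "convex I" using I(1) by (simp add: is_interval_convex_1)
    show "(f has_derivative (\<lambda>h. h *\<^sub>R D s)) (at s within I)" if "s \<in> I" for s
      using D(1)[of s] unfolding has_vector_derivative_def by (rule has_derivative_at_withinI)
    show "onorm (\<lambda>h. h *\<^sub>R D s) \<le> \<bar>L\<bar>" if "s \<in> I" for s
      by (rule onorm_le) (simp add: mult.commute mult_left_mono[OF le[OF that]])
  qed (use assms in auto)
  then show ?thesis by simp
qed

lemma C1_bounded_on_bounded:
  fixes f :: "real \<Rightarrow> 'a::euclidean_space"
  assumes f: "f C1_differentiable_on UNIV" and I: "bounded I"
  shows "continuous_on UNIV f" "\<exists>B. \<forall>s\<in>I. norm (f s) \<le> B"
proof -
  show c: "continuous_on UNIV f"
    using f by (rule C1_differentiable_imp_continuous_on)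
  have "compact (f ` closure I)"
    using I by (intro compact_continuous_image continuous_on_subset[OF c]) auto
  then have "bounded (f ` I)"
    using bounded_subset[OF compact_imp_bounded image_mono[OF closure_subset]] by blast
  then show "\<exists>B. \<forall>s\<in>I. norm (f s) \<le> B" by (auto simp: bounded_iff)
qed

section \<open>The estimate at a fixed time\<close>

text \<open>
  \<open>Fa\<close> and \<open>Fb\<close> are the values at \<open>e\<close> of the time derivatives of \<open>a\<close> and \<open>b\<close>.  With \<open>X = \<parallel>\<nabla>e\<parallel>\<close>, \<open>A = \<bar>L\<bar> \<parallel>e\<parallel>\<close>
  and \<open>D = C \<parallel>r\<parallel>\<close> the difference of the two equations gives \<open>Fa - Fb \<le> (A + D) X - \<nu> X\<^sup>2\<close>, which is at most
  \<open>(A + D)\<^sup>2/(4\<nu>)\<close>.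
\<close>
lemma residual_error_estimate:
  fixes f :: "real \<Rightarrow> 'a::euclidean_space" and a b r :: "'a \<Rightarrow> real"
  assumes \<Omega>: "bounded \<Omega>" "open \<Omega>" and "0 < \<nu>" and ab: "a \<in> H1 \<Omega>" "b \<in> H1 \<Omega>" and r: "r \<in> L2_space \<Omega>"
    and e: "e = (\<lambda>x. a x - b x)"
    and Fa: "Fa + weak_div \<Omega> (\<lambda>x. f (a x)) e - \<nu> * weak_laplacian \<Omega> a e = 0"
    and Fb: "Fb + weak_div \<Omega> (\<lambda>x. f (b x)) e - \<nu> * weak_laplacian \<Omega> b e = (LINT x|lebesgue_on \<Omega>. r x * e x)"
    and I: "AE x in lebesgue_on \<Omega>. b x \<in> I \<and> a x \<in> I"
    and f: "continuous_on UNIV f" "\<And>s. s \<in> I \<Longrightarrow> norm (f s) \<le> B"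
    and L: "\<And>p q. p \<in> I \<Longrightarrow> q \<in> I \<Longrightarrow> norm (f p - f q) \<le> \<bar>L\<bar> * \<bar>p - q\<bar>"
    and C: "0 < C" "L2_norm \<Omega> e \<le> C * L2_norm \<Omega> (wgrad \<Omega> e)"
  shows "2 * (Fa - Fb) \<le> L\<^sup>2 / \<nu> * (L2_norm \<Omega> e)\<^sup>2 + C\<^sup>2 / \<nu> * (L2_norm \<Omega> r)\<^sup>2"
proof -
  let ?M = "lebesgue_on \<Omega>" and ?G = "wgrad \<Omega> e"
  have eH: "e \<in> H1 \<Omega>" unfolding e by (rule H1_diff(1)[OF \<Omega> ab])
  have eL: "e \<in> L2_space \<Omega>" and GL: "?G \<in> L2_space \<Omega>" using H1D[OF eH] by auto
  have am: "a \<in> borel_measurable ?M" and bm: "b \<in> borel_measurable ?M"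
    using H1D(1)[OF ab(1)] H1D(1)[OF ab(2)] by (auto dest: L2_spaceD)
  have fm: "(\<lambda>x. f (c x)) \<in> borel_measurable ?M" if "c \<in> borel_measurable ?M" for c
    using measurable_compose[OF that borel_measurable_continuous_onI[OF f(1)]] .
  have fa: "(\<lambda>x. f (a x)) \<in> L2_space \<Omega>" 
    by (rule L2_space_bounded_measurable[OF \<Omega> fm[OF am], of B]) (use I in eventually_elim, simp add: f(2))
  have fb: "(\<lambda>x. f (b x)) \<in> L2_space \<Omega>"
    by (rule L2_space_bounded_measurable[OF \<Omega> fm[OF bm], of B]) (use I in eventually_elim, simp add: f(2))
  have fd: "(\<lambda>x. f (a x) - f (b x)) \<in> L2_space \<Omega>" using fa fb by (rule L2_space_diff)
  have "(L2_norm \<Omega> (\<lambda>x. f (a x) - f (b x)))\<^sup>2 \<le> (\<bar>L\<bar> * L2_norm \<Omega> e)\<^sup>2"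
  proof -
    have "(LINT x|?M. (norm (f (a x) - f (b x)))\<^sup>2) \<le> (LINT x|?M. \<bar>L\<bar>\<^sup>2 * (norm (e x))\<^sup>2)"
    proof (rule integral_mono_AE)
      show "integrable ?M (\<lambda>x. (norm (f (a x) - f (b x)))\<^sup>2)" using fd by (rule L2_spaceD)
      show "integrable ?M (\<lambda>x. \<bar>L\<bar>\<^sup>2 * (norm (e x))\<^sup>2)"
        using L2_spaceD(2)[OF eL] by (rule integrable_mult_right)
      show "AE x in ?M. (norm (f (a x) - f (b x)))\<^sup>2 \<le> \<bar>L\<bar>\<^sup>2 * (norm (e x))\<^sup>2"
        using I
      proof eventually_elim
        case (elim x)
        then have "(norm (f (a x) - f (b x)))\<^sup>2 \<le> (\<bar>L\<bar> * \<bar>a x - b x\<bar>)\<^sup>2"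
          by (intro power_mono L) auto
        then show ?case by (simp only: power_mult_distrib e real_norm_def)
      qed
    qed
    from this[unfolded power2_norm_eq_inner] show ?thesis
      unfolding L2_norm_power2 power_mult_distrib by simp
  qed
  then have flux: "L2_norm \<Omega> (\<lambda>x. f (a x) - f (b x)) \<le> \<bar>L\<bar> * L2_norm \<Omega> e"
    by (rule power2_le_imp_le) simp
  have ga: "wgrad \<Omega> a \<in> L2_space \<Omega>" and gb: "wgrad \<Omega> b \<in> L2_space \<Omega>"
    using H1D(3) ab by auto
  have Geq: "AE x in ?M. ?G x = wgrad \<Omega> a x - wgrad \<Omega> b x"
    using H1_lincomb(2)[OF \<Omega> ab, of 1 "-1"] by (simp add: e)
  have grad: "(LINT x|?M. wgrad \<Omega> a x \<bullet> ?G x) - (LINT x|?M. wgrad \<Omega> b x \<bullet> ?G x) = (L2_norm \<Omega> ?G)\<^sup>2"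
  proof -
    have "(LINT x|?M. wgrad \<Omega> a x \<bullet> ?G x) - (LINT x|?M. wgrad \<Omega> b x \<bullet> ?G x)
       = (LINT x|?M. (wgrad \<Omega> a x - wgrad \<Omega> b x) \<bullet> ?G x)"
      using L2_inner_integrable[OF ga GL] L2_inner_integrable[OF gb GL] by (simp add: inner_diff_left)
    also have "\<dots> = (LINT x|?M. ?G x \<bullet> ?G x)"
    proof (rule integral_cong_AE)
      show "(\<lambda>x. (wgrad \<Omega> a x - wgrad \<Omega> b x) \<bullet> ?G x) \<in> borel_measurable ?M"
        using L2_inner_integrable[OF L2_space_diff[OF ga gb] GL] by (rule borel_measurable_integrable)
      show "(\<lambda>x. ?G x \<bullet> ?G x) \<in> borel_measurable ?M"
        using L2_inner_integrable[OF GL GL] by (rule borel_measurable_integrable)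
    qed (use Geq in \<open>auto elim!: eventually_mono\<close>)
    finally show ?thesis by (simp add: L2_norm_power2)
  qed
  have conv: "(LINT x|?M. f (a x) \<bullet> ?G x) - (LINT x|?M. f (b x) \<bullet> ?G x)
     = (LINT x|?M. (f (a x) - f (b x)) \<bullet> ?G x)"
    using L2_inner_integrable[OF fa GL] L2_inner_integrable[OF fb GL] by (simp add: inner_diff_left)
  define X where "X = L2_norm \<Omega> ?G"
  define A where "A = \<bar>L\<bar> * L2_norm \<Omega> e"
  define D where "D = C * L2_norm \<Omega> r"
  have X0: "0 \<le> X" by (simp add: X_def)
  have "(LINT x|?M. (f (a x) - f (b x)) \<bullet> ?G x) \<le> L2_norm \<Omega> (\<lambda>x. f (a x) - f (b x)) * X"
    using L2_Cauchy_Schwarz[OF fd GL] by (simp add: X_def)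
  also have "\<dots> \<le> A * X" unfolding A_def by (rule mult_right_mono[OF flux X0])
  finally have 1: "(LINT x|?M. (f (a x) - f (b x)) \<bullet> ?G x) \<le> A * X" .
  have "- (LINT x|?M. r x * e x) \<le> L2_norm \<Omega> r * L2_norm \<Omega> e"
    using L2_Cauchy_Schwarz[OF r eL] by simp
  also have "\<dots> \<le> L2_norm \<Omega> r * (C * X)" unfolding X_def by (rule mult_left_mono[OF C(2)]) simp
  also have "\<dots> = D * X" by (simp add: D_def)
  finally have 2: "- (LINT x|?M. r x * e x) \<le> D * X" .
  have "Fa - Fb = (LINT x|?M. (f (a x) - f (b x)) \<bullet> ?G x) - \<nu> * X\<^sup>2 - (LINT x|?M. r x * e x)"
  proof -
    have "Fa = (LINT x|?M. f (a x) \<bullet> ?G x) - \<nu> * (LINT x|?M. wgrad \<Omega> a x \<bullet> ?G x)"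
      using Fa by (simp add: weak_div_def weak_laplacian_def)
    moreover have "Fb = (LINT x|?M. f (b x) \<bullet> ?G x) - \<nu> * (LINT x|?M. wgrad \<Omega> b x \<bullet> ?G x) + (LINT x|?M. r x * e x)"
      using Fb by (simp add: weak_div_def weak_laplacian_def)
    moreover have "\<nu> * (LINT x|?M. wgrad \<Omega> a x \<bullet> ?G x) - \<nu> * (LINT x|?M. wgrad \<Omega> b x \<bullet> ?G x) = \<nu> * X\<^sup>2"
      unfolding X_def grad[symmetric] by (simp add: right_diff_distrib)
    ultimately show ?thesis using conv by linarith
  qed
  then have 3: "Fa - Fb \<le> (A + D) * X - \<nu> * X\<^sup>2" using 1 2 by (simp add: distrib_right)
  have "(A + D) * X \<le> (A + D)\<^sup>2 / (4 * \<nu>) + \<nu> * X\<^sup>2"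
    using Young_weighted[of "2 * \<nu>" X "A + D"] \<open>0 < \<nu>\<close> by (simp add: mult.commute)
  moreover have "(A + D)\<^sup>2 \<le> 2 * (A\<^sup>2 + D\<^sup>2)"
    using sum_squares_bound[of A D] by (simp add: power2_sum)
  then have "(A + D)\<^sup>2 / (4 * \<nu>) \<le> 2 * (A\<^sup>2 + D\<^sup>2) / (4 * \<nu>)"
    using \<open>0 < \<nu>\<close> by (intro divide_right_mono) auto
  moreover have "2 * (A\<^sup>2 + D\<^sup>2) / (4 * \<nu>) = (A\<^sup>2 / \<nu> + D\<^sup>2 / \<nu>) / 2"
    using \<open>0 < \<nu>\<close> by (simp add: field_simps)
  ultimately have "2 * (Fa - Fb) \<le> A\<^sup>2 / \<nu> + D\<^sup>2 / \<nu>" using 3 by argo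
  then show ?thesis by (simp add: A_def D_def power_mult_distrib)
qed

section \<open>Boundary conditions\<close>

lemma H1_subspace_bc_space:
  assumes "bounded \<Omega>" "open \<Omega>" "admissible_domain bc \<Omega>"
  shows "H1_subspace \<Omega> (bc_space bc \<Omega>)"
proof (cases bc)
  case Dirichlet
  then show ?thesis using H1_subspace_H1_0[OF assms(1,2)] by simp
next
  case (Periodic a b)
  then show ?thesis using assms(3) H1_subspace_H1_per[of a b] by simp
qed

text \<open>
  In the periodic case equality of the spatial means makes the difference mean-free.
\<close>
lemma poincare_for_difference:
  assumes \<Omega>: "bounded \<Omega>" "open \<Omega>" and adm: "admissible_domain bc \<Omega>" and C: "poincare_constant bc \<Omega> C"
    and V: "v \<in> bc_space bc \<Omega>" "w \<in> bc_space bc \<Omega>"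
    and mean: "\<And>a b. bc = Periodic a b \<Longrightarrow> spatial_mean \<Omega> v = spatial_mean \<Omega> w"
  shows "L2_norm \<Omega> (\<lambda>x. w x - v x) \<le> C * L2_norm \<Omega> (wgrad \<Omega> (\<lambda>x. w x - v x))"
proof -
  note S = H1_subspace_bc_space[OF \<Omega> adm]
  have d: "(\<lambda>x. w x - v x) \<in> bc_space bc \<Omega>" by (rule H1_subspaceD(2)[OF S V(2,1)])
  show "L2_norm \<Omega> (\<lambda>x. w x - v x) \<le> C * L2_norm \<Omega> (wgrad \<Omega> (\<lambda>x. w x - v x))"
  proof (cases bc)
    case Dirichlet
    then show ?thesis using C d by auto
  next
    case (Periodic a b)
    have "integrable (lebesgue_on \<Omega>) v" "integrable (lebesgue_on \<Omega>) w"
      using V by (auto intro!: L2_space_imp_integrable[OF \<Omega>] H1D(1) H1_subspaceD(1)[OF S])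
    then have "spatial_mean \<Omega> (\<lambda>x. w x - v x) = spatial_mean \<Omega> w - spatial_mean \<Omega> v"
      by (simp add: spatial_mean_def diff_divide_distrib)
    then have "spatial_mean \<Omega> (\<lambda>x. w x - v x) = 0" using mean[OF Periodic] by simp
    then show ?thesis using C d Periodic by auto
  qed
qed

lemma bochner_L2_approx:
  assumes "w \<in> bochner_L2 X N T"
  shows "\<exists>s. (\<forall>n::nat. simple_function (lebesgue_on {0<..<T}) (s n)) \<and> (\<forall>n. \<forall>t\<in>{0<..<T}. s n t \<in> X) \<and>
    (AE t in lebesgue_on {0<..<T}. (\<lambda>n. N (\<lambda>x. w t x - s n t x)) \<longlonglongrightarrow> 0)"
proof -
  obtain s where "\<forall>n::nat. simple_function (lebesgue_on {0<..<T}) (s n) \<and> (\<forall>t\<in>space (lebesgue_on {0<..<T}). s n t \<in> X)"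
    "AE t in lebesgue_on {0<..<T}. (\<lambda>n. N (\<lambda>x. w t x - s n t x)) \<longlonglongrightarrow> 0"
    using assms unfolding bochner_L2_def bochner_measurable_def by blast
  then show ?thesis by (intro exI[of _ s]) auto
qed

section \<open>The energy inequality for the error\<close>

text \<open>
  Only \<open>w\<close> is approximated by simple functions with values in \<open>V\<close>; those of \<open>z\<close> have values in \<open>H\<^sup>1\<close>, and so
  have the differences, to which the replacement of values applies.  The weight \<open>\<mu>\<close> is the sum of the
  squared dual norms of both time derivatives.
\<close>
lemma energy_inequality_difference:
  fixes w z :: "real \<Rightarrow> 'a::euclidean_space \<Rightarrow> real"
  assumes \<Omega>: "bounded \<Omega>" "open \<Omega>" and V: "H1_subspace \<Omega> V" and T: "0 < T"
    and w: "evolution_class \<Omega> V V T w w'"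
    and z: "evolution_class \<Omega> V (H1 \<Omega>) T z z'" and zV: "AE t in lebesgue_on {0<..<T}. z t \<in> V"
    and ab: "0 < a" "a \<le> b" "b < T"
  shows "integrable (lebesgue_on {0<..<T}) (\<lambda>t. w' t (\<lambda>x. w t x - z t x) - z' t (\<lambda>x. w t x - z t x))"
    and "(L2_norm \<Omega> (\<lambda>x. w b x - z b x))\<^sup>2 - (L2_norm \<Omega> (\<lambda>x. w a x - z a x))\<^sup>2
      \<le> 2 * (LINT t|lebesgue_on {0<..<T}. indicator {a<..b} t * (w' t (\<lambda>x. w t x - z t x) - z' t (\<lambda>x. w t x - z t x)))"
proof -
  let ?M = "lebesgue_on {0<..<T}" and ?N = "H1_norm \<Omega>" and ?D = "dual_norm \<Omega> V"
  \<comment> \<open>Continuation by the end values outside \<open>[0,T]\<close>.\<close>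
  define cl where "cl t = max 0 (min T t)" for t
  have cl: "cl t = t" if "t \<in> {0<..<T}" for t using that by (simp add: cl_def)
  define e where "e t = (\<lambda>x. w (cl t) x - z (cl t) x)" for t
  have e_eq: "e t = (\<lambda>x. w t x - z t x)" if "t \<in> {0<..<T}" for t
    using cl[OF that] by (simp add: e_def)
  define ip where "ip v u = (LINT x|lebesgue_on \<Omega>. v x * (u x :: real))" for v u :: "'a \<Rightarrow> real"
  define W where "W t v = w' t v - z' t v" for t v
  define \<mu> where "\<mu> t = (?D (w' t))\<^sup>2 + (?D (z' t))\<^sup>2" for t
  have time: "AE t in ?M. t \<in> {0<..<T}" by (rule AE_I2) simp
  have wB: "w \<in> bochner_L2 V ?N T" and w'B: "w' \<in> bochner_L2 (dual_space \<Omega> V) ?D T" and wC: "continuous_L2 \<Omega> T w"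
    using w by (auto simp: evolution_class_def)
  have zB: "z \<in> bochner_L2 (H1 \<Omega>) ?N T" and z'B: "z' \<in> bochner_L2 (dual_space \<Omega> V) ?D T" and zC: "continuous_L2 \<Omega> T z"
    using z by (auto simp: evolution_class_def)
  have VH: "v \<in> V \<Longrightarrow> v \<in> H1 \<Omega>" for v by (rule H1_subspaceD(1)[OF V])
  have VL: "v \<in> V \<Longrightarrow> v \<in> L2_space \<Omega>" for v by (rule H1D(1)[OF VH])
  note w'F = bochner_dual_facts[OF \<Omega> V w'B] and z'F = bochner_dual_facts[OF \<Omega> V z'B]
  have eC: "L2_continuous \<Omega> e"
    unfolding e_def cl_def by (intro L2_continuous_diff L2_continuous_clamp wC zC T)
  then have eL: "e t \<in> L2_space \<Omega>" for t by (simp add: L2_continuous_def)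
  have wV: "AE t in ?M. w t \<in> V" using wB by (simp add: bochner_L2_def)
  have eV: "AE t in ?M. e t \<in> V"
    using time wV zV
  proof eventually_elim
    case (elim t)
    then show ?case unfolding e_eq[OF elim(1)] by (intro H1_subspaceD(2)[OF V])
  qed
  \<comment> \<open>A positive measure of times has \<open>w t \<in> V\<close>, so \<open>V\<close> is not empty.\<close>
  have V0: "(\<lambda>x. 0) \<in> V"
  proof -
    have "emeasure ?M (space ?M) \<noteq> 0"
      using T by (simp add: emeasure_restrict_space)
    then have "\<exists>t. w t \<in> V"
      using eventually_happens'[OF _ wV] by (simp add: ae_filter_eq_bot_iff)
    then obtain t where "w t \<in> V" by blast
    from H1_subspaceD(3)[OF V this, of 0] show ?thesis by simp
  qed
  have ip_diff_left: "ip (\<lambda>x. p x - q x) v = ip p v - ip q v"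
    if "p \<in> L2_space \<Omega>" "q \<in> L2_space \<Omega>" "v \<in> L2_space \<Omega>" for p q v
    using L2_mult_integrable[OF that(1,3)] L2_mult_integrable[OF that(2,3)] by (simp add: ip_def left_diff_distrib)
  have ip_diff_right: "ip v (\<lambda>x. p x - q x) = ip v p - ip v q"
    if "p \<in> L2_space \<Omega>" "q \<in> L2_space \<Omega>" "v \<in> L2_space \<Omega>" for p q v
    using L2_mult_integrable[OF that(3,1)] L2_mult_integrable[OF that(3,2)] by (simp add: ip_def right_diff_distrib)
  have ip_norm: "ip v v = (L2_norm \<Omega> v)\<^sup>2" for v by (simp add: ip_def L2_norm_power2)
  obtain s where s: "\<forall>n::nat. simple_function ?M (s n)" "\<forall>n. \<forall>t\<in>{0<..<T}. s n t \<in> V"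
    "AE t in ?M. (\<lambda>n. ?N (\<lambda>x. w t x - s n t x)) \<longlonglongrightarrow> 0"
    using bochner_L2_approx[OF wB] by blast
  obtain r where r: "\<forall>n::nat. simple_function ?M (r n)" "\<forall>n. \<forall>t\<in>{0<..<T}. r n t \<in> H1 \<Omega>"
    "AE t in ?M. (\<lambda>n. ?N (\<lambda>x. z t x - r n t x)) \<longlonglongrightarrow> 0"
    using bochner_L2_approx[OF zB] by blast
  have "\<exists>\<sigma>. (\<forall>m::nat. simple_function ?M (\<sigma> m)) \<and> (\<forall>m. \<forall>t\<in>{0<..<T}. \<sigma> m t \<in> V) \<and>
     (\<forall>m. integrable ?M (\<lambda>t. (?N (\<lambda>x. e t x - \<sigma> m t x))\<^sup>2)) \<and>
     (\<lambda>m. LINT t|?M. (?N (\<lambda>x. e t x - \<sigma> m t x))\<^sup>2) \<longlonglongrightarrow> 0 \<and>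
     (AE t in ?M. (\<lambda>m. ?N (\<lambda>x. e t x - \<sigma> m t x)) \<longlonglongrightarrow> 0)"
  proof (rule simple_approximation_in_subspace[OF \<Omega> V V0 eV])
    show "simple_function ?M (\<lambda>t x. s n t x - r n t x)" for n
      by (rule simple_function_compose2[where h="\<lambda>c d x. c x - d x"]) (use s(1) r(1) in auto)
    show "(\<lambda>x. s n t x - r n t x) \<in> H1 \<Omega>" if "t \<in> {0<..<T}" for n t
      using s(2) r(2) that by (intro H1_diff(1)[OF \<Omega>]) (auto intro: VH)
    show "AE t in ?M. (\<lambda>n. ?N (\<lambda>x. e t x - (s n t x - r n t x))) \<longlonglongrightarrow> 0"
      using time wV zV s(3) r(3)
    proof eventually_elim
      case (elim t)
      have le: "norm (?N (\<lambda>x. e t x - (s n t x - r n t x))) \<le> ?N (\<lambda>x. w t x - s n t x) + ?N (\<lambda>x. z t x - r n t x)"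
        for n
      proof -
        have st: "s n t \<in> H1 \<Omega>" "r n t \<in> H1 \<Omega>" using s(2) r(2) elim(1) by (auto intro: VH)
        have eq: "(\<lambda>x. e t x - (s n t x - r n t x)) = (\<lambda>x. (w t x - s n t x) - (z t x - r n t x))"
          unfolding e_eq[OF elim(1)] by (auto simp: algebra_simps)
        show ?thesis unfolding eq
          using H1_diff(2)[OF \<Omega> H1_diff(1)[OF \<Omega> VH[OF elim(2)] st(1)] H1_diff(1)[OF \<Omega> VH[OF elim(3)] st(2)]] by simp
      qed
      have "(\<lambda>n. ?N (\<lambda>x. w t x - s n t x) + ?N (\<lambda>x. z t x - r n t x)) \<longlonglongrightarrow> 0"
        using tendsto_add[OF elim(4,5)] by simp
      from Lim_null_squeeze[OF le this] show ?case .
    qed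
    show "integrable ?M (\<lambda>t. 2 * (?N (w t))\<^sup>2 + 2 * (?N (z t))\<^sup>2)"
      using wB zB by (simp add: bochner_L2_def)
    show "AE t in ?M. (?N (e t))\<^sup>2 \<le> 2 * (?N (w t))\<^sup>2 + 2 * (?N (z t))\<^sup>2"
      using time wV zV
    proof eventually_elim
      case (elim t)
      have "(?N (e t))\<^sup>2 \<le> (?N (w t) + ?N (z t))\<^sup>2"
        unfolding e_eq[OF elim(1)] by (intro power_mono H1_diff(2)[OF \<Omega> VH[OF elim(2)] VH[OF elim(3)]]) simp
      also have "\<dots> \<le> 2 * (?N (w t))\<^sup>2 + 2 * (?N (z t))\<^sup>2"
        using sum_squares_bound[of "?N (w t)" "?N (z t)"] by (simp add: power2_sum)
      finally show ?case .
    qed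
  qed
  then obtain \<sigma> where \<sigma>: "\<forall>m::nat. simple_function ?M (\<sigma> m)" "\<forall>m. \<forall>t\<in>{0<..<T}. \<sigma> m t \<in> V"
    "\<forall>m. integrable ?M (\<lambda>t. (?N (\<lambda>x. e t x - \<sigma> m t x))\<^sup>2)"
    "(\<lambda>m. LINT t|?M. (?N (\<lambda>x. e t x - \<sigma> m t x))\<^sup>2) \<longlonglongrightarrow> 0"
    "AE t in ?M. (\<lambda>m. ?N (\<lambda>x. e t x - \<sigma> m t x)) \<longlonglongrightarrow> 0"
    by blast
  have energy: "integrable ?M (\<lambda>t. W t (e t)) \<and>
    ip (e b) (e b) - ip (e a) (e a) \<le> 2 * (LINT t|?M. indicator {a<..b} t * W t (e t))"
  proof (rule energy_inequality[OF ab, where ip=ip and w=e and V=V and W=W and \<mu>=\<mu> and N="?N" and \<sigma>=\<sigma>])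
    show "continuous_on UNIV (\<lambda>t. ip (e t) (e t))"
      unfolding ip_def by (rule L2_continuous_inner[OF eC eC])
    show "continuous_on UNIV (\<lambda>t. ip (e (t - h)) (e t))" for h
      unfolding ip_def by (rule L2_continuous_inner[OF L2_continuous_shift[OF eC] eC])
    show "ip (e t) (e t) - ip (e s) (e s) \<le> 2 * (ip (e t) (e t) - ip (e s) (e t))" for s t
    proof -
      have "0 \<le> ip (\<lambda>x. e t x - e s x) (\<lambda>x. e t x - e s x)" unfolding ip_norm by simp
      also have "\<dots> = ip (e t) (e t) - 2 * ip (e s) (e t) + ip (e s) (e s)"
        using eL by (simp add: ip_diff_left ip_diff_right L2_space_diff) (simp add: ip_def mult.commute)
      finally show ?thesis by simp
    qed
    show "continuous_on UNIV (\<lambda>t. ip (e t) v)" if "v \<in> V" for v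
      unfolding ip_def by (rule L2_continuous_inner[OF eC L2_continuous_const[OF VL[OF that]]])
    show "integrable ?M (\<lambda>t. W t v)" if "v \<in> V" for v
      unfolding W_def by (intro Bochner_Integration.integrable_diff w'F(3) z'F(3) that)
    show "ip (e t) v - ip (e s) v = (LINT r|?M. indicator {s<..t} r * W r v)"
      if v: "v \<in> V" and st: "0 < s" "s \<le> t" "t < T" for v s t
    proof -
      have S: "{s<..t} \<in> sets ?M" using st by (intro interval_sets_time) auto
      have ie: "ip (e r) v = ip (w r) v - ip (z r) v" if "r \<in> {0<..<T}" for r
        unfolding e_eq[OF that] using wC zC that VL[OF v] by (intro ip_diff_left) (auto simp: continuous_L2_def)
      have "(LINT r|?M. indicator {s<..t} r * W r v)
         = (LINT r|?M. indicator {s<..t} r * w' r v) - (LINT r|?M. indicator {s<..t} r * z' r v)"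
        using integrable_indicator_time[OF w'F(3)[OF v] S] integrable_indicator_time[OF z'F(3)[OF v] S]
        by (simp add: W_def right_diff_distrib)
      also have "\<dots> = (ip (w t) v - ip (w s) v) - (ip (z t) v - ip (z s) v)"
        unfolding ip_def evolution_class_FTC[OF \<Omega> V T w v st] evolution_class_FTC[OF \<Omega> V T z v st] ..
      finally show ?thesis using ie[of s] ie[of t] st by simp
    qed
    show "integrable ?M \<mu>"
      unfolding \<mu>_def by (intro Bochner_Integration.integrable_add w'F(2) z'F(2))
    show "AE t in ?M. 0 \<le> \<mu> t" by (simp add: \<mu>_def)
    show "AE r in ?M. \<forall>v\<in>V. \<forall>\<delta>>0. \<bar>W r v\<bar> \<le> \<delta> * \<mu> r + (?N v)\<^sup>2 / \<delta>"
      using w'F(1) z'F(1)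
    proof eventually_elim
      case (elim r)
      show ?case
      proof (intro ballI allI impI)
        fix v and \<delta> :: real assume v: "v \<in> V" and \<delta>: "0 < \<delta>"
        have "\<bar>W r v\<bar> \<le> ?D (w' r) * ?N v + ?D (z' r) * ?N v"
          unfolding W_def using dual_norm_bound[OF \<Omega> V elim(1) v] dual_norm_bound[OF \<Omega> V elim(2) v] by linarith
        also have "\<dots> \<le> (\<delta> / 2 * (?D (w' r))\<^sup>2 + (?N v)\<^sup>2 / (2 * \<delta>)) + (\<delta> / 2 * (?D (z' r))\<^sup>2 + (?N v)\<^sup>2 / (2 * \<delta>))"
          by (intro add_mono Young_weighted \<delta>)
        also have "\<dots> = \<delta> / 2 * \<mu> r + (?N v)\<^sup>2 / \<delta>"
          using \<delta> by (simp add: \<mu>_def field_simps)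
        also have "\<dots> \<le> \<delta> * \<mu> r + (?N v)\<^sup>2 / \<delta>"
          using \<delta> by (intro add_right_mono mult_right_mono) (auto simp: \<mu>_def)
        finally show "\<bar>W r v\<bar> \<le> \<delta> * \<mu> r + (?N v)\<^sup>2 / \<delta>" .
      qed
    qed
    show "AE t in ?M. \<forall>u\<in>V. \<forall>v\<in>V. W t (\<lambda>x. u x - v x) = W t u - W t v"
      using w'F(1) z'F(1)
    proof eventually_elim
      case (elim t)
      then show ?case by (simp add: W_def dual_space_diff_arg[OF V])
    qed
    show "ip (e s) (\<lambda>x. u x - v x) = ip (e s) u - ip (e s) v" if "u \<in> V" "v \<in> V" for s u v
      using that by (intro ip_diff_right VL eL)
    show "(\<lambda>x. u x - v x) \<in> V" if "u \<in> V" "v \<in> V" for u v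
      using that by (rule H1_subspaceD(2)[OF V])
  qed (use \<sigma> eV in auto)
  have WE: "W t (e t) = w' t (\<lambda>x. w t x - z t x) - z' t (\<lambda>x. w t x - z t x)" if "t \<in> {0<..<T}" for t
    by (simp add: W_def e_eq[OF that])
  show "integrable ?M (\<lambda>t. w' t (\<lambda>x. w t x - z t x) - z' t (\<lambda>x. w t x - z t x))"
    by (subst Bochner_Integration.integrable_cong[OF refl WE[symmetric]]) (use energy in auto)
  have "(LINT t|?M. indicator {a<..b} t * W t (e t))
     = (LINT t|?M. indicator {a<..b} t * (w' t (\<lambda>x. w t x - z t x) - z' t (\<lambda>x. w t x - z t x)))"
    by (intro Bochner_Integration.integral_cong) (auto simp: WE)
  then show "(L2_norm \<Omega> (\<lambda>x. w b x - z b x))\<^sup>2 - (L2_norm \<Omega> (\<lambda>x. w a x - z a x))\<^sup>2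
      \<le> 2 * (LINT t|?M. indicator {a<..b} t * (w' t (\<lambda>x. w t x - z t x) - z' t (\<lambda>x. w t x - z t x)))"
    using energy ab by (simp add: ip_norm e_eq)
qed

section \<open>Stability of weak solutions with respect to the residual\<close>

theorem lemma4p1:
  fixes \<Omega> :: "'a::euclidean_space set"
    and bc :: "'a boundary_condition"
    and f :: "real \<Rightarrow> 'a"
    and u u\<nu> :: "real \<Rightarrow> 'a \<Rightarrow> real"
    and u' u\<nu>' :: "real \<Rightarrow> ('a \<Rightarrow> real) \<Rightarrow> real"
    and R :: "real \<Rightarrow> 'a \<Rightarrow> real"
    and I :: "real set"
    and T \<nu> C\<^sub>P L\<^sub>f :: real
  assumes "bounded \<Omega>" and "lipschitz_domain \<Omega>" and "admissible_domain bc \<Omega>"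
    and "T > 0" and "\<nu> > 0"
    and "f C1_differentiable_on UNIV"
    and "weak_solution \<Omega> (bc_space bc \<Omega>) T \<nu> f u\<nu> u\<nu>'"
    and "evolution_class \<Omega> (bc_space bc \<Omega>) (H1 \<Omega>) T u u'"
    and "AE t in lebesgue_on {0<..<T}. u t \<in> bc_space bc \<Omega>"
    and "\<And>a b t. bc = Periodic a b \<Longrightarrow> t \<in> {0..T} \<Longrightarrow> spatial_mean \<Omega> (u t) = spatial_mean \<Omega> (u\<nu> t)"
    and "has_L2_residual \<Omega> (bc_space bc \<Omega>) T \<nu> f u u' R"
    and "is_interval I" and "bounded I"
    and "AE t in lebesgue_on {0<..<T}. AE x in lebesgue_on \<Omega>. u t x \<in> I \<and> u\<nu> t x \<in> I"
    and "L\<^sub>f = (SUP s\<in>I. norm (vector_derivative f (at s)))"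
    and "poincare_constant bc \<Omega> C\<^sub>P"
  shows "\<forall>t\<in>{0..T}.
    L2_norm \<Omega> (\<lambda>x. u\<nu> t x - u t x)
      \<le> exp (L\<^sub>f\<^sup>2 / (2 * \<nu>) * t) *
         (L2_norm \<Omega> (\<lambda>x. u\<nu> 0 x - u 0 x)
          + C\<^sub>P / sqrt \<nu> * bochner_L2_norm (L2_norm \<Omega>) t R)"
proof -
  let ?M = "lebesgue_on {0<..<T}" and ?V = "bc_space bc \<Omega>"
  have \<Omega>: "bounded \<Omega>" "open \<Omega>" using assms(1,2) by (auto simp: lipschitz_domain_def)
  note T = \<open>T > 0\<close> and nu = \<open>\<nu> > 0\<close>
  have V: "H1_subspace \<Omega> ?V" by (rule H1_subspace_bc_space[OF \<Omega> assms(3)])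
  have ev: "evolution_class \<Omega> ?V ?V T u\<nu> u\<nu>'"
    and eq: "AE t in ?M. \<forall>v\<in>?V. residual_functional \<Omega> \<nu> f u\<nu> u\<nu>' t v = 0"
    using assms(7) by (auto simp: weak_solution_def)
  note ez = assms(8) and zV = assms(9)
  have RB: "R \<in> bochner_L2 (L2_space \<Omega>) (L2_norm \<Omega>) T"
    and req: "AE t in ?M. \<forall>v\<in>?V. residual_functional \<Omega> \<nu> f u u' t v = (LINT x|lebesgue_on \<Omega>. R t x * v x)"
    using assms(11) by (auto simp: has_L2_residual_def)
  have time: "AE t in ?M. t \<in> {0<..<T}" by (rule AE_I2) simp
  have uV: "AE t in ?M. u\<nu> t \<in> ?V" using ev by (auto simp: evolution_class_def bochner_L2_def)
  have RL: "AE t in ?M. R t \<in> L2_space \<Omega>" and Rint: "integrable ?M (\<lambda>t. (L2_norm \<Omega> (R t))\<^sup>2)"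
    using RB by (auto simp: bochner_L2_def)
  define e where "e t = (\<lambda>x. u\<nu> t x - u t x)" for t
  define S where "S t = u\<nu>' t (e t) - u' t (e t)" for t
  define \<kappa> where "\<kappa> = L\<^sub>f\<^sup>2 / \<nu>"
  define \<rho> where "\<rho> t = C\<^sub>P\<^sup>2 / \<nu> * (L2_norm \<Omega> (R t))\<^sup>2" for t
  have \<kappa>: "0 \<le> \<kappa>" using nu by (simp add: \<kappa>_def)
  have C: "0 < C\<^sub>P" using assms(16) by (cases bc) auto
  have \<rho>int: "integrable ?M \<rho>" unfolding \<rho>_def using Rint by (rule integrable_mult_right)
  have \<rho>nn: "AE t in ?M. 0 \<le> \<rho> t" using nu by (simp add: \<rho>_def)
  obtain B where B: "\<And>s. s \<in> I \<Longrightarrow> norm (f s) \<le> B"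
    using C1_bounded_on_bounded(2)[OF assms(6,13)] by blast
  have static: "AE t in ?M. 2 * S t \<le> \<kappa> * (L2_norm \<Omega> (e t))\<^sup>2 + \<rho> t"
    using time uV zV eq req RL assms(14)
  proof eventually_elim
    case (elim t)
    have mean: "spatial_mean \<Omega> (u t) = spatial_mean \<Omega> (u\<nu> t)" if "bc = Periodic a b" for a b
      using elim(1) by (intro assms(10)[OF that]) auto
    have eV: "e t \<in> ?V" unfolding e_def by (rule H1_subspaceD(2)[OF V elim(2,3)])
    show ?case
      unfolding S_def \<kappa>_def \<rho>_def
    proof (rule residual_error_estimate[OF \<Omega> nu H1_subspaceD(1)[OF V elim(2)] H1_subspaceD(1)[OF V elim(3)] elim(6) e_def])
      show "u\<nu>' t (e t) + weak_div \<Omega> (\<lambda>x. f (u\<nu> t x)) (e t) - \<nu> * weak_laplacian \<Omega> (u\<nu> t) (e t) = 0"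
        using elim(4) eV by (simp add: residual_functional_def)
      show "u' t (e t) + weak_div \<Omega> (\<lambda>x. f (u t x)) (e t) - \<nu> * weak_laplacian \<Omega> (u t) (e t)
          = (LINT x|lebesgue_on \<Omega>. R t x * e t x)"
        using elim(5) eV by (simp add: residual_functional_def)
      show "AE x in lebesgue_on \<Omega>. u t x \<in> I \<and> u\<nu> t x \<in> I" by (rule elim(7))
      show "continuous_on UNIV f" by (rule C1_bounded_on_bounded(1)[OF assms(6,13)])
      show "norm (f s) \<le> B" if "s \<in> I" for s using B that .
      show "norm (f p - f q) \<le> \<bar>L\<^sub>f\<bar> * \<bar>p - q\<bar>" if "p \<in> I" "q \<in> I" for p q
        by (rule C1_Lipschitz_on_bounded_interval[OF assms(6,12,13,15) that])
      show "0 < C\<^sub>P" by (rule C)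
      show "L2_norm \<Omega> (e t) \<le> C\<^sub>P * L2_norm \<Omega> (wgrad \<Omega> (e t))"
        unfolding e_def by (rule poincare_for_difference[OF \<Omega> assms(3,16) elim(3,2) mean])
    qed
  qed
  define cl where "cl t = max 0 (min T t)" for t
  define \<phi> where "\<phi> t = (L2_norm \<Omega> (\<lambda>x. u\<nu> (cl t) x - u (cl t) x))\<^sup>2" for t
  have \<phi>_eq: "\<phi> t = (L2_norm \<Omega> (e t))\<^sup>2" if "t \<in> {0..T}" for t
    using that by (simp add: \<phi>_def cl_def e_def)
  have \<phi>C: "continuous_on UNIV \<phi>"
  proof -
    have "L2_continuous \<Omega> (\<lambda>t x. u\<nu> (cl t) x - u (cl t) x)"
      unfolding cl_def using ev ez
      by (intro L2_continuous_diff L2_continuous_clamp T) (auto simp: evolution_class_def)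
    from L2_continuous_inner[OF this this] show ?thesis
      unfolding \<phi>_def[abs_def] L2_norm_power2 by simp
  qed
  obtain \<Phi> where \<Phi>: "\<And>x. (\<Phi> has_real_derivative \<phi> x) (at x)"
    using continuous_imp_antiderivative[OF \<phi>C] by blast
  have \<Phi>C: "continuous_on UNIV \<Phi>"
    by (rule continuous_at_imp_continuous_on) (use DERIV_isCont[OF \<Phi>] in blast)
  obtain P where P: "continuous_on UNIV P"
    "\<And>s t. 0 \<le> s \<Longrightarrow> s \<le> t \<Longrightarrow> t < T \<Longrightarrow> P t - P s = (LINT r|?M. indicator {s<..t} r * \<rho> r)"
    "\<And>t. P t = (LINT r|?M. indicator {..t} r * \<rho> r)" "\<And>s t. s \<le> t \<Longrightarrow> P s \<le> P t"
    by (rule primitive_time[OF \<rho>int \<rho>nn]) blast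
  \<comment> \<open>Here \<open>\<Phi>\<close> and \<open>P\<close> are primitives of \<open>\<phi> = \<parallel>e\<parallel>\<^sup>2\<close> and of \<open>\<rho> = C\<^sub>P\<^sup>2/\<nu> \<parallel>R\<parallel>\<^sup>2\<close>.\<close>
  have decr: "\<phi> b - \<kappa> * \<Phi> b - P b \<le> \<phi> a - \<kappa> * \<Phi> a - P a" if ab: "0 < a" "a \<le> b" "b < T" for a b
  proof -
    note E = energy_inequality_difference[OF \<Omega> V T ev ez zV ab, folded e_def S_def]
    have Sab: "{a<..b} \<in> sets ?M" using ab by (intro interval_sets_time) auto
    have \<phi>i: "has_bochner_integral ?M (\<lambda>t. indicator {a<..b} t * \<phi> t) (\<Phi> b - \<Phi> a)"
      using ab by (intro has_bochner_integral_time_interval \<Phi> \<phi>C) auto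
    have "\<phi> b - \<phi> a \<le> 2 * (LINT t|?M. indicator {a<..b} t * S t)"
      using E(2) ab by (simp add: \<phi>_eq e_def)
    also have "\<dots> = (LINT t|?M. 2 * (indicator {a<..b} t * S t))" by (rule integral_mult_right_zero[symmetric])
    also have "\<dots> \<le> (LINT t|?M. \<kappa> * (indicator {a<..b} t * \<phi> t) + indicator {a<..b} t * \<rho> t)"
    proof (rule integral_mono_AE)
      show "integrable ?M (\<lambda>t. 2 * (indicator {a<..b} t * S t))"
        by (intro integrable_mult_right integrable_indicator_time[OF _ Sab] E(1))
      show "integrable ?M (\<lambda>t. \<kappa> * (indicator {a<..b} t * \<phi> t) + indicator {a<..b} t * \<rho> t)"
        by (intro Bochner_Integration.integrable_add integrable_mult_right integrable.intros[OF \<phi>i]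
            integrable_indicator_time[OF \<rho>int Sab])
      show "AE t in ?M. 2 * (indicator {a<..b} t * S t) \<le> \<kappa> * (indicator {a<..b} t * \<phi> t) + indicator {a<..b} t * \<rho> t"
        using time static by eventually_elim (auto simp: indicator_def \<phi>_eq)
    qed
    also have "\<dots> = \<kappa> * (\<Phi> b - \<Phi> a) + (P b - P a)"
      using P(2)[of a b] ab \<phi>i integrable_indicator_time[OF \<rho>int Sab]
      by (simp add: has_bochner_integral_iff)
    finally show ?thesis by (simp add: right_diff_distrib)
  qed
  have growth: "\<phi> s \<le> \<phi> 0 + \<kappa> * (\<Phi> s - \<Phi> 0) + (P s - P 0)" if "0 \<le> s" "s \<le> T" for s
  proof -
    have "\<phi> s - \<kappa> * \<Phi> s - P s \<le> \<phi> 0 - \<kappa> * \<Phi> 0 - P 0"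
      by (rule nonincreasing_on_closed_interval[OF _ decr T that])
        (intro continuous_on_diff continuous_on_mult continuous_on_const \<phi>C \<Phi>C P(1))
    then show ?thesis by (simp add: right_diff_distrib)
  qed
  have P_eq: "P t - P 0 = C\<^sub>P\<^sup>2 / \<nu> * (bochner_L2_norm (L2_norm \<Omega>) t R)\<^sup>2" if t: "0 \<le> t" "t \<le> T" for t
  proof -
    have P0: "P 0 = 0"
    proof -
      have "P 0 = (LINT r|?M. 0)"
        unfolding P(3) by (intro Bochner_Integration.integral_cong) auto
      then show ?thesis by simp
    qed
    have \<rho>l: "(\<lambda>r. indicator {0<..<T} r * \<rho> r) \<in> borel_measurable lebesgue"
      using \<rho>int by (intro borel_measurable_integrable) (simp add: integrable_restrict_space)
    have "P t = (LINT r|lebesgue. indicator {..t} r * (indicator {0<..<T} r * \<rho> r))"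
      unfolding P(3) by (simp add: integral_restrict_space mult.left_commute)
    also have "\<dots> = (LINT r|lebesgue. indicator {0<..<t} r * (indicator {0<..<T} r * \<rho> r))"
    proof (rule integral_cong_AE)
      have "AE r in lebesgue. r \<noteq> t"
        by (rule AE_not_in[of "{t}", simplified]) (simp add: null_sets_completionI)
      then show "AE r in lebesgue. indicator {..t} r * (indicator {0<..<T} r * \<rho> r)
          = indicator {0<..<t} r * (indicator {0<..<T} r * \<rho> r)"
        by eventually_elim (auto simp: indicator_def)
    qed (intro borel_measurable_times borel_measurable_indicator \<rho>l; simp)+
    also have "\<dots> = (LINT r|lebesgue. indicator {0<..<t} r *\<^sub>R \<rho> r)"
      using t by (intro Bochner_Integration.integral_cong) (auto simp: indicator_def)
    also have "\<dots> = (LINT r|lebesgue_on {0<..<t}. \<rho> r)"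
      by (simp add: integral_restrict_space)
    also have "\<dots> = C\<^sub>P\<^sup>2 / \<nu> * (LINT r|lebesgue_on {0<..<t}. (L2_norm \<Omega> (R r))\<^sup>2)"
      unfolding \<rho>_def by (rule integral_mult_right_zero)
    also have "(LINT r|lebesgue_on {0<..<t}. (L2_norm \<Omega> (R r))\<^sup>2) = (bochner_L2_norm (L2_norm \<Omega>) t R)\<^sup>2"
      by (simp add: bochner_L2_norm_def)
    finally show ?thesis using P0 by simp
  qed
  show ?thesis
  proof
    fix t assume t: "t \<in> {0..T}"
    define E0 where "E0 = L2_norm \<Omega> (\<lambda>x. u\<nu> 0 x - u 0 x)"
    define RR where "RR = bochner_L2_norm (L2_norm \<Omega>) t R"
    have pos: "0 \<le> E0" "0 \<le> RR" by (simp_all add: E0_def RR_def bochner_L2_norm_def)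
    \<comment> \<open>\<open>P\<close> is nondecreasing, so \<open>P t\<close> replaces \<open>P s\<close> and leaves a constant for Gronwall's inequality.\<close>
    have "\<phi> t \<le> (\<phi> 0 + (P t - P 0)) * exp (\<kappa> * t)"
    proof (rule Gronwall_primitive[OF \<Phi> \<kappa>])
      show "0 \<le> t" using t by simp
      show "\<phi> s \<le> \<phi> 0 + (P t - P 0) + \<kappa> * (\<Phi> s - \<Phi> 0)" if "0 \<le> s" "s \<le> t" for s
        using growth[of s] P(4)[of s t] that t by simp
    qed
    also have "\<phi> 0 + (P t - P 0) = E0\<^sup>2 + C\<^sub>P\<^sup>2 / \<nu> * RR\<^sup>2"
      using P_eq[of t] \<phi>_eq[of 0] t T by (simp add: E0_def RR_def e_def)
    also have "\<dots> \<le> (E0 + C\<^sub>P / sqrt \<nu> * RR)\<^sup>2"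
      using pos C nu by (simp add: power2_sum power_mult_distrib power_divide)
    also have "exp (\<kappa> * t) = (exp (L\<^sub>f\<^sup>2 / (2 * \<nu>) * t))\<^sup>2"
      by (simp add: \<kappa>_def exp_double[symmetric])
    finally have "(L2_norm \<Omega> (e t))\<^sup>2 \<le> (exp (L\<^sub>f\<^sup>2 / (2 * \<nu>) * t) * (E0 + C\<^sub>P / sqrt \<nu> * RR))\<^sup>2"
      using \<phi>_eq[OF t] by (simp add: power_mult_distrib mult.commute mult_right_mono)
    then have "L2_norm \<Omega> (e t) \<le> exp (L\<^sub>f\<^sup>2 / (2 * \<nu>) * t) * (E0 + C\<^sub>P / sqrt \<nu> * RR)"
      by (rule power2_le_imp_le) (use pos C nu in simp)
    then show "L2_norm \<Omega> (\<lambda>x. u\<nu> t x - u t x)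
      \<le> exp (L\<^sub>f\<^sup>2 / (2 * \<nu>) * t) *
         (L2_norm \<Omega> (\<lambda>x. u\<nu> 0 x - u 0 x)
          + C\<^sub>P / sqrt \<nu> * bochner_L2_norm (L2_norm \<Omega>) t R)"
      by (simp add: e_def E0_def RR_def)
  qed
qed

end
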